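(* For every balanced block $\Lambda$ the $Q$-linear map $\mathrm{coeff}_\Lambda\colon\mathfrak A[\mathbf{KBN}]_\Lambda\to\mathfrak A[Q]_\Lambda$, which multiplies each basis element $\underline\lambda\nu\overline\mu$ by $\prod_C\mathrm{coeff}(C)$ (product over all circles $C$ of $\underline\lambda\,\overline\mu$ with their orientation given by $\nu$), is an isomorphism of graded $Q$-algebras. These maps extend to an isomorphism of graded $Q$-algebras $$\mathrm{coeff}\colon\ \mathfrak A[\mathbf{KBN}]\xrightarrow{\ \cong\ }\mathfrak A[Q].$$
   Context: Ground ring: $Q=\mathbb Z[\alpha,\varepsilon,\omega^{\pm1}]$, where $\varepsilon$ is a sign, i.e. $\varepsilon^2=1$; $\alpha$ has degree $4$, $\varepsilon,\omega$ have degree $0$. Weights, blocks. A weight is $\lambda=(\lambda_i)_{i\in\mathbb Z}$ with $\lambda_i\in\{\circ,\times,\vee,\wedge\}$ and $\lambda_i=\circ$ for $|i|\gg0$. Two weights are in the same block $\Lambda$ if they differ by permuting the symbols $\vee,\wedge$. The block sequence $\mathrm{seq}(\Lambda)$ is obtained by replacing $\vee,\wedge$ by $\star$. $\Lambda$ is balanced if it has equally many $\wedge$ and $\vee$. The cup diagram $\underline\lambda$ is obtained by successively connecting by cups (arcs below the line) neighbouring pairs $\vee\wedge$ ($\vee$ left, $\wedge$ right), ignoring $\circ,\times$ and already connected vertices; $\overline\lambda$ is its mirror image (cap diagram). Only weights $\lambda$ for which all $\star$-vertices lie on cups are used ("balanced weights"). $\underline\lambda\nu\overline\mu$ ($\nu\in\Lambda$)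 is oriented if each arc has one endpoint labelled $\vee$ and the other $\wedge$ by $\nu$; so each circle is oriented clockwise or anticlockwise (anticlockwise iff its rightmost vertex is $\wedge$). The degree of $\underline\lambda\nu\overline\mu$ is the number of cups and caps whose left end is $\wedge$ and right end is $\vee$. Positions. $p_\Lambda(i)=\#\{j\le i: \mathrm{seq}(\Lambda)_j=\star\}+2\#\{j\le i:\mathrm{seq}(\Lambda)_j=\times\}$. For a cup or cap $\gamma$ connecting $i<j$: $p_\Lambda(\gamma)=p_\Lambda(i)$, $d_\Lambda(\gamma)=p_\Lambda(j)-p_\Lambda(i)$ and $s_\Lambda(\gamma)=\tfrac12(d_\Lambda(\gamma)+1)$ (saddle width). For a circle $C$, $d_\Lambda(C)$ is the sum of $d_\Lambda$ over its cups and caps, and $t(C)$ is the position of its rightmost vertex. Arc algebra. $\mathfrak A[Q]_\Lambda$ is the free $Q$-module on all oriented $\underline\lambda\nu\overline\mu$, $\lambda,\mu$ balanced weights in $\Lambda$, $\nu\in\Lambda$; $\mathfrak A[Q]=\bigoplus_{\Lambda\text{ balanced}}\mathfrak A[Q]_\Lambda$ (products between different blocks are $0$). The product $(\underline\lambda\nu\overline\mu)(\underline{\mu'}\nu'\overline\eta)$ is $0$ if $\mu\ne\mu'$. If $\mu=\mu'$, put the second diagram on top of the first, giving a stacked diagram with middle part $\overline\mu\,\underline\mu$. Successively (from left to right) choose a mirror-symmetric cap/cup pair in the middle part which can be connected without crossing other arcs (the cap and cup both denoted $\gamma$, with vertices $i<j$) and replace it by two vertical lines at $i$ and $j$; circles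 not involved keep their orientations; the involved ones are reoriented, with coefficients as follows. At the end collapse the middle part. (1) Non-nested merge of $C_1,C_2$ into $C$: both anticlockwise $\mapsto$ $C$ anticlockwise, coefficient $1$; exactly one, $C_k$, clockwise $\mapsto$ $C$ clockwise, coefficient $\varepsilon^{t(C)-t(C_k)}$; both clockwise $\mapsto$ $C$ anticlockwise, coefficient $\alpha\,\varepsilon^{t(C)-t(C_1)}\varepsilon^{t(C)-t(C_2)}$. (2) Nested merge (inner circle $C_{\rm in}$): as in (1), with the additional factor $\varepsilon\cdot\varepsilon^{\frac14(d_\Lambda(C_{\rm in})-2)}\cdot\varepsilon^{s_\Lambda(\gamma)}$ in all cases. (3) Non-nested split of $C$ into $C_i\ni i$ and $C_j\ni j$: $C$ anticlockwise $\mapsto$ $\omega\varepsilon^{t(C_i)-p_\Lambda(i)}\varepsilon^{s_\Lambda(\gamma)}\cdot$($C_i$ clockwise, $C_j$ anticlockwise) $+$ $\varepsilon\omega\varepsilon^{t(C_j)-p_\Lambda(j)}\varepsilon^{s_\Lambda(\gamma)}\cdot$($C_j$ clockwise, $C_i$ anticlockwise); $C$ clockwise $\mapsto$ $\omega\varepsilon^{t(C)-t(C_j)}\varepsilon^{t(C_i)-p_\Lambda(i)}\varepsilon^{s_\Lambda(\gamma)}\cdot$(both clockwise) $+$ $\alpha\varepsilon\omega\varepsilon^{t(C)-t(C_j)}\varepsilon^{t(C_j)-p_\Lambda(j)}\varepsilon^{s_\Lambda(\gamma)}\cdot$(both anticlockwise). (4) Nested split of $C$ into $C_{\rm in},C_{\rm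 out}$, with $\kappa=\varepsilon^{\frac14(d_\Lambda(C_{\rm in})-2)}$: $C$ anticlockwise $\mapsto$ $\omega\kappa\cdot$($C_{\rm in}$ clockwise, $C_{\rm out}$ anticlockwise) $+$ $\varepsilon\omega\kappa\cdot$($C_{\rm out}$ clockwise, $C_{\rm in}$ anticlockwise); $C$ clockwise $\mapsto$ $\omega\kappa\cdot$(both clockwise) $+$ $\alpha\varepsilon\omega\kappa\cdot$(both anticlockwise). $\mathfrak A[\mathbf{KBN}]$ (with summands $\mathfrak A[\mathbf{KBN}]_\Lambda$) is the algebra with the same basis over $Q$ and the same rule with $\varepsilon$ and $\omega$ replaced by $1$ (only $\alpha$ remains), i.e. the specialization over $\mathbb Z[\alpha]$ extended to $Q$. Coefficients. For a circle $C$ let $\mathrm{icup}(C)$ be the set of cups of $C$ such that the exterior of $C$ is directly above the cup, and $\mathrm{icap}(C)$ the set of caps of $C$ such that the exterior of $C$ is directly below the cap (exterior with respect to $C$ only, ignoring other components). If $C$ is anticlockwise, $$\mathrm{coeff}(C)=\prod_{\gamma\in\mathrm{icup}(C)}\varepsilon^{(s_\Lambda(\gamma)+1)p_\Lambda(\gamma)}\omega^{-s_\Lambda(\gamma)}\cdot\prod_{\gamma\in\mathrm{icap}(C)}\varepsilon^{s_\Lambda(\gamma)(p_\Lambda(\gamma)+1)}\omega^{s_\Lambda(\gamma)-1};$$ if $C$ is clockwise, this is additionally multiplied by $\varepsilon^{t(C)}$. *)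

theory Defs
  imports
    "HOL-Library.Poly_Mapping"
    "HOL-Library.Product_Plus"
    "HOL-Library.Z2"
    "HOL-Combinatorics.Permutations"
begin

section \<open>The ground ring\<close>

text \<open>
  \<open>\<int>[\<alpha>, \<epsilon>, \<omega>, 1/\<omega>]\<close> with \<open>\<epsilon>\<^sup>2 = 1\<close> is the monoid ring over the integers of
  \<open>\<nat> \<times> \<int>/2 \<times> \<int>\<close>; the key \<open>(a, e, w)\<close> stands for the monomial \<open>\<alpha>^a \<epsilon>^e \<omega>^w\<close>,
  and multiplication is the convolution product of \<^theory>\<open>HOL-Library.Poly_Mapping\<close>.
\<close>

type_synonym Q = "(nat \<times> bit \<times> int) \<Rightarrow>\<^sub>0 int"

definition Q_alpha :: Q where
  "Q_alpha = Poly_Mapping.single (1, 0, 0) 1"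

definition Q_eps :: Q where
  "Q_eps = Poly_Mapping.single (0, 1, 0) 1"

definition Q_omega_pow :: "int \<Rightarrow> Q" where
  "Q_omega_pow k = Poly_Mapping.single (0, 0, k) 1"

definition Q_omega :: Q where
  "Q_omega = Q_omega_pow 1"

lemma Q_eps_squared: "Q_eps * Q_eps = 1"
  by (simp add: Q_eps_def mult_single flip: zero_prod_def)

lemma Q_omega_pow_0: "Q_omega_pow 0 = 1"
  by (simp add: Q_omega_pow_def flip: zero_prod_def)

lemma Q_omega_pow_add: "Q_omega_pow (k + l) = Q_omega_pow k * Q_omega_pow l"
  by (simp add: Q_omega_pow_def mult_single)


section \<open>Free modules\<close>

definition smult :: "'r::comm_ring_1 \<Rightarrow> ('b \<Rightarrow>\<^sub>0 'r) \<Rightarrow> ('b \<Rightarrow>\<^sub>0 'r)" where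
  "smult q x = Poly_Mapping.map ((*) q) x"

definition lin_ext :: "('b \<Rightarrow> ('c \<Rightarrow>\<^sub>0 'r::comm_ring_1)) \<Rightarrow> ('b \<Rightarrow>\<^sub>0 'r) \<Rightarrow> ('c \<Rightarrow>\<^sub>0 'r)" where
  "lin_ext f x = (\<Sum>b\<in>Poly_Mapping.keys x. smult (Poly_Mapping.lookup x b) (f b))"


section \<open>Weights and blocks\<close>

text \<open>Weights are called \<open>\<xi>\<close>, \<open>\<nu>\<close>, \<open>\<mu>\<close>, \<open>\<eta>\<close>, as the usual letter for the first is a binder here.\<close>

datatype wsymbol = Circ | Cross | Down | Up
  \<comment> \<open>\<open>\<circ>\<close>, \<open>\<times>\<close>, \<open>\<or>\<close>, \<open>\<and>\<close>\<close>

type_synonym weight = "int \<Rightarrow> wsymbol"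

definition is_weight :: "weight \<Rightarrow> bool" where
  "is_weight \<xi> \<longleftrightarrow> (\<exists>N. \<forall>i. \<bar>i\<bar> > N \<longrightarrow> \<xi> i = Circ)"

definition same_block :: "weight \<Rightarrow> weight \<Rightarrow> bool" where
  "same_block \<xi> \<mu> \<longleftrightarrow> (\<exists>\<pi>. \<pi> permutes {i. \<xi> i = Down \<or> \<xi> i = Up} \<and> \<mu> = \<xi> \<circ> \<pi>)"

definition block_of :: "weight \<Rightarrow> weight set" where
  "block_of \<xi> = {\<mu>. same_block \<xi> \<mu>}"

definition is_block :: "weight set \<Rightarrow> bool" where
  "is_block \<Lambda> \<longleftrightarrow> (\<exists>\<xi>. is_weight \<xi> \<and> \<Lambda> = block_of \<xi>)"

definition balanced_block :: "weight set \<Rightarrow> bool" where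
  "balanced_block \<Lambda> \<longleftrightarrow> is_block \<Lambda> \<and> (\<forall>\<xi>\<in>\<Lambda>. card {i. \<xi> i = Up} = card {i. \<xi> i = Down})"

datatype bsymbol = BCirc | BCross | BStar

fun forget :: "wsymbol \<Rightarrow> bsymbol" where
  "forget Circ = BCirc"
| "forget Cross = BCross"
| "forget Down = BStar"
| "forget Up = BStar"

text \<open>The choice is harmless: all weights of a block have the same underlying sequence.\<close>

definition block_seq :: "weight set \<Rightarrow> int \<Rightarrow> bsymbol" where
  "block_seq \<Lambda> i = forget ((SOME \<xi>. \<xi> \<in> \<Lambda>) i)"

definition pos :: "weight set \<Rightarrow> int \<Rightarrow> nat" where
  "pos \<Lambda> i = card {j. j \<le> i \<and> block_seq \<Lambda> j = BStar} + 2 * card {j. j \<le> i \<and> block_seq \<Lambda> j = BCross}"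

lemma forget_same_block:
  assumes "same_block \<xi> \<mu>"
  shows "forget (\<mu> i) = forget (\<xi> i)"
proof -
  obtain \<pi> where \<pi>: "\<pi> permutes {i. \<xi> i = Down \<or> \<xi> i = Up}" and \<mu>: "\<mu> = \<xi> \<circ> \<pi>"
    using assms unfolding same_block_def by blast
  have star: "forget s = BStar \<longleftrightarrow> s = Down \<or> s = Up" for s
    by (cases s) simp_all
  show ?thesis
  proof (cases "\<xi> i = Down \<or> \<xi> i = Up")
    case True
    then have "\<xi> (\<pi> i) = Down \<or> \<xi> (\<pi> i) = Up"
      using permutes_in_image[OF \<pi>, of i] by blast
    with True have "forget (\<xi> (\<pi> i)) = BStar" "forget (\<xi> i) = BStar"
      unfolding star by blast+
    then show ?thesis unfolding \<mu> comp_def by (rule trans[OF _ sym])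
  next
    case False
    then have "\<pi> i = i"
      using permutes_not_in[OF \<pi>, of i] by blast
    then show ?thesis unfolding \<mu> comp_def by (rule arg_cong)
  qed
qed

lemma block_seq_block_of: "block_seq (block_of \<xi>) i = forget (\<xi> i)"
proof -
  have "same_block \<xi> \<xi>"
    unfolding same_block_def by (rule exI[of _ id]) (simp add: permutes_id)
  then have "\<xi> \<in> block_of \<xi>"
    by (simp add: block_of_def)
  then have "(SOME \<mu>. \<mu> \<in> block_of \<xi>) \<in> block_of \<xi>"
    by (rule someI[where P = "\<lambda>\<mu>. \<mu> \<in> block_of \<xi>"])
  then have "same_block \<xi> (SOME \<mu>. \<mu> \<in> block_of \<xi>)"
    by (simp only: block_of_def mem_Collect_eq)
  then show ?thesis
    unfolding block_seq_def by (rule forget_same_block)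
qed


section \<open>Cup diagrams\<close>

type_synonym arc = "int \<times> int"

text \<open>
  A pair \<open>\<or>\<and>\<close> gets connected iff every vertex strictly between its two ends is \<open>\<circ>\<close>, \<open>\<times>\<close>,
  or has been connected before; by planarity the partner of such a vertex lies strictly between
  the two ends as well, and requiring this ensures that the ends are not used twice.
  The same set of arcs encodes the cap diagram, which is the mirror image.
\<close>

inductive_set arcs :: "weight \<Rightarrow> arc set" for \<xi> :: weight where
  connect: "\<lbrakk>\<xi> i = Down; \<xi> j = Up; i < j;
     \<And>k. \<lbrakk>i < k; k < j\<rbrakk> \<Longrightarrow> \<xi> k = Circ \<or> \<xi> k = Cross \<or>
        (\<exists>a b. (a, b) \<in> arcs \<xi> \<and> i < a \<and> b < j \<and> (k = a \<or> k = b))\<rbrakk>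
   \<Longrightarrow> (i, j) \<in> arcs \<xi>"

definition balanced_weight :: "weight \<Rightarrow> bool" where
  "balanced_weight \<xi> \<longleftrightarrow>
     is_weight \<xi> \<and> (\<forall>k. \<xi> k = Down \<or> \<xi> k = Up \<longrightarrow> (\<exists>a b. (a, b) \<in> arcs \<xi> \<and> (k = a \<or> k = b)))"

definition oriented_by :: "arc set \<Rightarrow> weight \<Rightarrow> bool" where
  "oriented_by A \<nu> \<longleftrightarrow>
     (\<forall>(i, j)\<in>A. (\<nu> i = Down \<and> \<nu> j = Up) \<or> (\<nu> i = Up \<and> \<nu> j = Down))"

text \<open>\<open>(\<xi>, \<nu>, \<mu>)\<close> is the diagram with cup diagram of \<open>\<xi>\<close>, orientation \<open>\<nu>\<close>, cap diagram of \<open>\<mu>\<close>.\<close>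

type_synonym basis = "weight \<times> weight \<times> weight"

definition arc_basis :: "weight set \<Rightarrow> basis set" where
  "arc_basis \<Lambda> = {(\<xi>, \<nu>, \<mu>). \<xi> \<in> \<Lambda> \<and> \<nu> \<in> \<Lambda> \<and> \<mu> \<in> \<Lambda> \<and> balanced_weight \<xi> \<and> balanced_weight \<mu> \<and>
     oriented_by (arcs \<xi>) \<nu> \<and> oriented_by (arcs \<mu>) \<nu>}"

fun basis_degree :: "basis \<Rightarrow> nat" where
  "basis_degree (\<xi>, \<nu>, \<mu>) =
     card {(i, j) \<in> arcs \<xi>. \<nu> i = Up \<and> \<nu> j = Down} + card {(i, j) \<in> arcs \<mu>. \<nu> i = Up \<and> \<nu> j = Down}"


section \<open>Circles in (stacked) diagrams\<close>

text \<open>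
  Diagrams have vertices on two horizontal lines; a cup hangs below and a cap stands on the
  line of its level, and \<open>vlines\<close> are the vertical lines from the lower to the upper level.
  Diagrams that are not stacked use the lower level only.
\<close>

datatype level = Lower | Upper

type_synonym vertex = "level \<times> int"

type_synonym circle = "vertex set"

record diagram =
  cups :: "(level \<times> arc) set"
  caps :: "(level \<times> arc) set"
  vlines :: "int set"

definition basic_diagram :: "weight \<Rightarrow> weight \<Rightarrow> diagram" where
  "basic_diagram \<xi> \<mu> = \<lparr>cups = {Lower} \<times> arcs \<xi>, caps = {Lower} \<times> arcs \<mu>, vlines = {}\<rparr>"

definition stacked_diagram :: "weight \<Rightarrow> weight \<Rightarrow> weight \<Rightarrow> diagram" where
  "stacked_diagram \<xi> \<mu> \<eta> =
     \<lparr>cups = {Lower} \<times> arcs \<xi> \<union> {Upper} \<times> arcs \<mu>,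
      caps = {Lower} \<times> arcs \<mu> \<union> {Upper} \<times> arcs \<eta>,
      vlines = {}\<rparr>"

definition cut :: "diagram \<Rightarrow> arc \<Rightarrow> diagram" where
  "cut D \<gamma> = \<lparr>cups = cups D - {(Upper, \<gamma>)}, caps = caps D - {(Lower, \<gamma>)},
     vlines = vlines D \<union> {fst \<gamma>, snd \<gamma>}\<rparr>"

definition adjacency :: "diagram \<Rightarrow> (vertex \<times> vertex) set" where
  "adjacency D =
     (let R = {((l, i), (l, j)) | l i j. (l, i, j) \<in> cups D \<union> caps D} \<union>
              {((Lower, i), (Upper, i)) | i. i \<in> vlines D}
      in R \<union> R\<inverse>)"

definition circle_of :: "diagram \<Rightarrow> vertex \<Rightarrow> circle" where
  "circle_of D v = (adjacency D)\<^sup>* `` {v}"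

definition circles :: "diagram \<Rightarrow> circle set" where
  "circles D = circle_of D ` Domain (adjacency D)"

text \<open>
  All diagrams are finite and meet each of the two horizontal lines transversally and only in
  vertices. So a point on a line (away from \<open>C\<close>) is in the interior of \<open>C\<close> iff the ray on that
  line to the right of the point meets \<open>C\<close> an odd number of times.
\<close>

definition odd_to_the_right :: "circle \<Rightarrow> vertex \<Rightarrow> bool" where
  "odd_to_the_right C v \<longleftrightarrow> odd (card {y. snd v < y \<and> (fst v, y) \<in> C})"

definition nested_in :: "circle \<Rightarrow> circle \<Rightarrow> bool" where
  "nested_in C C' \<longleftrightarrow> C \<inter> C' = {} \<and> (\<forall>v\<in>C. odd_to_the_right C' v)"

text \<open>
  The exterior of \<open>C\<close> is directly above one of its cups (below one of its caps) iff the points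
  of the line just to the right of the left end of the cup (cap) are exterior.
\<close>

definition icup :: "diagram \<Rightarrow> circle \<Rightarrow> (level \<times> arc) set" where
  "icup D C = {(l, i, j) \<in> cups D. (l, i) \<in> C \<and> \<not> odd_to_the_right C (l, i)}"

definition icap :: "diagram \<Rightarrow> circle \<Rightarrow> (level \<times> arc) set" where
  "icap D C = {(l, i, j) \<in> caps D. (l, i) \<in> C \<and> \<not> odd_to_the_right C (l, i)}"

text \<open>
  In a stacked diagram a circle may have a rightmost vertex on each of the two levels; in an
  oriented diagram these carry the same label. Orientations of the circles of a diagram are
  encoded by the set of its clockwise circles.
\<close>

definition anticlockwise :: "(vertex \<Rightarrow> wsymbol) \<Rightarrow> circle \<Rightarrow> bool" where
  "anticlockwise lab C \<longleftrightarrow> (\<forall>v\<in>C. snd v = Max (snd ` C) \<longrightarrow> lab v = Up)"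

definition clockwise_circles :: "diagram \<Rightarrow> (vertex \<Rightarrow> wsymbol) \<Rightarrow> circle set" where
  "clockwise_circles D lab = {C \<in> circles D. \<not> anticlockwise lab C}"


section \<open>Positions, distances, saddle widths\<close>

text \<open>
  In what follows \<open>p\<close> is the position function of a block. It is monotone, so the differences
  of natural numbers below (and in the exponents of the surgery rules) are never truncated.
  The divisions by 2 and 4 are exact: distances of cups and caps are odd, and
  \<open>d(C) mod 4 = 2\<close> for every circle \<open>C\<close>.
\<close>

fun arc_dist :: "(int \<Rightarrow> nat) \<Rightarrow> arc \<Rightarrow> nat" where
  "arc_dist p (i, j) = p j - p i"

definition saddle_width :: "(int \<Rightarrow> nat) \<Rightarrow> arc \<Rightarrow> nat" where
  "saddle_width p \<gamma> = (arc_dist p \<gamma> + 1) div 2"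

definition circle_dist :: "(int \<Rightarrow> nat) \<Rightarrow> diagram \<Rightarrow> circle \<Rightarrow> nat" where
  "circle_dist p D C =
     (\<Sum>(l, \<gamma>)\<in>{(l, \<gamma>) \<in> cups D. (l, fst \<gamma>) \<in> C}. arc_dist p \<gamma>) +
     (\<Sum>(l, \<gamma>)\<in>{(l, \<gamma>) \<in> caps D. (l, fst \<gamma>) \<in> C}. arc_dist p \<gamma>)"

definition rightmost :: "(int \<Rightarrow> nat) \<Rightarrow> circle \<Rightarrow> nat" where
  "rightmost p C = p (Max (snd ` C))"


section \<open>Surgeries\<close>

text \<open>
  The rules are stated for arbitrary parameters \<open>\<alpha>\<close>, \<open>\<epsilon>\<close>, \<open>\<omega>\<close>, so that the algebra in which
  \<open>\<epsilon>\<close> and \<open>\<omega>\<close> are replaced by 1 is obtained from the same definition.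
  \<open>K\<close> is the set of clockwise circles before the surgery \<open>\<gamma>\<close> in the diagram \<open>D\<close>.
\<close>

definition merge ::
  "'r::comm_ring_1 \<Rightarrow> 'r \<Rightarrow> (int \<Rightarrow> nat) \<Rightarrow> diagram \<Rightarrow> arc \<Rightarrow> circle \<Rightarrow> circle \<Rightarrow> circle
    \<Rightarrow> circle set \<Rightarrow> (circle set \<Rightarrow>\<^sub>0 'r)" where
  "merge \<alpha> \<epsilon> p D \<gamma> C1 C2 C K =
     (let t = rightmost p;
          nest = (\<lambda>Cin. \<epsilon> * \<epsilon> ^ ((circle_dist p D Cin - 2) div 4) * \<epsilon> ^ saddle_width p \<gamma>);
          \<kappa> = (if nested_in C1 C2 then nest C1 else if nested_in C2 C1 then nest C2 else 1);
          K0 = K - {C1, C2}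
      in if C1 \<notin> K \<and> C2 \<notin> K then Poly_Mapping.single K0 \<kappa>
         else if C1 \<in> K \<and> C2 \<notin> K then Poly_Mapping.single (insert C K0) (\<kappa> * \<epsilon> ^ (t C - t C1))
         else if C1 \<notin> K \<and> C2 \<in> K then Poly_Mapping.single (insert C K0) (\<kappa> * \<epsilon> ^ (t C - t C2))
         else Poly_Mapping.single K0 (\<kappa> * \<alpha> * \<epsilon> ^ (t C - t C1) * \<epsilon> ^ (t C - t C2)))"

definition nonnested_split ::
  "'r::comm_ring_1 \<Rightarrow> 'r \<Rightarrow> 'r \<Rightarrow> (int \<Rightarrow> nat) \<Rightarrow> arc \<Rightarrow> circle \<Rightarrow> circle \<Rightarrow> circle
    \<Rightarrow> circle set \<Rightarrow> (circle set \<Rightarrow>\<^sub>0 'r)" where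
  "nonnested_split \<alpha> \<epsilon> \<omega> p \<gamma> C Ci Cj K =
     (let t = rightmost p; i = fst \<gamma>; j = snd \<gamma>; s = saddle_width p \<gamma>; K0 = K - {C}
      in if C \<notin> K then
           Poly_Mapping.single (insert Ci K0) (\<omega> * \<epsilon> ^ (t Ci - p i) * \<epsilon> ^ s) +
           Poly_Mapping.single (insert Cj K0) (\<epsilon> * \<omega> * \<epsilon> ^ (t Cj - p j) * \<epsilon> ^ s)
         else
           Poly_Mapping.single (insert Ci (insert Cj K0))
             (\<omega> * \<epsilon> ^ (t C - t Cj) * \<epsilon> ^ (t Ci - p i) * \<epsilon> ^ s) +
           Poly_Mapping.single K0
             (\<alpha> * \<epsilon> * \<omega> * \<epsilon> ^ (t C - t Cj) * \<epsilon> ^ (t Cj - p j) * \<epsilon> ^ s))"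

text \<open>Here \<open>D'\<close> is the diagram after the surgery, which contains the inner circle.\<close>

definition nested_split ::
  "'r::comm_ring_1 \<Rightarrow> 'r \<Rightarrow> 'r \<Rightarrow> (int \<Rightarrow> nat) \<Rightarrow> diagram \<Rightarrow> circle \<Rightarrow> circle \<Rightarrow> circle
    \<Rightarrow> circle set \<Rightarrow> (circle set \<Rightarrow>\<^sub>0 'r)" where
  "nested_split \<alpha> \<epsilon> \<omega> p D' C Cin Cout K =
     (let \<kappa> = \<epsilon> ^ ((circle_dist p D' Cin - 2) div 4); K0 = K - {C}
      in if C \<notin> K then
           Poly_Mapping.single (insert Cin K0) (\<omega> * \<kappa>) +
           Poly_Mapping.single (insert Cout K0) (\<epsilon> * \<omega> * \<kappa>)
         else
           Poly_Mapping.single (insert Cin (insert Cout K0)) (\<omega> * \<kappa>) +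
           Poly_Mapping.single K0 (\<alpha> * \<epsilon> * \<omega> * \<kappa>))"

definition surgery ::
  "'r::comm_ring_1 \<Rightarrow> 'r \<Rightarrow> 'r \<Rightarrow> (int \<Rightarrow> nat) \<Rightarrow> diagram \<Rightarrow> arc \<Rightarrow> circle set \<Rightarrow> (circle set \<Rightarrow>\<^sub>0 'r)" where
  "surgery \<alpha> \<epsilon> \<omega> p D \<gamma> K =
     (let D' = cut D \<gamma>;
          C1 = circle_of D (Lower, fst \<gamma>); C2 = circle_of D (Upper, fst \<gamma>);
          Ci = circle_of D' (Lower, fst \<gamma>); Cj = circle_of D' (Lower, snd \<gamma>)
      in if C1 \<noteq> C2 then merge \<alpha> \<epsilon> p D \<gamma> C1 C2 Ci K
         else if nested_in Ci Cj then nested_split \<alpha> \<epsilon> \<omega> p D' C1 Ci Cj K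
         else if nested_in Cj Ci then nested_split \<alpha> \<epsilon> \<omega> p D' C1 Cj Ci K
         else nonnested_split \<alpha> \<epsilon> \<omega> p \<gamma> C1 Ci Cj K)"

fun surgeries ::
  "'r::comm_ring_1 \<Rightarrow> 'r \<Rightarrow> 'r \<Rightarrow> (int \<Rightarrow> nat) \<Rightarrow> diagram \<Rightarrow> arc list
    \<Rightarrow> (circle set \<Rightarrow>\<^sub>0 'r) \<Rightarrow> (circle set \<Rightarrow>\<^sub>0 'r)" where
  "surgeries \<alpha> \<epsilon> \<omega> p D [] x = x"
| "surgeries \<alpha> \<epsilon> \<omega> p D (\<gamma> # \<gamma>s) x =
     surgeries \<alpha> \<epsilon> \<omega> p (cut D \<gamma>) \<gamma>s (lin_ext (surgery \<alpha> \<epsilon> \<omega> p D \<gamma>) x)"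


section \<open>Multiplication\<close>

text \<open>
  A remaining cap/cup pair of the middle part can be connected iff it is not nested inside
  another remaining pair; the leftmost such pair is the one with the smallest left end.
  So the surgeries are performed in the order of the left ends.

  Collapsing the middle part is a bijection between orientations of the completely surgered
  diagram and the weights \<open>\<nu>''\<close> orienting \<open>\<xi>\<eta>\<close>: the weight \<open>\<nu>''\<close> is placed on both levels.
\<close>

definition left_to_right :: "arc set \<Rightarrow> arc list" where
  "left_to_right A = (THE \<gamma>s. set \<gamma>s = A \<and> sorted_wrt (\<lambda>\<gamma> \<delta>. fst \<gamma> < fst \<delta>) \<gamma>s)"

lemma left_to_right_eqI:
  assumes "set \<gamma>s = A" and "sorted_wrt (\<lambda>\<gamma> \<delta>. fst \<gamma> < fst \<delta>) \<gamma>s"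
  shows "left_to_right A = \<gamma>s"
  unfolding left_to_right_def
proof (rule the_equality)
  fix \<delta>s assume \<delta>s: "set \<delta>s = A \<and> sorted_wrt (\<lambda>\<gamma> \<delta>. fst \<gamma> < fst \<delta>) \<delta>s"
  have eq: "map fst \<delta>s = map fst \<gamma>s"
  proof (rule strict_sorted_equal)
    show "sorted_wrt (<) (map fst \<delta>s)" "sorted_wrt (<) (map fst \<gamma>s)"
      using \<delta>s assms(2) by (simp_all add: sorted_wrt_map)
    show "set (map fst \<delta>s) = set (map fst \<gamma>s)"
      using \<delta>s assms(1) by simp
  qed
  have "distinct (map fst \<gamma>s)"
    using assms(2) strict_sorted_iff[of "map fst \<gamma>s"] by (simp add: sorted_wrt_map)
  then have "inj_on fst (set \<delta>s \<union> set \<gamma>s)"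
    using \<delta>s assms(1) by (simp add: distinct_map)
  with eq show "\<delta>s = \<gamma>s"
    by (rule map_inj_on)
qed (use assms in simp)

fun basis_mult :: "'r::comm_ring_1 \<Rightarrow> 'r \<Rightarrow> 'r \<Rightarrow> basis \<Rightarrow> basis \<Rightarrow> (basis \<Rightarrow>\<^sub>0 'r)" where
  "basis_mult \<alpha> \<epsilon> \<omega> (\<xi>, \<nu>, \<mu>) (\<mu>', \<nu>', \<eta>) =
     (if \<mu> \<noteq> \<mu>' then 0 else
      let \<Lambda> = block_of \<mu>;
          D = stacked_diagram \<xi> \<mu> \<eta>;
          \<gamma>s = left_to_right (arcs \<mu>);
          K = clockwise_circles D (\<lambda>(l, i). case l of Lower \<Rightarrow> \<nu> i | Upper \<Rightarrow> \<nu>' i);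
          x = surgeries \<alpha> \<epsilon> \<omega> (pos \<Lambda>) D \<gamma>s (Poly_Mapping.single K 1);
          E = foldl cut D \<gamma>s
      in \<Sum>\<nu>''\<in>{\<nu>''. (\<xi>, \<nu>'', \<eta>) \<in> arc_basis \<Lambda>}.
           Poly_Mapping.single (\<xi>, \<nu>'', \<eta>)
             (Poly_Mapping.lookup x (clockwise_circles E (\<lambda>(l, i). \<nu>'' i))))"

definition arc_mult ::
  "'r::comm_ring_1 \<Rightarrow> 'r \<Rightarrow> 'r \<Rightarrow> (basis \<Rightarrow>\<^sub>0 'r) \<Rightarrow> (basis \<Rightarrow>\<^sub>0 'r) \<Rightarrow> (basis \<Rightarrow>\<^sub>0 'r)" where
  "arc_mult \<alpha> \<epsilon> \<omega> x y = lin_ext (\<lambda>a. lin_ext (\<lambda>b. basis_mult \<alpha> \<epsilon> \<omega> a b) y) x"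


section \<open>The arc algebras over Q\<close>

type_synonym Q_algebra = "(basis \<Rightarrow>\<^sub>0 Q) set \<times> ((basis \<Rightarrow>\<^sub>0 Q) \<Rightarrow> (basis \<Rightarrow>\<^sub>0 Q) \<Rightarrow> (basis \<Rightarrow>\<^sub>0 Q))"

definition arc_module :: "weight set \<Rightarrow> (basis \<Rightarrow>\<^sub>0 Q) set" where
  "arc_module \<Lambda> = {x. Poly_Mapping.keys x \<subseteq> arc_basis \<Lambda>}"

text \<open>The direct sum of the \<^const>\<open>arc_module\<close>s, since bases of distinct blocks are disjoint.\<close>

definition total_module :: "(basis \<Rightarrow>\<^sub>0 Q) set" where
  "total_module = {x. Poly_Mapping.keys x \<subseteq> (\<Union>\<Lambda>\<in>{\<Lambda>. balanced_block \<Lambda>}. arc_basis \<Lambda>)}"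

definition AQ_block :: "weight set \<Rightarrow> Q_algebra" where
  "AQ_block \<Lambda> = (arc_module \<Lambda>, arc_mult Q_alpha Q_eps Q_omega)"

definition AKBN_block :: "weight set \<Rightarrow> Q_algebra" where
  "AKBN_block \<Lambda> = (arc_module \<Lambda>, arc_mult Q_alpha 1 1)"

definition AQ :: Q_algebra where
  "AQ = (total_module, arc_mult Q_alpha Q_eps Q_omega)"

definition AKBN :: Q_algebra where
  "AKBN = (total_module, arc_mult Q_alpha 1 1)"

definition homogeneous :: "nat \<Rightarrow> (basis \<Rightarrow>\<^sub>0 Q) \<Rightarrow> bool" where
  "homogeneous n x \<longleftrightarrow>
     (\<forall>b\<in>Poly_Mapping.keys x. \<forall>(a, e, w)\<in>Poly_Mapping.keys (Poly_Mapping.lookup x b).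
        4 * a + basis_degree b = n)"

text \<open>
  There is no separate clause for units: the direct sum over all blocks has none, and for a
  single block a multiplicative bijection maps a two-sided unit to a two-sided unit.
\<close>

fun graded_algebra_iso :: "Q_algebra \<Rightarrow> Q_algebra \<Rightarrow> ((basis \<Rightarrow>\<^sub>0 Q) \<Rightarrow> (basis \<Rightarrow>\<^sub>0 Q)) \<Rightarrow> bool" where
  "graded_algebra_iso (A, mA) (B, mB) f \<longleftrightarrow>
     bij_betw f A B \<and>
     (\<forall>x\<in>A. \<forall>y\<in>A. f (x + y) = f x + f y) \<and>
     (\<forall>q. \<forall>x\<in>A. f (smult q x) = smult q (f x)) \<and>
     (\<forall>x\<in>A. \<forall>y\<in>A. f (mA x y) = mB (f x) (f y)) \<and>
     (\<forall>n. f ` {x \<in> A. homogeneous n x} = {y \<in> B. homogeneous n y})"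


section \<open>The coefficient map\<close>

definition circle_coeff :: "(int \<Rightarrow> nat) \<Rightarrow> diagram \<Rightarrow> circle set \<Rightarrow> circle \<Rightarrow> Q" where
  "circle_coeff p D K C =
     (\<Prod>(l, \<gamma>)\<in>icup D C.
        Q_eps ^ ((saddle_width p \<gamma> + 1) * p (fst \<gamma>)) * Q_omega_pow (- int (saddle_width p \<gamma>))) *
     (\<Prod>(l, \<gamma>)\<in>icap D C.
        Q_eps ^ (saddle_width p \<gamma> * (p (fst \<gamma>) + 1)) * Q_omega_pow (int (saddle_width p \<gamma>) - 1)) *
     (if C \<in> K then Q_eps ^ rightmost p C else 1)"

fun basis_coeff :: "weight set \<Rightarrow> basis \<Rightarrow> Q" where
  "basis_coeff \<Lambda> (\<xi>, \<nu>, \<mu>) =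
     (let D = basic_diagram \<xi> \<mu>
      in \<Prod>C\<in>circles D. circle_coeff (pos \<Lambda>) D (clockwise_circles D (\<lambda>(l, i). \<nu> i)) C)"

definition coeff_map :: "weight set \<Rightarrow> (basis \<Rightarrow>\<^sub>0 Q) \<Rightarrow> (basis \<Rightarrow>\<^sub>0 Q)" where
  "coeff_map \<Lambda> = lin_ext (\<lambda>b. Poly_Mapping.single b (basis_coeff \<Lambda> b))"

end

theory Submission
  imports Defs
begin

text \<open>
  Let the coefficient of an oriented stacked diagram be the product of the coefficients of its
  circles. It is enough that each surgery intertwines these coefficients. Let \<open>\<chi> = 1\<close> for an arc of
  a circle \<open>C\<close> with the interior of \<open>C\<close> between the arc and the line, and \<open>\<chi> = - 1\<close> otherwise, so
  that \<open>coeff(C)\<close> is a product over the arcs with \<open>\<chi> = - 1\<close>. A non-nested surgery keeps the signs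
  of all other arcs, whereas in a nested one the signs on the inner circle are reversed. The latter is
  controlled by the sum of the exponents over all arcs of one circle. It is computed from three
  facts: the sum of \<open>\<chi>\<close> is 2 (the turning number), the sums of \<open>\<chi> d\<close> over cups and over caps agree
  (the circle is closed), and the left end of an arc has position \<open>\<equiv> t(C)\<close> modulo 2 iff \<open>\<chi> = - 1\<close>.

  Planarity enters through noncrossing involutions: an interval between two partners is closed under
  the involution, hence contains an even number of vertices of each circle.
\<close>

section \<open>Circles as orbits of two involutions\<close>

text \<open>A surgery reconnects circles without changing their vertices:
  \<open>Ci \<union> Cj = C1 \<union> C2\<close>. Ray parity is additive on disjoint unions, so the
  exponents before and after are sums over the same arcs; only the two copies of the cut pair
  \<gamma> and the sides along an inner circle differ. With \<open>k = (d - 2) / 4\<close> for the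
  inner circle and \<open>t\<close> its rightmost position, removing \<gamma> from the exterior arcs
  corresponds to \<epsilon>^(p i + s) and \<omega>^(-1), reversing the inner circle to \<epsilon>^(k
  + t) and \<omega>^(-1). In a non-nested merge neither happens; in a nested merge both happen, the
  powers of \<omega> cancel and \<epsilon>^(1 + k + s) remains; in a split exactly one happens,
  which leaves the \<omega> of the split rules.

  The obstacle is that all topology has to be expressed by ray parities: that a circle lies on one
  side of another, that a simple closed curve turns once, and that a surgery never turns one circle
  into one circle. The last statement fails for arbitrary reconnections; a colouring of the vertices
  by parity of position and by level saves it.\<close>

definition orb :: "('a \<Rightarrow> 'a) \<Rightarrow> ('a \<Rightarrow> 'a) \<Rightarrow> 'a \<Rightarrow> 'a set" where
  "orb f g v = {(x, y). y = f x \<or> y = g x}\<^sup>* `` {v}"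

definition involution_on :: "'a set \<Rightarrow> ('a \<Rightarrow> 'a) \<Rightarrow> bool" where
  "involution_on X f \<longleftrightarrow> (\<forall>x\<in>X. f x \<in> X \<and> f (f x) = x \<and> f x \<noteq> x)"

lemma even_card_involution:
  assumes "finite X" "involution_on X f"
  shows "even (card X)"
  using assms
proof (induction "card X" arbitrary: X rule: less_induct)
  case less
  show ?case
  proof (cases "X = {}")
    case False
    then obtain x where x: "x \<in> X" by blast
    let ?Y = "X - {x, f x}"
    have fx: "f x \<in> X" "f x \<noteq> x" using less.prems x by (auto simp: involution_on_def)
    have "involution_on ?Y f"
      using less.prems(2) x unfolding involution_on_def by (metis Diff_iff insert_iff singletonD)
    moreover have "card ?Y < card X"
      using less.prems(1) x by (intro psubset_card_mono) auto
    ultimately have "even (card ?Y)" using less by simp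
    moreover have "card X = card ?Y + 2"
    proof -
      have "card ?Y = card X - card {x, f x}"
        using fx x by (intro card_Diff_subset) auto
      moreover have "card {x, f x} = 2" using fx by auto
      moreover have "card {x, f x} \<le> card X" using less.prems(1) fx x by (intro card_mono) auto
      ultimately show ?thesis by simp
    qed
    ultimately show ?thesis by simp
  qed simp
qed

lemma orb_refl: "v \<in> orb f g v"
  by (simp add: orb_def)

lemma orb_closed:
  assumes "x \<in> orb f g v"
  shows "f x \<in> orb f g v" "g x \<in> orb f g v"
  using assms unfolding orb_def by (auto intro: rtrancl_into_rtrancl)

lemma orb_step: "f v \<in> orb f g v" "g v \<in> orb f g v"
  by (rule orb_closed[OF orb_refl])+

lemma orb_minimal:
  assumes "v \<in> Y" "\<And>x. x \<in> Y \<Longrightarrow> f x \<in> Y \<and> g x \<in> Y"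
  shows "orb f g v \<subseteq> Y"
proof
  fix w assume "w \<in> orb f g v"
  then have "(v, w) \<in> {(x, y). y = f x \<or> y = g x}\<^sup>*" by (simp add: orb_def)
  then show "w \<in> Y" by (induction) (use assms in auto)
qed

lemma orb_subset:
  assumes "involution_on W f" "involution_on W g" "v \<in> W"
  shows "orb f g v \<subseteq> W"
  by (rule orb_minimal) (use assms in \<open>auto simp: involution_on_def\<close>)

lemma orb_eq:
  assumes "involution_on W f" "involution_on W g" "v \<in> W" "w \<in> orb f g v"
  shows "orb f g w = orb f g v"
proof
  show "orb f g w \<subseteq> orb f g v"
    using assms(4) by (rule orb_minimal) (auto intro: orb_closed)
  \<comment> \<open>Reachability uses forward steps only. It is symmetric because an involution
    undoes its own steps, so the points that lead back to \<open>v\<close> form a closed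
    set.\<close>
  have "orb f g v \<subseteq> {x\<in>W. v \<in> orb f g x}"
  proof (rule orb_minimal)
    fix x assume x: "x \<in> {x\<in>W. v \<in> orb f g x}"
    have "v \<in> orb f g y" if y: "y \<in> W" "x = f y \<or> x = g y" for y
    proof -
      have "f y \<in> orb f g y" "g y \<in> orb f g y" by (rule orb_step)+
      moreover have "x = f y \<or> x = g y" using y x assms(1,2) unfolding involution_on_def by auto
      ultimately have "x \<in> orb f g y" by auto
      then have "orb f g x \<subseteq> orb f g y" by (rule orb_minimal) (auto intro: orb_closed)
      then show ?thesis using x by auto
    qed
    then show "f x \<in> {x\<in>W. v \<in> orb f g x} \<and> g x \<in> {x\<in>W. v \<in> orb f g x}"
      using x assms(1,2) by (simp add: involution_on_def)
  qed (use assms orb_refl in auto)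
  then have "v \<in> orb f g w" using assms(4) by blast
  then show "orb f g v \<subseteq> orb f g w" by (rule orb_minimal) (auto intro: orb_closed)
qed

lemma orb_disjoint:
  assumes "involution_on W f" "involution_on W g" "v \<in> W" "w \<in> W" "orb f g v \<noteq> orb f g w"
  shows "orb f g v \<inter> orb f g w = {}"
proof (rule ccontr)
  assume "orb f g v \<inter> orb f g w \<noteq> {}"
  then obtain x where x: "x \<in> orb f g v" "x \<in> orb f g w" by blast
  show False
    using orb_eq[OF assms(1-3) x(1)] orb_eq[OF assms(1,2,4) x(2)] assms(5) by simp
qed

text \<open>One surgery in abstract form: \<open>f\<close> is the part of the diagram away from the
  saddle, \<open>g\<close> and \<open>h\<close> are the pairings on the other side before and after
  it. The four points are the ends of a cap and a cup, joined horizontally by \<open>g\<close> and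
  vertically by \<open>h\<close>. The colouring \<open>q\<close>, which alternates along every step,
  encodes orientability.\<close>

locale switching =
  fixes W :: "'a set" and f g h :: "'a \<Rightarrow> 'a" and a b c d :: 'a and q :: "'a \<Rightarrow> bool"
  assumes fin: "finite W"
    and inv: "involution_on W f" "involution_on W g" "involution_on W h"
    and abcd: "a \<in> W" "b \<in> W" "c \<in> W" "d \<in> W" "distinct [a, b, c, d]"
    and g: "g a = b" "g c = d" and h: "h a = c" "h b = d"
    and gh: "\<And>x. x \<in> W - {a, b, c, d} \<Longrightarrow> g x = h x"
    and col: "\<And>x. x \<in> W \<Longrightarrow> q (f x) \<noteq> q x" "\<And>x. x \<in> W \<Longrightarrow> q (g x) \<noteq> q x"
      "\<And>x. x \<in> W \<Longrightarrow> q (h x) \<noteq> q x"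
begin

lemma back_eqs: "g b = a" "g d = c" "h c = a" "h d = b"
proof -
  have "g (g a) = a" "g (g c) = c" "h (h a) = a" "h (h b) = b"
    using inv abcd unfolding involution_on_def by blast+
  then show "g b = a" "g d = c" "h c = a" "h d = b" by (simp_all add: g h)
qed

lemma flipped: "switching W f h g a c b d q"
proof
  show "h x = g x" if "x \<in> W - {a, c, b, d}" for x
    by (rule gh[symmetric]) (use that in blast)
  show "distinct [a, c, b, d]" using abcd(5) by auto
qed (fact fin inv abcd g h col)+

lemma swap_closed:
  assumes "X \<subseteq> W" "\<And>x. x \<in> X \<Longrightarrow> g x \<in> X" "a \<in> X" "b \<in> X" "c \<in> X" "d \<in> X" "x \<in> X"
  shows "h x \<in> X"
proof (cases "x \<in> {a, b, c, d}")
  case True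
  then have "h x \<in> {a, b, c, d}" using h back_eqs by auto
  then show ?thesis using assms(3-6) by blast
next
  case False
  then have "g x = h x" using assms(1,7) by (intro gh) blast
  then show ?thesis using assms(2)[OF assms(7)] by simp
qed

lemma union_subset: "orb f h a \<union> orb f h b \<subseteq> orb f g a \<union> orb f g c"
proof -
  let ?X = "orb f g a \<union> orb f g c"
  have X: "?X \<subseteq> W" using orb_subset[OF inv(1,2)] abcd by blast
  have gX: "g x \<in> ?X" "f x \<in> ?X" if "x \<in> ?X" for x using that orb_closed[of x f g] by auto
  have "a \<in> ?X" "c \<in> ?X" using orb_refl[of _ f g] by auto
  then have m: "a \<in> ?X" "b \<in> ?X" "c \<in> ?X" "d \<in> ?X" using gX(1)[of a] gX(1)[of c] unfolding g by blast+
  have "h x \<in> ?X" if "x \<in> ?X" for x by (rule swap_closed[OF X]) (use gX m that in auto)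
  then have "\<And>x. x \<in> ?X \<Longrightarrow> f x \<in> ?X \<and> h x \<in> ?X" using gX(2) by blast
  then have "orb f h a \<subseteq> ?X" "orb f h b \<subseteq> ?X"
    using orb_minimal[OF m(1), of f h] orb_minimal[OF m(2), of f h] by simp_all
  then show ?thesis by blast
qed

lemma union_eq: "orb f h a \<union> orb f h b = orb f g a \<union> orb f g c"
  using union_subset switching.union_subset[OF flipped] by blast

text \<open>Otherwise the common part of the orbits of \<open>a\<close> before and after would
  contain \<open>a\<close> but none of the other three points. Closed under \<open>f\<close>, it has
  even size; without \<open>a\<close> it is closed under \<open>g\<close>, which agrees with
  \<open>h\<close> there, so its size is odd.\<close>

lemma not_both_distinct:
  assumes "orb f g a \<noteq> orb f g c" shows "orb f h a = orb f h b"
proof (rule ccontr)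
  assume ne: "orb f h a \<noteq> orb f h b"
  let ?I = "orb f g a \<inter> orb f h a"
  have dj: "orb f g a \<inter> orb f g c = {}" "orb f h a \<inter> orb f h b = {}"
    using orb_disjoint[OF inv(1,2)] orb_disjoint[OF inv(1,3)] abcd assms ne by auto
  have IW: "?I \<subseteq> W" using orb_subset[OF inv(1,2)] abcd by blast
  have c: "c \<notin> ?I" "d \<notin> ?I" "b \<notin> ?I"
    using dj orb_refl[of c f g] orb_refl[of b f h] orb_step(2)[where f = f and g = g and v = c] g by auto
  have fI: "finite ?I" using IW fin finite_subset by blast
  have aI: "a \<in> ?I" using orb_refl by auto
  have "involution_on ?I f"
    unfolding involution_on_def using IW inv(1) by (auto simp: involution_on_def intro: orb_closed)
  then have ev: "even (card ?I)" using fI even_card_involution by blast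
  have "g x \<in> ?I - {a}" if x: "x \<in> ?I - {a}" for x
  proof -
    have "x \<in> W - {a, b, c, d}" using x c IW by blast
    then have "g x = h x" "x \<in> W" using gh by auto
    then have "g x \<in> ?I" using x orb_closed(2)[of x f g] orb_closed(2)[of x f h] by auto
    moreover have "g x \<noteq> a"
    proof
      assume "g x = a"
      then have "x = b" using inv(2) \<open>x \<in> W\<close> g(1) unfolding involution_on_def by metis
      then show False using x c by blast
    qed
    ultimately show ?thesis by simp
  qed
  then have "involution_on (?I - {a}) g"
    unfolding involution_on_def using IW inv(2) by (auto simp: involution_on_def)
  then have "even (card (?I - {a}))" using fI even_card_involution by (metis finite_Diff)
  moreover have "card ?I = Suc (card (?I - {a}))" using aI fI by (metis card_Suc_Diff1)
  ultimately show False using ev by simp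
qed

lemma iterate_colour:
  "((\<lambda>x. g (f x)) ^^ n) a \<in> W \<and> (q (((\<lambda>x. g (f x)) ^^ n) a) \<longleftrightarrow> q a)"
proof (induction n)
  case (Suc n)
  let ?x = "((\<lambda>x. g (f x)) ^^ n) a"
  have "?x \<in> W" "f ?x \<in> W" "g (f ?x) \<in> W" using Suc inv unfolding involution_on_def by auto
  then show ?case using Suc col(1)[of ?x] col(2)[of "f ?x"] by auto
qed (use abcd in auto)

lemma iterate_return: "\<exists>n>0. ((\<lambda>x. g (f x)) ^^ n) a = a"
proof -
  let ?F = "\<lambda>x. g (f x)"
  have "inj_on ?F W" using inv unfolding involution_on_def inj_on_def by metis
  have "\<not> inj_on (\<lambda>n. (?F ^^ n) a) UNIV"
    using fin iterate_colour by (metis (mono_tags) finite_imageD finite_subset image_subsetI infinite_UNIV_nat)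
  then obtain m n where mn: "m < n" "(?F ^^ m) a = (?F ^^ n) a"
    unfolding inj_on_def by (metis linorder_neqE_nat)
  \<comment> \<open>Injectivity cancels the common initial steps of two coinciding iterates, so the
    orbit returns to \<open>a\<close> itself.\<close>
  have "(?F ^^ 0) a = (?F ^^ (n - m)) a"
    using mn
  proof (induction m arbitrary: n)
    case (Suc m)
    obtain n' where n': "n = Suc n'" using Suc.prems by (cases n) auto
    have "(?F ^^ m) a = (?F ^^ n') a"
      using Suc.prems \<open>inj_on ?F W\<close> iterate_colour unfolding n' by (auto dest: inj_onD)
    then show ?case using Suc.IH[of n'] Suc.prems n' by simp
  qed simp
  then show ?thesis using mn(1) by (intro exI[of _ "n - m"]) auto
qed

text \<open>Follow the path that starts at \<open>a\<close> with an \<open>f\<close>-step up to its first return to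
  \<open>{a, b, c, d}\<close>; the colouring rules out that it ends in \<open>d\<close>.\<close>

lemma not_both_equal:
  assumes "orb f g a = orb f g c" shows "orb f h a \<noteq> orb f h b"
proof -
  let ?F = "\<lambda>x. g (f x)"
  let ?P = "\<lambda>n. n > 0 \<and> (?F ^^ n) a \<in> {a, b, c, d}"
  define n where "n = (LEAST n. ?P n)"
  have n: "?P n" unfolding n_def by (rule LeastI_ex) (use iterate_return in auto)
  have least: "(?F ^^ m) a \<notin> {a, b, c, d}" if "m > 0" "m < n" for m
    using that not_less_Least[of m ?P] unfolding n_def by auto
  define x where "x = (\<lambda>m. (?F ^^ m) a)"
  define e where "e = f (x (n - 1))"
  have x0: "x 0 = a" and xS: "x (Suc m) = g (f (x m))" for m unfolding x_def by auto
  have xW: "x m \<in> W" "f (x m) \<in> W" for m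
    using iterate_colour[of m] inv unfolding x_def involution_on_def by auto
  have back_f: "f (f (x m)) = x m" "g (x (Suc m)) = f (x m)" for m
    using xW[of m] inv unfolding xS involution_on_def by auto
  \<comment> \<open>\<open>Y\<close> is the path from \<open>a\<close> to \<open>e\<close>, and only
    its two ends lie among the four points. If \<open>e = b\<close>, the pairing \<open>g\<close>
    closes it up and the old orbit of \<open>a\<close> misses \<open>c\<close>; if
    \<open>e = c\<close>, the pairing \<open>h\<close> closes it up and the new orbit of
    \<open>a\<close> misses \<open>b\<close>.\<close>
  define Y where "Y = x ` {..<n} \<union> (\<lambda>m. f (x m)) ` {..<n}"
  have YW: "Y \<subseteq> W" unfolding Y_def using xW by auto
  have aY: "a \<in> Y" unfolding Y_def using n x0 by (metis UnI1 image_eqI lessThan_iff)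
  have eY: "e \<in> Y" unfolding Y_def e_def using n by auto
  have fY: "f y \<in> Y" if "y \<in> Y" for y using that back_f unfolding Y_def by auto
  have eabcd: "e \<in> {a, b, c, d}"
  proof -
    have "x n \<in> {a, b, c, d}" using n x_def by simp
    moreover have "e = g (x n)" unfolding e_def using n back_f(2)[of "n - 1"] by simp
    ultimately show ?thesis using g back_eqs by auto
  qed
  have qe: "q e \<noteq> q a" using iterate_colour[of "n - 1"] col(1)[of "x (n - 1)"] xW unfolding e_def x_def by auto
  have only: "y = a \<or> y = e" if y: "y \<in> Y" "y \<in> {a, b, c, d}" for y
  proof -
    consider m where "m < n" "y = x m" | m where "m < n" "y = f (x m)" using y unfolding Y_def by auto
    then show ?thesis
    proof cases
      case 1
      then show ?thesis using least[of m] y(2) x0 unfolding x_def by (cases "m = 0") auto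
    next
      case 2
      then have "x (Suc m) \<in> {a, b, c, d}" using xS[of m] y(2) g back_eqs by auto
      then have "Suc m = n" using least[of "Suc m"] 2 unfolding x_def by (metis Suc_lessI zero_less_Suc)
      then show ?thesis unfolding e_def 2 by auto
    qed
  qed
  have gY: "g y \<in> Y" if y: "y \<in> Y" "y \<notin> {a, b, c, d}" for y
  proof -
    consider m where "m < n" "y = x m" | m where "m < n" "y = f (x m)" using y unfolding Y_def by auto
    then show ?thesis
    proof cases
      case 1
      then obtain k where "m = Suc k" using y x0 by (cases m) auto
      then show ?thesis using 1 back_f(2)[of k] unfolding Y_def by auto
    next
      case 2
      then have "g y = x (Suc m)" using xS by simp
      moreover have "Suc m \<noteq> n"
        using n 2 y(2) eabcd unfolding e_def by auto
      ultimately show ?thesis unfolding Y_def using 2 by auto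
    qed
  qed
  have qs: "q b \<noteq> q a" "q c \<noteq> q a" "q d = q a"
    using col(2)[of a] col(3)[of a] col(2)[of c] abcd g h by auto
  then consider "e = b" | "e = c" using eabcd qe by auto
  then show ?thesis
  proof cases
    case 1
    have cd: "c \<notin> Y" "d \<notin> Y" using only[of c] only[of d] abcd(5) 1 by auto
    have "g y \<in> Y" if y: "y \<in> Y" for y
    proof (cases "y \<in> {a, b}")
      case True then show ?thesis using g back_eqs aY eY 1 by auto
    next
      case False
      then have "y \<notin> {a, b, c, d}" using y cd by auto
      then show ?thesis using gY[of y] y by auto
    qed
    then have "orb f g a \<subseteq> Y" using fY by (intro orb_minimal[OF aY]) simp
    then show ?thesis using assms cd orb_refl[of c f g] by auto
  next
    case 2
    have bd: "b \<notin> Y" "d \<notin> Y" using only[of b] only[of d] abcd(5) 2 by auto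
    have "h y \<in> Y" if y: "y \<in> Y" for y
    proof (cases "y \<in> {a, c}")
      case True then show ?thesis using h back_eqs aY eY 2 by auto
    next
      case False
      then have "y \<in> W - {a, b, c, d}" using y bd YW by auto
      then show ?thesis using gh gY[of y] y by auto
    qed
    then have "orb f h a \<subseteq> Y" using fY by (intro orb_minimal[OF aY]) simp
    then show ?thesis using bd orb_refl[of b f h] by auto
  qed
qed

lemma orb_away:
  assumes "v \<in> W" "v \<notin> orb f g a \<union> orb f g c"
  shows "orb f h v = orb f g v"
proof -
  have *: "orb f h v \<subseteq> orb f g v" if sw: "switching W f g h a b c d q" and v: "v \<in> W" "v \<notin> orb f g a \<union> orb f g c" for g h b c
  proof -
    interpret s: switching W f g h a b c d q by fact
    have dj: "orb f g v \<inter> (orb f g a \<union> orb f g c) = {}"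
      using v orb_disjoint[OF s.inv(1,2)] s.abcd orb_refl[of v f g] by blast
    have "h x \<in> orb f g v" if x: "x \<in> orb f g v" for x
    proof -
      have "x \<notin> orb f g a \<union> orb f g c" using x dj by blast
      then have "x \<notin> {a, b, c, d}"
        using orb_refl[of _ f g] orb_step(2)[where f = f and g = g] s.g by auto
      then have "g x = h x" using s.gh x orb_subset[OF s.inv(1,2) v(1)] by blast
      then show ?thesis using x orb_closed(2) by metis
    qed
    then show ?thesis by (intro orb_minimal) (auto intro: orb_refl orb_closed)
  qed
  show ?thesis
    using *[OF switching_axioms assms] *[OF flipped assms(1)] assms(2) union_eq by (metis subset_antisym)
qed

end

section \<open>Noncrossing involutions and the turning number\<close>

definition noncrossing :: "('a \<Rightarrow> int) \<Rightarrow> 'a set \<Rightarrow> ('a \<Rightarrow> 'a) \<Rightarrow> bool" where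
  "noncrossing z X f \<longleftrightarrow> involution_on X f \<and>
     (\<forall>x\<in>X. \<forall>y\<in>X. z x < z y \<longrightarrow> z y < z (f x) \<longrightarrow> z x < z (f y) \<and> z (f y) < z (f x))"

text \<open>The ray criterion: if \<open>X\<close> consists of the points where a closed curve
  crosses the line, this says that the line just to the right of \<open>v\<close> is in the
  interior.\<close>

definition odd_right :: "('a \<Rightarrow> int) \<Rightarrow> 'a set \<Rightarrow> 'a \<Rightarrow> bool" where
  "odd_right z X v \<longleftrightarrow> odd (card {y \<in> X. z v < z y})"

lemma noncrossing_subset:
  assumes "noncrossing z W f" "X \<subseteq> W" "\<And>x. x \<in> X \<Longrightarrow> f x \<in> X"
  shows "noncrossing z X f"
  using assms unfolding noncrossing_def involution_on_def by blast

lemma noncrossingD: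
  assumes "noncrossing z X f" "x \<in> X"
  shows "f x \<in> X" "f (f x) = x" "f x \<noteq> x"
  using assms unfolding noncrossing_def involution_on_def by auto

lemma noncrossing_between:
  assumes "noncrossing z X f" "x \<in> X" "y \<in> X" "z x < z y" "z y < z (f x)"
  shows "z x < z (f y)" "z (f y) < z (f x)"
  using assms unfolding noncrossing_def by auto

text \<open>Beneath the arc from \<open>u\<close> to \<open>f u\<close> the points of
  \<open>X\<close> are paired off by \<open>f\<close>, so they leave the parity alone, and only
  \<open>f u\<close> itself can change it. Closure is assumed only beneath the arc because
  \<open>sides\<close> applies this to sets that are not closed at the ends of a saddle.\<close>

lemma odd_right_between:
  assumes "finite X" "inj_on z W" "X \<subseteq> W" "noncrossing z W f" "u \<in> W" "z u < z (f u)"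
    and X: "\<And>x. x \<in> X \<Longrightarrow> z u < z x \<Longrightarrow> z x < z (f u) \<Longrightarrow> f x \<in> X"
  shows "odd_right z X u \<longleftrightarrow> (odd_right z X (f u) \<noteq> (f u \<in> X))"
proof -
  let ?B = "{x\<in>X. z u < z x \<and> z x < z (f u)}" and ?R = "{y\<in>X. z (f u) < z y}"
  have fu: "f u \<in> W" using noncrossingD[OF assms(4,5)] by simp
  have "involution_on ?B f"
    unfolding involution_on_def
  proof
    fix x assume x: "x \<in> ?B"
    then have xW: "x \<in> W" using assms(3) by auto
    show "f x \<in> ?B \<and> f (f x) = x \<and> f x \<noteq> x"
      using X[of x] x noncrossingD[OF assms(4) xW] noncrossing_between[OF assms(4,5) xW] by auto
  qed
  then have ev: "even (card ?B)" using assms(1) by (intro even_card_involution) auto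
  have split: "{y\<in>X. z u < z y} = ?B \<union> ((if f u \<in> X then {f u} else {}) \<union> ?R)"
  proof -
    have "y = f u" if "y \<in> X" "z y = z (f u)" for y
      using that assms(2,3) fu by (auto dest: inj_onD)
    then show ?thesis using assms(6) by (auto simp: not_less_iff_gr_or_eq)
  qed
  have "card {y\<in>X. z u < z y} = card ?B + card ((if f u \<in> X then {f u} else {}) \<union> ?R)"
    unfolding split using assms(1,6) by (intro card_Un_disjoint) auto
  also have "card ((if f u \<in> X then {f u} else {}) \<union> ?R) = (if f u \<in> X then 1 else 0) + card ?R"
    using assms(1) by auto
  finally show ?thesis using ev unfolding odd_right_def by auto
qed

text \<open>This replaces the Jordan curve theorem: along an arc off \<open>X\<close> the side is
  constant, whereas the two ends of an arc of \<open>X\<close> have opposite parities.\<close>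

lemma odd_right_step:
  assumes "finite X" "inj_on z W" "X \<subseteq> W" "noncrossing z W f" "u \<in> W"
    and X: "\<And>x. x \<in> X \<Longrightarrow> f x \<in> X"
  shows "odd_right z X (f u) \<longleftrightarrow> (odd_right z X u \<noteq> (u \<in> X))"
proof -
  note ff = noncrossingD[OF assms(4,5)]
  have uX: "f u \<in> X \<longleftrightarrow> u \<in> X" using X[of u] X[of "f u"] ff by auto
  have "z u \<noteq> z (f u)" using ff assms(2,5) by (auto dest: inj_onD)
  then consider "z u < z (f u)" | "z (f u) < z u" by linarith
  then show ?thesis
  proof cases
    case 1
    then show ?thesis using odd_right_between[OF assms(1-5)] X uX by auto
  next
    case 2
    then show ?thesis using odd_right_between[OF assms(1-4) ff(1)] X uX ff by auto
  qed
qed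

text \<open>Each arc has exactly one end of odd parity and contributes 1 if this is its left end,
  otherwise -1. So the sum counts the signed half turns of a simple closed curve made of
  semicircles; the last hypothesis says that it is one curve. The induction removes an innermost
  \<open>f\<close>-arc and pulls the three consecutive arcs around it tight into one.\<close>

lemma turning_number:
  fixes z :: "'a \<Rightarrow> int"
  assumes "finite X" "X \<noteq> {}" "inj_on z X" "noncrossing z X f" "noncrossing z X g"
    and "\<And>Y. Y \<subseteq> X \<Longrightarrow> Y \<noteq> {} \<Longrightarrow> (\<And>y. y \<in> Y \<Longrightarrow> f y \<in> Y \<and> g y \<in> Y) \<Longrightarrow> Y = X"
  shows "(\<Sum>x\<in>X. if odd_right z X x then sgn (z (f x) - z x) + sgn (z (g x) - z x) else 0) = 2"
  using assms
proof (induction "card X" arbitrary: X g rule: less_induct)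
  case less
  note fin = less.prems(1) and inj = less.prems(3) and nf = less.prems(4) and ng = less.prems(5)
  note conn = less.prems(6)
  note fX = noncrossingD[OF nf] and gX = noncrossingD[OF ng]
  have zne: "z x \<noteq> z y" if "x \<in> X" "y \<in> X" "x \<noteq> y" for x y using inj that by (auto dest: inj_onD)
  obtain w where w: "w \<in> X" using less.prems(2) by blast
  let ?L = "{x\<in>X. z x < z (f x)}"
  have "w \<in> ?L \<or> f w \<in> ?L" using fX[OF w] w zne[of w "f w"] by (auto simp: not_less_iff_gr_or_eq)
  then have "?L \<noteq> {}" by blast
  then obtain a where a: "a \<in> ?L" and amin: "\<And>y. y \<in> ?L \<Longrightarrow> z (f a) - z a \<le> z (f y) - z y"
    using arg_min_if_finite(1)[of ?L "\<lambda>y. z (f y) - z y"] arg_min_least[of ?L _ "\<lambda>y. z (f y) - z y"] fin by simp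
  define b where "b = f a"
  have aX: "a \<in> X" and bX: "b \<in> X" and ab: "z a < z b" and fb: "f b = a" "a \<noteq> b"
    using a fX[of a] unfolding b_def by auto
  \<comment> \<open>By noncrossing, a point beneath the shortest arc would lie on a still shorter
    one.\<close>
  have adj: "\<not> (z a < z y \<and> z y < z b)" if y: "y \<in> X" for y
  proof
    assume y2: "z a < z y \<and> z y < z b"
    then have y3: "z a < z (f y)" "z (f y) < z b"
      using noncrossing_between[OF nf aX y] unfolding b_def by auto
    show False
    proof (cases "z y < z (f y)")
      case True
      then show False using amin[of y] y y2 y3 unfolding b_def by auto
    next
      case False
      then have "z (f y) < z (f (f y))" using fX[OF y] y zne[of y "f y"] by auto
      then show False using amin[of "f y"] fX[OF y] y y2 y3 unfolding b_def by auto
    qed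
  qed
  have rab: "odd_right z X a \<longleftrightarrow> \<not> odd_right z X b"
    using odd_right_step[OF fin inj order_refl nf aX] fX aX unfolding b_def by auto
  have sides: "z y < z a \<longleftrightarrow> z y < z b" "z b < z y \<longleftrightarrow> z a < z y" if "y \<in> X" "y \<noteq> a" "y \<noteq> b" for y
    using adj[of y] zne[of y a] zne[of y b] that aX bX ab by auto
  let ?r = "odd_right z X"
  let ?G = "\<lambda>g x. if ?r x then sgn (z (f x) - z x) + sgn (z (g x) - z x) else 0"
  show ?case
  proof (cases "g a = b")
    case True
    then have "g b = a" using gX[OF aX] by simp
    then have X: "X = {a, b}"
      using conn[of "{a, b}"] aX bX True fb b_def by auto
    have "{y \<in> X. z a < z y} = {b}" "{y \<in> X. z b < z y} = {}" using ab unfolding X by auto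
    then have "card {y \<in> X. z a < z y} = 1" "card {y \<in> X. z b < z y} = 0" by (simp_all only: card.empty card_1_singleton_iff) simp
    then have "?r a" "\<not> ?r b" unfolding odd_right_def by simp_all
    then have "(\<Sum>x\<in>{a, b}. ?G g x) = sgn (z b - z a) + sgn (z b - z a)"
      using fb(2) True b_def by simp
    then show ?thesis using ab unfolding X by simp
  next
    case False
    define u v where "u = g a" and "v = g b"
    have uX: "u \<in> X" and vX: "v \<in> X" and gu: "g u = a" and gv: "g v = b"
      using gX aX bX unfolding u_def v_def by auto
    have ne: "u \<noteq> a" "u \<noteq> b" "v \<noteq> a" "v \<noteq> b" "u \<noteq> v"
      using gX[OF aX] gX[OF bX] False fb gu gv unfolding u_def v_def by auto
    \<comment> \<open>The \<open>f\<close>-arc from \<open>a\<close> to \<open>b\<close> disappears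
      together with the \<open>g\<close>-arcs at its ends, which are replaced by the single
      \<open>g\<close>-arc from \<open>u\<close> to \<open>v\<close>.\<close>
    define g' where "g' = (\<lambda>x. if x = u then v else if x = v then u else g x)"
    define X' where "X' = X - {a, b}"
    have X'X: "X' \<subseteq> X" "finite X'" unfolding X'_def using fin by auto
    have cross: "z x < z y \<Longrightarrow> z y < z (g x) \<Longrightarrow> z x < z (g y) \<and> z (g y) < z (g x)" if "x \<in> X" "y \<in> X" for x y
      using noncrossing_between[OF ng that] by auto
    have gu': "g a = u" "g b = v" unfolding u_def v_def by auto
    \<comment> \<open>Noncrossing of the \<open>g\<close>-arcs \<open>a u\<close> and
      \<open>b v\<close>, instantiated in all ways. As no point lies between \<open>a\<close> and
      \<open>b\<close>, only three orders remain: u < a < b < v, v < u < a < b and a < b < v <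
      u.\<close>
    note cr = cross[OF aX bX, unfolded gu'] cross[OF aX vX, unfolded gu' gv] cross[OF uX bX, unfolded gu gu']
      cross[OF uX vX, unfolded gu gv] cross[OF bX aX, unfolded gu'] cross[OF bX uX, unfolded gu' gu]
      cross[OF vX aX, unfolded gu' gv] cross[OF vX uX, unfolded gu gv]
    note su = sides[OF uX ne(1,2)] and sv = sides[OF vX ne(3,4)]
    have zuv: "z u \<noteq> z v" "z u \<noteq> z a" "z u \<noteq> z b" "z v \<noteq> z a" "z v \<noteq> z b"
      using zne ne aX bX uX vX by auto
    have r': "odd_right z X' x \<longleftrightarrow> ?r x" if x: "x \<in> X'" for x
    proof (cases "z x < z a")
      case True
      then have "{y \<in> X. z x < z y} = insert a (insert b {y \<in> X'. z x < z y})"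
        using aX bX ab unfolding X'_def by auto
      then show ?thesis unfolding odd_right_def using X'X fb(2) by (simp add: X'_def)
    next
      case False
      then have "{y \<in> X. z x < z y} = {y \<in> X'. z x < z y}"
        using x sides[of x] unfolding X'_def by auto
      then show ?thesis unfolding odd_right_def by simp
    qed
    have g'X: "g' x \<in> X' \<and> g' (g' x) = x \<and> g' x \<noteq> x" if x: "x \<in> X'" for x
    proof (cases "x = u \<or> x = v")
      case True
      then show ?thesis using ne uX vX unfolding g'_def X'_def by auto
    next
      case False
      have xX: "x \<in> X" "x \<noteq> a" "x \<noteq> b" using x unfolding X'_def by auto
      have "g x \<noteq> a" "g x \<noteq> b" "g x \<noteq> u" "g x \<noteq> v"
        using gX[OF xX(1)] False gu gv gu' xX by metis+
      then show ?thesis using False gX[OF xX(1)] unfolding g'_def X'_def by auto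
    qed
    \<comment> \<open>The path from \<open>u\<close> along its arc to \<open>a\<close>, straight on
      to \<open>b\<close> and along the other arc to \<open>v\<close> meets no other
      \<open>g\<close>-arc. So no other arc can separate \<open>u\<close> from
      \<open>v\<close>.\<close>
    have g'c: "z x < z (g' y) \<and> z (g' y) < z (g' x)"
      if xy: "x \<in> X'" "y \<in> X'" "z x < z y" "z y < z (g' x)" for x y
    proof -
      have xX: "x \<in> X" "x \<noteq> a" "x \<noteq> b" and yX: "y \<in> X" "y \<noteq> a" "y \<noteq> b" using xy unfolding X'_def by auto
      note gxX = gX[OF xX(1)] and gyX = gX[OF yX(1)]
      note sx = sides[OF xX] and sy = sides[OF yX]
      have xny: "x \<noteq> y" "y \<noteq> g' x" using xy by auto
      consider "x = u" "y \<noteq> u" "y \<noteq> v" | "x = v" "y \<noteq> u" "y \<noteq> v" | "x \<noteq> u" "x \<noteq> v" "y = u \<or> y = v"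
        | "x \<noteq> u" "x \<noteq> v" "y \<noteq> u" "y \<noteq> v"
        using xny unfolding g'_def by (auto split: if_splits)
      then show ?thesis
      proof cases
        case 1
        have "g y \<noteq> a" "g y \<noteq> b" "g y \<noteq> u" "g y \<noteq> v"
          using gyX 1 gu gv gu' yX by metis+
        then have n: "z (g y) \<noteq> z a" "z (g y) \<noteq> z b" "z (g y) \<noteq> z u" "z (g y) \<noteq> z v" "z y \<noteq> z a" "z y \<noteq> z b"
          using zne gyX(1) yX aX bX uX vX by auto
        have gg: "g' x = v" "g' y = g y" using 1 unfolding g'_def by auto
        have "z u < z y" "z y < z v" using xy 1 gg by auto
        moreover have ua: "z u < z a" using cr(1) su zuv \<open>z u < z y\<close> \<open>z y < z v\<close> ab by linarith
        moreover have bv: "z b < z v" using cr(4) sv zuv ua \<open>z u < z y\<close> \<open>z y < z v\<close> ab by linarith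
        ultimately have "z u < z (g y) \<and> z (g y) < z v"
          using cross[OF uX yX(1)] cross[OF bX yX(1)] sy n ab unfolding gu gu' by linarith
        then show ?thesis using gg 1 by simp
      next
        case 2
        have "g y \<noteq> a" "g y \<noteq> b" "g y \<noteq> u" "g y \<noteq> v"
          using gyX 2 gu gv gu' yX by metis+
        then have n: "z (g y) \<noteq> z a" "z (g y) \<noteq> z b" "z (g y) \<noteq> z u" "z (g y) \<noteq> z v" "z y \<noteq> z a" "z y \<noteq> z b"
          using zne gyX(1) yX aX bX uX vX by auto
        note sgy = sides[OF gyX(1) \<open>g y \<noteq> a\<close> \<open>g y \<noteq> b\<close>]
        have gg: "g' x = u" "g' y = g y" using 2 ne unfolding g'_def by auto
        have vyu: "z v < z y" "z y < z u" using xy 2 gg by auto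
        have "z v < z (g y) \<and> z (g y) < z u"
        proof (cases "z v < z a")
          case True
          then have "z u < z a" using cr(7) su zuv ab by linarith
          then show ?thesis
            using vyu True cross[OF vX yX(1)] cross[OF yX(1) uX] sgy n ab unfolding gu gv by linarith
        next
          case False
          then have "z b < z v" using zuv sv ab by linarith
          then show ?thesis
            using vyu cross[OF aX yX(1)] cross[OF gyX(1) vX] sgy n ab unfolding gu' gv gyX(2) by linarith
        qed
        then show ?thesis using gg 2 by simp
      next
        case 3
        have gx: "g' x = g x" using 3 unfolding g'_def by simp
        have "g x \<noteq> a" "g x \<noteq> b" using gxX 3 gu' by auto
        note sg = sides[OF gxX(1) this]
        from 3(3) show ?thesis
        proof
          assume y: "y = u"
          then have "z x < z u" "z u < z (g x)" using xy gx by auto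
          then have "z x < z v \<and> z v < z (g x)"
            using cross[OF xX(1) uX] cross[OF xX(1) bX] sx sg unfolding gu gu' by linarith
          then show ?thesis using gx y unfolding g'_def by simp
        next
          assume y: "y = v"
          then have "z x < z v" "z v < z (g x)" using xy gx by auto
          then have "z x < z u \<and> z u < z (g x)"
            using cross[OF xX(1) vX] cross[OF xX(1) aX] sx sg unfolding gv gu' by linarith
          then show ?thesis using gx y ne unfolding g'_def by simp
        qed
      next
        case 4
        then show ?thesis using xy cross[OF xX(1) yX(1)] unfolding g'_def by simp
      qed
    qed
    have ng': "noncrossing z X' g'"
      unfolding noncrossing_def involution_on_def using g'X g'c by blast
    have fX': "f x \<in> X'" if "x \<in> X'" for x
      using that fX[of x] fb unfolding X'_def b_def by (metis Diff_iff insert_iff singletonD)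
    have nf': "noncrossing z X' f" by (rule noncrossing_subset[OF nf X'X(1) fX'])
    have IH: "(\<Sum>x\<in>X'. if odd_right z X' x then sgn (z (f x) - z x) + sgn (z (g' x) - z x) else 0) = 2"
    proof (rule less.hyps)
      show "card X' < card X" using fin aX unfolding X'_def by (intro psubset_card_mono) auto
      show "X' \<noteq> {}" using uX ne unfolding X'_def by auto
      show "inj_on z X'" using inj X'X inj_on_subset by blast
      fix Y assume Y: "Y \<subseteq> X'" "Y \<noteq> {}" and cl: "\<And>y. y \<in> Y \<Longrightarrow> f y \<in> Y \<and> g' y \<in> Y"
      have uv: "u \<in> Y \<longleftrightarrow> v \<in> Y" using cl[of u] cl[of v] ne unfolding g'_def by auto
      \<comment> \<open>A closed set of the shortened curve lifts to the original one by putting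
        \<open>a\<close> and \<open>b\<close> back iff it contains \<open>u\<close>, equivalently
        \<open>v\<close>. Thus the shortened curve is again a single one.\<close>
      define Y2 where "Y2 = Y \<union> (if u \<in> Y then {a, b} else {})"
      have "f y \<in> Y2 \<and> g y \<in> Y2" if y: "y \<in> Y2" for y
      proof (cases "y \<in> {a, b}")
        case True
        then have "u \<in> Y" using y Y unfolding Y2_def X'_def by (auto split: if_splits)
        then show ?thesis using True uv fb b_def gu' unfolding Y2_def by auto
      next
        case False
        then have yY: "y \<in> Y" using y unfolding Y2_def by (auto split: if_splits)
        show ?thesis
        proof (cases "y = u \<or> y = v")
          case True
          then show ?thesis using yY cl[OF yY] uv gu gv unfolding Y2_def by auto
        next
          case False
          then have "g' y = g y" unfolding g'_def by simp
          then show ?thesis using cl[OF yY] unfolding Y2_def by auto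
        qed
      qed
      then have "Y2 = X" using Y X'X aX bX unfolding Y2_def by (intro conn) (auto split: if_splits)
      then show "Y = X'" using Y aX unfolding Y2_def X'_def by (auto split: if_splits)
    qed (use X'X nf' ng' in auto)
    then have IH': "(\<Sum>x\<in>X'. ?G g' x) = 2" using r' by (simp cong: sum.cong)
    have X': "X = insert a (insert b (insert u (insert v (X' - {u, v}))))"
      using aX bX uX vX unfolding X'_def by auto
    have X'': "X' = insert u (insert v (X' - {u, v}))"
      using uX vX ne unfolding X'_def by auto
    have "(\<Sum>x\<in>X. ?G g x) = ?G g a + ?G g b + ?G g u + ?G g v + (\<Sum>x\<in>X'-{u,v}. ?G g x)"
      by (subst (1) X') (use ne fb(2) X'X(2) in \<open>simp add: X'_def\<close>)
    moreover have "2 = ?G g' u + ?G g' v + (\<Sum>x\<in>X'-{u,v}. ?G g' x)"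
      by (subst IH'[symmetric], subst (1) X'') (use ne X'X(2) in simp)
    moreover have "(\<Sum>x\<in>X'-{u,v}. ?G g' x) = (\<Sum>x\<in>X'-{u,v}. ?G g x)"
      by (rule sum.cong) (auto simp: g'_def)
    moreover have "?G g a + ?G g b + ?G g u + ?G g v = ?G g' u + ?G g' v"
    proof -
      have ru: "?r u \<longleftrightarrow> \<not> ?r a" "?r v \<longleftrightarrow> \<not> ?r b"
        using odd_right_step[OF fin inj order_refl ng] gX aX bX unfolding u_def v_def by auto
      have sg: "z x < z y \<Longrightarrow> sgn (z x - z y) = -1" "z y < z x \<Longrightarrow> sgn (z x - z y) = 1" for x y
        by (simp_all add: sgn_if)
      consider "z u < z a" "z b < z v" | "z v < z u" "z u < z a" | "z b < z v" "z v < z u"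
      proof (cases "z u < z a")
        case True
        show ?thesis
        proof (cases "z v < z a")
          case T2: True
          then have "z v < z u" using cr(4) True zuv ab by linarith
          then show ?thesis using that True by blast
        next
          case False
          then have "z b < z v" using zuv sv by linarith
          then show ?thesis using that True by blast
        qed
      next
        case False
        then have "z b < z u" using zuv su by linarith
        moreover from this have "z b < z v" using cr(7) zuv sv ab by linarith
        moreover have "z v < z u" using cr(6) calculation zuv ab by linarith
        ultimately show ?thesis using that by blast
      qed
      \<comment> \<open>The signs of the three removed arcs add up to the sign of the new one, in
        each of the three possible orders.\<close>
      then have id: "1 + sgn (z u - z a) + sgn (z b - z v) = sgn (z u - z v)"
      proof cases
        case 1 then show ?thesis using ab sg(1)[of u a] sg(1)[of b v] sg(1)[of u v] by simp
      next
        case 2 then show ?thesis using ab sg(1)[of u a] sg(2)[of v b] sg(2)[of v u] by simp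
      next
        case 3 then show ?thesis using ab sg(2)[of a u] sg(1)[of b v] sg(2)[of v u] by simp
      qed
      have anti: "sgn (z x - z y) = - sgn (z y - z x)" for x y by (simp add: sgn_if)
      have sab: "sgn (z b - z a) = 1" using ab by simp
      have fa: "f a = b" by (simp add: b_def)
      show ?thesis
      proof (cases "?r a")
        case True
        then have "?r v" "\<not> ?r b" "\<not> ?r u" using rab ru by auto
        then show ?thesis using True id sab ne unfolding g'_def gu gv gu' fa by simp
      next
        case False
        then have "\<not> ?r v" "?r b" "?r u" using rab ru by auto
        then show ?thesis using False id sab anti[of a b] anti[of v b] anti[of a u] anti[of v u] fb unfolding g'_def gu gv gu' by simp
      qed
    qed
    ultimately show ?thesis by simp
  qed
qed

section \<open>Planar two-level diagrams\<close>

text \<open>Since \<open>k\<close> is the left end of its arc, an arc that starts beneath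
  \<open>(i, j)\<close> can leave only to the right; the last inequality therefore excludes all
  crossings.\<close>

definition matching :: "int set \<Rightarrow> arc set \<Rightarrow> bool" where
  "matching S X \<longleftrightarrow> (\<forall>(i, j)\<in>X. i < j \<and> i \<in> S \<and> j \<in> S) \<and>
     (\<forall>v\<in>S. \<exists>!w. (v, w) \<in> X \<or> (w, v) \<in> X) \<and>
     (\<forall>i j k l. (i, j) \<in> X \<longrightarrow> (k, l) \<in> X \<longrightarrow> i < k \<longrightarrow> k < j \<longrightarrow> l < j)"

definition partner :: "arc set \<Rightarrow> int \<Rightarrow> int" where
  "partner X v = (THE w. (v, w) \<in> X \<or> (w, v) \<in> X)"

lemma matchingD:
  assumes "matching S X" "(i, j) \<in> X"
  shows "i < j" "i \<in> S" "j \<in> S"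
  using assms unfolding matching_def by blast+

lemma matching_nested:
  assumes "matching S X" "(i, j) \<in> X" "(k, l) \<in> X" "i < k" "k < j"
  shows "l < j"
  using assms unfolding matching_def by blast

lemma partner_arc:
  assumes "matching S X" "v \<in> S"
  shows "(v, partner X v) \<in> X \<or> (partner X v, v) \<in> X"
  unfolding partner_def by (rule theI') (use assms in \<open>auto simp: matching_def\<close>)

lemma partner_eq:
  assumes "matching S X" "(v, w) \<in> X \<or> (w, v) \<in> X"
  shows "partner X v = w"
proof -
  have "v \<in> S" using assms matchingD by blast
  then have "\<exists>!w. (v, w) \<in> X \<or> (w, v) \<in> X" using assms(1) unfolding matching_def by blast
  then show ?thesis unfolding partner_def using assms(2) by (rule the1_equality)
qed

lemma partner_in:
  assumes "matching S X" "v \<in> S"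
  shows "partner X v \<in> S" "partner X (partner X v) = v" "partner X v \<noteq> v"
proof -
  note a = partner_arc[OF assms]
  show "partner X v \<in> S" using a matchingD[OF assms(1)] by blast
  show "partner X (partner X v) = v" using a by (intro partner_eq[OF assms(1)]) blast
  show "partner X v \<noteq> v" using a matchingD(1)[OF assms(1)] by fastforce
qed

lemma noncrossing_partner:
  assumes m: "matching S X"
  shows "noncrossing (\<lambda>x. x) S (partner X)"
  unfolding noncrossing_def involution_on_def
proof (intro conjI ballI impI)
  fix x y assume xy: "x \<in> S" "y \<in> S" "x < y" "y < partner X x"
  have x: "(x, partner X x) \<in> X" using partner_arc[OF m xy(1)] matchingD(1)[OF m] xy by force
  consider "(y, partner X y) \<in> X" | "(partner X y, y) \<in> X" using partner_arc[OF m xy(2)] by blast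
  then have "x < partner X y \<and> partner X y < partner X x"
  proof cases
    case 1
    then show ?thesis using matching_nested[OF m x 1 xy(3,4)] matchingD(1)[OF m 1] xy(3) by simp
  next
    case 2
    have "partner X y \<noteq> x" using partner_in[OF m xy(2)] xy(4) by auto
    moreover have "\<not> partner X y < x" using matching_nested[OF m 2 x] xy by fastforce
    ultimately show ?thesis using matchingD(1)[OF m 2] xy by simp
  qed
  then show "x < partner X y" "partner X y < partner X x" by auto
qed (use partner_in[OF m] in auto)

lemma finite_matching:
  assumes "finite S" "matching S X" shows "finite X"
  by (rule finite_subset[of _ "S \<times> S"]) (use assms matchingD in \<open>auto simp: \<close>)

lemma sum_matching:
  fixes f :: "int \<Rightarrow> 'b::comm_monoid_add"
  assumes "finite S" "matching S X" "Y \<subseteq> S" "\<And>v. v \<in> Y \<Longrightarrow> partner X v \<in> Y"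
  shows "(\<Sum>v\<in>Y. f v) = (\<Sum>(i, j)\<in>{\<gamma>\<in>X. fst \<gamma> \<in> Y}. f i + f j)"
proof -
  note m = assms(2)
  let ?X = "{\<gamma>\<in>X. fst \<gamma> \<in> Y}"
  have fX: "finite ?X" using finite_matching[OF assms(1,2)] by simp
  have mem: "snd \<gamma> = partner X (fst \<gamma>)" "fst \<gamma> = partner X (snd \<gamma>)" "fst \<gamma> < snd \<gamma>" if "\<gamma> \<in> ?X" for \<gamma>
  proof -
    have "(fst \<gamma>, snd \<gamma>) \<in> X" using that by simp
    then show "snd \<gamma> = partner X (fst \<gamma>)" "fst \<gamma> = partner X (snd \<gamma>)" "fst \<gamma> < snd \<gamma>"
      using partner_eq[OF m, of "fst \<gamma>" "snd \<gamma>"] partner_eq[OF m, of "snd \<gamma>" "fst \<gamma>"] matchingD(1)[OF m] by simp_all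
  qed
  have inj: "inj_on fst ?X" "inj_on snd ?X"
  proof -
    show "inj_on fst ?X" using mem(1) by (intro inj_onI prod_eqI) (assumption, metis)
    show "inj_on snd ?X" using mem(2) by (intro inj_onI prod_eqI) (metis, assumption)
  qed
  have Y: "Y = fst ` ?X \<union> snd ` ?X"
  proof
    show "Y \<subseteq> fst ` ?X \<union> snd ` ?X"
    proof
      fix v assume v: "v \<in> Y"
      then have "(v, partner X v) \<in> X \<or> (partner X v, v) \<in> X" using partner_arc[OF m] assms(3) by blast
      then have "(v, partner X v) \<in> ?X \<or> (partner X v, v) \<in> ?X" using v assms(4) by auto
      then show "v \<in> fst ` ?X \<union> snd ` ?X" by force
    qed
    show "fst ` ?X \<union> snd ` ?X \<subseteq> Y" using mem(1) assms(4) by auto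
  qed
  have "fst ` ?X \<inter> snd ` ?X = {}"
  proof -
    have "fst \<gamma> \<noteq> snd \<delta>" if "\<gamma> \<in> ?X" "\<delta> \<in> ?X" for \<gamma> \<delta>
    proof
      assume e: "fst \<gamma> = snd \<delta>"
      then have "snd \<gamma> = fst \<delta>" by (subst mem(1)[OF that(1)], subst mem(2)[OF that(2)]) (rule arg_cong)
      then show False using mem(3)[OF that(1)] mem(3)[OF that(2)] e by linarith
    qed
    then show ?thesis by blast
  qed
  then have "(\<Sum>v\<in>Y. f v) = (\<Sum>v\<in>fst ` ?X. f v) + (\<Sum>v\<in>snd ` ?X. f v)"
    by (subst Y, intro sum.union_disjoint) (use fX in auto)
  also have "\<dots> = (\<Sum>\<gamma>\<in>?X. f (fst \<gamma>) + f (snd \<gamma>))"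
    using inj by (simp add: sum.reindex sum.distrib)
  finally show ?thesis by (simp add: case_prod_beta)
qed

text \<open>The shape of every diagram that occurs during a multiplication: \<open>M\<close>
  consists of the middle pairs that are still to be cut, \<open>V\<close> of the positions of the
  vertical lines inserted so far.\<close>

definition mid_diagram :: "arc set \<Rightarrow> arc set \<Rightarrow> arc set \<Rightarrow> int set \<Rightarrow> diagram" where
  "mid_diagram A M B V = \<lparr>cups = {Lower} \<times> A \<union> {Upper} \<times> M, caps = {Lower} \<times> M \<union> {Upper} \<times> B, vlines = V\<rparr>"

fun other :: "level \<Rightarrow> level" where
  "other Lower = Upper" | "other Upper = Lower"

text \<open>Walking along the lower level to the right and back along the upper one turns the
  two-level diagram into a one-level diagram: the arcs and vertical lines between the two
  levels lie on one side of this path, all the others on the other side.\<close>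

fun zigzag :: "int set \<Rightarrow> vertex \<Rightarrow> int" where
  "zigzag S (Lower, i) = i"
| "zigzag S (Upper, i) = 2 * Max S + 1 - i"

fun outward :: "arc set \<Rightarrow> arc set \<Rightarrow> vertex \<Rightarrow> vertex" where
  "outward A B (Lower, i) = (Lower, partner A i)"
| "outward A B (Upper, i) = (Upper, partner B i)"

fun inward :: "arc set \<Rightarrow> int set \<Rightarrow> vertex \<Rightarrow> vertex" where
  "inward M V (l, i) = (if i \<in> V then (other l, i) else (l, partner M i))"

text \<open>The sign \<chi>: the ray to the right of the left end starts in the region between the
  arc and the line.\<close>

definition left_interior :: "circle \<Rightarrow> level \<times> arc \<Rightarrow> int" where
  "left_interior C a = (if odd_to_the_right C (fst a, fst (snd a)) then 1 else - 1)"

definition cups_of :: "diagram \<Rightarrow> circle \<Rightarrow> (level \<times> arc) set" where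
  "cups_of D C = {(l, \<gamma>) \<in> cups D. (l, fst \<gamma>) \<in> C}"

definition caps_of :: "diagram \<Rightarrow> circle \<Rightarrow> (level \<times> arc) set" where
  "caps_of D C = {(l, \<gamma>) \<in> caps D. (l, fst \<gamma>) \<in> C}"

text \<open>\<open>MV\<close> expresses that outer pairs are cut before the pairs nested in them, as
  a vertical line would cross a remaining pair around it. \<open>p_odd\<close> is the only
  arithmetic property of the position function beyond monotonicity; it makes all circles
  orientable.\<close>

locale planar =
  fixes A M B :: "arc set" and V S :: "int set" and p :: "int \<Rightarrow> nat"
  assumes finS: "finite S" and mA: "matching S A" and mB: "matching S B" and mM: "matching (S - V) M"
    and VS: "V \<subseteq> S" and MV: "\<And>i j v. (i, j) \<in> M \<Longrightarrow> v \<in> V \<Longrightarrow> \<not> (i < v \<and> v < j)"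
    and p_mono: "mono p" and p_odd: "\<And>i j. (i, j) \<in> A \<union> M \<union> B \<Longrightarrow> odd (p i + p j)"
begin

abbreviation "D \<equiv> mid_diagram A M B V"
abbreviation "W \<equiv> (UNIV :: level set) \<times> S"
abbreviation "z \<equiv> zigzag S"
abbreviation "out \<equiv> outward A B"
abbreviation "inn \<equiv> inward M V"

lemma level_UNIV: "(UNIV :: level set) = {Lower, Upper}"
  using level.exhaust by auto

lemma finW: "finite W" using finS unfolding level_UNIV by auto

text \<open>The summand 1 in \<open>zigzag\<close> matters here: without it the two vertices at
  \<open>Max S\<close> would get the same coordinate.\<close>

lemma z_lower_upper:
  assumes "i \<in> S" "j \<in> S" shows "z (Lower, i) < z (Upper, j)"
proof -
  have "i \<le> Max S" "j \<le> Max S" using assms finS by auto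
  then show ?thesis by simp
qed

lemma le_Max: "i \<in> S \<Longrightarrow> i \<le> Max S"
  using finS by simp

lemma inj_z: "inj_on z W"
proof (rule inj_onI)
  fix x y assume "x \<in> W" "y \<in> W" "z x = z y"
  then show "x = y"
    using z_lower_upper[of "snd x" "snd y"] z_lower_upper[of "snd y" "snd x"]
    by (cases x; cases y; cases "fst x"; cases "fst y") auto
qed

lemma noncrossing_out: "noncrossing z W out"
  unfolding noncrossing_def
proof (intro conjI ballI impI)
  show "involution_on W out"
    unfolding involution_on_def
  proof
    fix x assume "x \<in> W"
    then obtain l i where x: "x = (l, i)" "i \<in> S" by auto
    show "out x \<in> W \<and> out (out x) = x \<and> out x \<noteq> x"
      using partner_in[OF mA x(2)] partner_in[OF mB x(2)] unfolding x by (cases l) auto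
  qed
next
  fix x y assume xy: "x \<in> W" "y \<in> W" "z x < z y" "z y < z (out x)"
  obtain l i k j where x: "x = (l, i)" and y: "y = (k, j)" by (cases x, cases y)
  have S: "i \<in> S" "j \<in> S" "partner A i \<in> S" "partner B i \<in> S" using xy x y partner_in mA mB by auto
  have "z x < z (out y) \<and> z (out y) < z (out x)"
  proof (cases l; cases k)
    assume l: "l = Lower" "k = Lower"
    show ?thesis
      using noncrossing_between[OF noncrossing_partner[OF mA] S(1,2)] xy(3,4) unfolding x y l by simp
  next
    assume l: "l = Lower" "k = Upper"
    show ?thesis using z_lower_upper[OF S(3,2)] xy(3,4) unfolding x y l by simp
  next
    assume l: "l = Upper" "k = Lower"
    show ?thesis using z_lower_upper[OF S(2,1)] xy(3,4) unfolding x y l by simp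
  next
    assume l: "l = Upper" "k = Upper"
    have "partner B i < partner B j" "partner B j < partner B (partner B i)"
      using noncrossing_between[OF noncrossing_partner[OF mB] S(4,2)] partner_in[OF mB S(1)] xy(3,4) unfolding x y l by simp_all
    then show ?thesis using partner_in[OF mB S(1)] unfolding x y l by simp
  qed
  then show "z x < z (out y)" "z (out y) < z (out x)" by auto
qed

lemma partner_M:
  assumes "i \<in> S" "i \<notin> V"
  shows "partner M i \<in> S" "partner M i \<notin> V" "partner M (partner M i) = i" "partner M i \<noteq> i"
  using partner_in[OF mM, of i] assms by auto

lemma M_no_V:
  assumes "i \<in> S" "i \<notin> V" "v \<in> V"
  shows "i < v \<longleftrightarrow> partner M i < v"
proof -
  have "(i, partner M i) \<in> M \<or> (partner M i, i) \<in> M" using partner_arc[OF mM, of i] assms by auto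
  moreover have "partner M i \<noteq> v" "i \<noteq> v" using assms partner_M by auto
  ultimately show ?thesis using MV[of i "partner M i" v] MV[of "partner M i" i v] assms(3) matchingD(1)[OF mM] by force
qed

lemma noncrossing_inn: "noncrossing z W inn"
  unfolding noncrossing_def
proof (intro conjI ballI impI)
  have "other (other l) = l" "other l \<noteq> l" for l by (cases l; simp)+
  then show "involution_on W inn"
    unfolding involution_on_def using partner_M VS by auto
next
  fix x y assume xy: "x \<in> W" "y \<in> W" "z x < z y" "z y < z (inn x)"
  obtain l i k j where x: "x = (l, i)" and y: "y = (k, j)" by (cases x, cases y)
  have S: "i \<in> S" "j \<in> S" using xy x y by auto
  have M: "i' < j' \<and> j' < partner M i' \<Longrightarrow> i' < partner M j' \<and> partner M j' < partner M i'" if "i' \<in> S - V" "j' \<in> S - V" for i' j'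
    using noncrossing_between[OF noncrossing_partner[OF mM] that] by simp
  have "z x < z (inn y) \<and> z (inn y) < z (inn x)"
  proof (cases "i \<in> V"; cases "j \<in> V")
    assume v: "i \<in> V" "j \<in> V"
    show ?thesis
      using xy(3,4) v le_Max[OF S(1)] le_Max[OF S(2)] unfolding x y by (cases l; cases k; simp)
  next
    assume v: "i \<in> V" "j \<notin> V"
    note pj = partner_M[OF S(2) v(2)]
    have "j < i \<longleftrightarrow> partner M j < i" "j \<noteq> i" "partner M j \<noteq> i" using M_no_V[OF S(2) v(2,1)] v pj by auto
    then show ?thesis
      using xy(3,4) v le_Max[OF S(1)] le_Max[OF S(2)] le_Max[OF pj(1)] unfolding x y by (cases l; cases k; simp)
  next
    assume v: "i \<notin> V" "j \<in> V"
    note pi = partner_M[OF S(1) v(1)]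
    have "i < j \<longleftrightarrow> partner M i < j" "i \<noteq> j" "partner M i \<noteq> j" using M_no_V[OF S(1) v] v pi by auto
    then show ?thesis
      using xy(3,4) v le_Max[OF S(1)] le_Max[OF S(2)] le_Max[OF pi(1)] unfolding x y by (cases l; cases k; simp)
  next
    assume v: "i \<notin> V" "j \<notin> V"
    note pi = partner_M[OF S(1) v(1)] and pj = partner_M[OF S(2) v(2)]
    have "i < j \<and> j < partner M i \<Longrightarrow> i < partner M j \<and> partner M j < partner M i"
      "partner M i < j \<and> j < i \<Longrightarrow> partner M i < partner M j \<and> partner M j < i"
      using M[of i j] M[of "partner M i" j] pi S v by auto
    then show ?thesis
      using xy(3,4) v le_Max[OF S(1)] le_Max[OF S(2)] le_Max[OF pi(1)] le_Max[OF pj(1)] unfolding x y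
      by (cases l; cases k; simp)
  qed
  then show "z x < z (inn y)" "z (inn y) < z (inn x)" by auto
qed

lemma out_in: "x \<in> W \<Longrightarrow> out x \<in> W" "x \<in> W \<Longrightarrow> out (out x) = x"
  using noncrossingD[OF noncrossing_out] by auto

lemma inn_in: "x \<in> W \<Longrightarrow> inn x \<in> W" "x \<in> W \<Longrightarrow> inn (inn x) = x"
  using noncrossingD[OF noncrossing_inn] by auto

lemma invs: "involution_on W out" "involution_on W inn"
  using noncrossing_out noncrossing_inn unfolding noncrossing_def by auto

lemma adjacency_eq: "adjacency D = {(x, y). x \<in> W \<and> (y = out x \<or> y = inn x)}"
proof -
  have mat: "(i, j) \<in> X \<or> (j, i) \<in> X \<longleftrightarrow> i \<in> T \<and> j = partner X i" if "matching T X" for X T i j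
    using partner_eq[OF that, of i j] partner_arc[OF that, of i] matchingD[OF that] by blast
  show ?thesis
  proof (intro set_eqI)
    fix xy :: "vertex \<times> vertex"
    obtain l i k j where xy: "xy = ((l, i), (k, j))" by (metis surj_pair)
    show "xy \<in> adjacency D \<longleftrightarrow> xy \<in> {(x, y). x \<in> W \<and> (y = out x \<or> y = inn x)}"
    proof -
      let ?X = "case l of Lower \<Rightarrow> A | Upper \<Rightarrow> B"
      have "xy \<in> adjacency D \<longleftrightarrow>
          l = k \<and> (((i, j) \<in> ?X \<or> (j, i) \<in> ?X) \<or> ((i, j) \<in> M \<or> (j, i) \<in> M)) \<or> l \<noteq> k \<and> i = j \<and> i \<in> V"
        unfolding xy adjacency_def mid_diagram_def Let_def by (cases l; cases k) auto
      also have "\<dots> \<longleftrightarrow> l = k \<and> (i \<in> S \<and> j = partner ?X i \<or> i \<in> S - V \<and> j = partner M i) \<or> l \<noteq> k \<and> i = j \<and> i \<in> V"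
        unfolding mat[OF mM] by (cases l) (simp_all add: mat[OF mA] mat[OF mB])
      also have "\<dots> \<longleftrightarrow> i \<in> S \<and> ((k, j) = out (l, i) \<or> (k, j) = inn (l, i))"
        using VS by (cases l; cases k) auto
      finally show ?thesis unfolding xy by auto
    qed
  qed
qed

declare inward.simps [simp del] outward.simps [simp del]

lemma circle_of_eq: "v \<in> W \<Longrightarrow> circle_of D v = orb out inn v"
proof (intro equalityI subsetI)
  fix w assume v: "v \<in> W" and "w \<in> circle_of D v"
  then have "(v, w) \<in> (adjacency D)\<^sup>*" unfolding circle_of_def by simp
  then show "w \<in> orb out inn v"
    by induction (auto simp: adjacency_eq orb_refl intro: orb_closed)
next
  fix w assume v: "v \<in> W" and "w \<in> orb out inn v"
  then have "(v, w) \<in> {(x, y). y = out x \<or> y = inn x}\<^sup>*" unfolding orb_def by simp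
  then have "w \<in> W \<and> (v, w) \<in> (adjacency D)\<^sup>*"
  proof induction
    case (step x y)
    then have "(x, y) \<in> adjacency D" unfolding adjacency_eq by auto
    moreover have "y \<in> W" using step out_in(1)[of x] inn_in(1)[of x] by auto
    ultimately show ?case using step by (auto intro: rtrancl_into_rtrancl)
  qed (use v in auto)
  then show "w \<in> circle_of D v" unfolding circle_of_def by simp
qed

lemma circles_eq: "circles D = orb out inn ` W"
proof -
  have "Domain (adjacency D) = W" unfolding adjacency_eq Domain_unfold by blast
  then show ?thesis unfolding circles_def using circle_of_eq by simp
qed

lemma finite_circles: "finite (circles D)" unfolding circles_eq using finW by simp

lemma circleD:
  assumes "C \<in> circles D"
  shows "C \<subseteq> W" "C \<noteq> {}" "finite C" "\<And>x. x \<in> C \<Longrightarrow> out x \<in> C" "\<And>x. x \<in> C \<Longrightarrow> inn x \<in> C"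
    "\<And>x. x \<in> C \<Longrightarrow> orb out inn x = C"
proof -
  obtain v where v: "v \<in> W" "C = orb out inn v" using assms unfolding circles_eq by auto
  show W: "C \<subseteq> W" using orb_subset[OF invs v(1)] v by simp
  then show "finite C" using finW finite_subset by blast
  show "C \<noteq> {}" using orb_refl[of v] v by blast
  show "out x \<in> C" "inn x \<in> C" if "x \<in> C" for x using orb_closed that v by auto
  show "orb out inn x = C" if "x \<in> C" for x using orb_eq[OF invs v(1)] that v by auto
qed

lemma circle_disjoint:
  assumes "C \<in> circles D" "C' \<in> circles D" "C \<noteq> C'"
  shows "C \<inter> C' = {}"
  using circleD(6)[OF assms(1)] circleD(6)[OF assms(2)] assms(3) by blast

lemma circle_of_in: "v \<in> W \<Longrightarrow> circle_of D v \<in> circles D" "v \<in> W \<Longrightarrow> v \<in> circle_of D v"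
  using circle_of_eq unfolding circles_eq by (auto simp: orb_refl)

lemma circle_invariant:
  assumes "C \<in> circles D" "v \<in> C" "w \<in> C"
    and "\<And>x. x \<in> C \<Longrightarrow> P (out x) \<longleftrightarrow> P x" "\<And>x. x \<in> C \<Longrightarrow> P (inn x) \<longleftrightarrow> P x"
  shows "P v \<longleftrightarrow> P w"
proof -
  have "orb out inn v \<subseteq> {x\<in>C. P x \<longleftrightarrow> P v}"
    by (rule orb_minimal) (use assms circleD[OF assms(1)] in auto)
  then show ?thesis using circleD(6)[OF assms(1,2)] assms(3) by auto
qed

lemma arc_partner:
  assumes "(l, i, j) \<in> cups D \<union> caps D"
  shows "(l, i) \<in> W" "(l, j) \<in> W" "i < j" "odd (p i + p j)" "p i < p j"
    "(l, j) = out (l, i) \<and> (l, i) = out (l, j) \<or> (l, j) = inn (l, i) \<and> (l, i) = inn (l, j)" (is ?g6)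
proof -
  have cs: "l = Lower \<and> (i, j) \<in> A \<or> l = Upper \<and> (i, j) \<in> B \<or> (i, j) \<in> M"
    using assms unfolding mid_diagram_def by auto
  then show "(l, i) \<in> W" "(l, j) \<in> W" "i < j" using matchingD[OF mA] matchingD[OF mB] matchingD[OF mM] by auto
  show o: "odd (p i + p j)" using cs p_odd by auto
  have "p i \<noteq> p j" using o by auto
  then show "p i < p j" using monoD[OF p_mono, of i j] \<open>i < j\<close> by simp
  show ?g6
    using cs partner_eq[OF mA, of i j] partner_eq[OF mA, of j i] partner_eq[OF mB, of i j] partner_eq[OF mB, of j i]
      partner_eq[OF mM, of i j] partner_eq[OF mM, of j i] matchingD[OF mM, of i j]
    by (cases l) (auto simp: inward.simps outward.simps)
qed

lemma finite_cups: "finite (cups D)" "finite (caps D)"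
proof -
  have "finite (S - V)" using finS by simp
  then show "finite (cups D)" "finite (caps D)"
    unfolding mid_diagram_def
    using finite_matching[OF finS mA] finite_matching[OF finS mB] finite_matching[OF _ mM] by auto
qed

text \<open>The colouring for \<open>switching\<close>: along an arc the parity of the position
  changes and the level stays, along a vertical line it is the other way round.\<close>

definition colour :: "vertex \<Rightarrow> bool" where
  "colour x \<longleftrightarrow> (even (p (snd x)) \<longleftrightarrow> fst x = Lower)"

lemma odd_partner:
  assumes "matching T X" "X \<subseteq> A \<union> M \<union> B" "i \<in> T"
  shows "odd (p i + p (partner X i))"
  using partner_arc[OF assms(1,3)] p_odd assms(2) by (metis add.commute subsetD)

lemma colour_flip:
  assumes "x \<in> W" shows "colour (out x) \<noteq> colour x" "colour (inn x) \<noteq> colour x"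
proof -
  obtain l i where x: "x = (l, i)" "i \<in> S" using assms by auto
  show "colour (out x) \<noteq> colour x"
    using odd_partner[OF mA _ x(2)] odd_partner[OF mB _ x(2)] unfolding x colour_def by (cases l) (auto simp: inward.simps outward.simps)
  show "colour (inn x) \<noteq> colour x"
    using odd_partner[OF mM, of i] x(2) unfolding x colour_def by (cases l) (auto simp: inward.simps outward.simps)
qed

text \<open>Each level meets \<open>X\<close> in an even number of points. A ray from the lower
  level runs along the zigzag through the whole upper level, which does not matter for the parity.
  On the upper level the zigzag reverses directions, so points to the left are counted instead; this
  differs from the count to the right by the starting point, if it is in \<open>X\<close>.\<close>

lemma odd_right_iff:
  assumes "X \<subseteq> W" "\<And>x. x \<in> X \<Longrightarrow> out x \<in> X" "i \<in> S"
  shows "odd_to_the_right X (Lower, i) \<longleftrightarrow> odd_right z X (Lower, i)" (is ?g1)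
    "odd_to_the_right X (Upper, i) \<longleftrightarrow> (odd_right z X (Upper, i) \<noteq> ((Upper, i) \<in> X))" (is ?g2)
proof -
  have fX: "finite X" using assms(1) finW finite_subset by blast
  let ?U = "{j. (Upper, j) \<in> X}"
  have U: "?U = snd ` (X \<inter> {Upper} \<times> UNIV)" by force
  have fU: "finite ?U" unfolding U using fX by simp
  have "involution_on ?U (partner B)"
    unfolding involution_on_def
  proof
    fix j assume j: "j \<in> ?U"
    then have "out (Upper, j) \<in> X" "j \<in> S" using assms(1,2) by auto
    then show "partner B j \<in> ?U \<and> partner B (partner B j) = j \<and> partner B j \<noteq> j"
      using partner_in[OF mB] by (simp add: outward.simps)
  qed
  then have ev: "even (card ?U)" using even_card_involution[OF fU] by simp
  have "{y \<in> X. z (Lower, i) < z y} = Pair Lower ` {y. i < y \<and> (Lower, y) \<in> X} \<union> Pair Upper ` ?U"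
  proof -
    have "y \<in> Pair Lower ` {y. i < y \<and> (Lower, y) \<in> X} \<union> Pair Upper ` ?U \<longleftrightarrow> z (Lower, i) < z y" if "y \<in> X" for y
      using that z_lower_upper[OF assms(3), of "snd y"] assms(1) by (cases y; cases "fst y") auto
    then show ?thesis by auto
  qed
  moreover have fL: "finite {y. i < y \<and> (Lower, y) \<in> X}"
    by (rule finite_subset[of _ "snd ` X"]) (use fX in force)+
  moreover have "card (Pair Lower ` {y. i < y \<and> (Lower, y) \<in> X} \<union> Pair Upper ` ?U) =
      card (Pair Lower ` {y. i < y \<and> (Lower, y) \<in> X}) + card (Pair Upper ` ?U)"
    using fL fU by (intro card_Un_disjoint) auto
  ultimately have "card {y \<in> X. z (Lower, i) < z y} = card {y. i < y \<and> (Lower, y) \<in> X} + card ?U"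
    by (simp add: card_image inj_on_def)
  then show ?g1
    unfolding odd_to_the_right_def odd_right_def using ev by simp
  have "{y \<in> X. z (Upper, i) < z y} = Pair Upper ` {y. y < i \<and> (Upper, y) \<in> X}"
  proof -
    have "y \<in> Pair Upper ` {y. y < i \<and> (Upper, y) \<in> X} \<longleftrightarrow> z (Upper, i) < z y" if "y \<in> X" for y
      using that z_lower_upper[of "snd y" i] assms by (cases y; cases "fst y") auto
    then show ?thesis by auto
  qed
  then have c1: "card {y \<in> X. z (Upper, i) < z y} = card {y. y < i \<and> (Upper, y) \<in> X}"
    by (simp add: card_image inj_on_def)
  let ?L = "{y. y < i \<and> (Upper, y) \<in> X}" and ?R = "{y. i < y \<and> (Upper, y) \<in> X}"
    and ?E = "if (Upper, i) \<in> X then {i} else {}"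
  have "finite ?L" "finite ?R"
    using fU by (auto intro: finite_subset[OF _ fU])
  then have "card (?L \<union> (?E \<union> ?R)) = card ?L + (card ?E + card ?R)"
    by (subst card_Un_disjoint; (subst card_Un_disjoint)?; auto)
  moreover have "?L \<union> (?E \<union> ?R) = ?U"
    by (auto simp: not_less_iff_gr_or_eq split: if_splits)
  ultimately have "card ?U = card ?L + (card ?E + card ?R)" by (simp only:)
  then show ?g2
    unfolding odd_to_the_right_def odd_right_def c1 using ev by (auto split: if_splits)
qed

lemma odd_right_iff':
  assumes "X \<subseteq> W" "\<And>x. x \<in> X \<Longrightarrow> out x \<in> X" "x \<in> W"
  shows "odd_to_the_right X x \<longleftrightarrow> (odd_right z X x \<noteq> (x \<in> X \<and> fst x = Upper))"
  using odd_right_iff[OF assms(1,2)] assms(3) by (cases x; cases "fst x") auto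

lemma odd_right_flip:
  assumes "X \<subseteq> W" "\<And>x. x \<in> X \<Longrightarrow> out x \<in> X \<and> inn x \<in> X" "x \<in> W"
  shows "odd_right z X (out x) \<longleftrightarrow> (odd_right z X x \<noteq> (x \<in> X))" (is ?g1)
    "odd_right z X (inn x) \<longleftrightarrow> (odd_right z X x \<noteq> (x \<in> X))" (is ?g2)
proof -
  have fX: "finite X" using assms(1) finW finite_subset by blast
  show ?g1
    by (rule odd_right_step[OF fX inj_z assms(1) noncrossing_out assms(3)]) (use assms(2) in blast)
  show ?g2
    by (rule odd_right_step[OF fX inj_z assms(1) noncrossing_inn assms(3)]) (use assms(2) in blast)
qed

text \<open>Follow \<open>C\<close> arc by arc: none of its arcs belongs to \<open>C'\<close>, so
  the side never changes. One vertex then decides about nesting.\<close>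

lemma side_constant:
  assumes "C \<in> circles D" "C' \<in> circles D" "C \<noteq> C'" "v \<in> C" "w \<in> C"
  shows "odd_to_the_right C' v \<longleftrightarrow> odd_to_the_right C' w"
proof -
  note c = circleD[OF assms(1)] and c' = circleD[OF assms(2)]
  have dj: "x \<notin> C'" if "x \<in> C" for x using circle_disjoint[OF assms(1-3)] that by blast
  have "odd_right z C' v \<longleftrightarrow> odd_right z C' w"
    by (rule circle_invariant[OF assms(1,4,5)])
      (use odd_right_flip[of C'] c c' dj in \<open>auto\<close>)
  moreover have "v \<in> W" "w \<in> W" "v \<notin> C'" "w \<notin> C'" using assms(4,5) c(1) dj by auto
  ultimately show ?thesis by (simp add: odd_right_iff'[OF c'(1,4)])
qed

lemma nested_iff:
  assumes "C \<in> circles D" "C' \<in> circles D" "C \<noteq> C'" "v \<in> C"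
  shows "nested_in C C' \<longleftrightarrow> odd_to_the_right C' v"
  using circle_disjoint[OF assms(1-3)] side_constant[OF assms(1-3)] assms(4) unfolding nested_in_def by blast

text \<open>If \<open>C\<close> reached at least as far to the right as \<open>C'\<close>, the ray
  from its rightmost vertex would miss \<open>C'\<close>.\<close>

lemma nested_Max:
  assumes "C \<in> circles D" "C' \<in> circles D" "nested_in C C'"
  shows "Max (snd ` C) < Max (snd ` C')"
proof (rule ccontr)
  assume a: "\<not> Max (snd ` C) < Max (snd ` C')"
  note c = circleD[OF assms(1)] and c' = circleD[OF assms(2)]
  have "Max (snd ` C) \<in> snd ` C" using c by (intro Max_in) auto
  then obtain v where v: "v \<in> C" "snd v = Max (snd ` C)" by auto
  have "{y. snd v < y \<and> (fst v, y) \<in> C'} = {}"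
  proof -
    have "y \<le> Max (snd ` C')" if "(l, y) \<in> C'" for l y using c'(3) that by (intro Max_ge) force+
    then show ?thesis using a v by force
  qed
  then have "\<not> odd_to_the_right C' v" unfolding odd_to_the_right_def by (simp only: card.empty) simp
  then show False using v assms(3) unfolding nested_in_def by blast
qed

lemma not_nested_both:
  assumes "C \<in> circles D" "C' \<in> circles D" "nested_in C C'"
  shows "\<not> nested_in C' C"
  using nested_Max[OF assms] nested_Max[OF assms(2,1)] by fastforce

text \<open>Ray parity and colour both alternate along the circle, so their comparison is constant;
  at a rightmost vertex the ray is empty. The corrections for the upper level, in
  \<open>colour\<close> and in \<open>odd_right_iff'\<close>, cancel.\<close>

lemma parity_rightmost:
  assumes "C \<in> circles D" "(l, i) \<in> C"
  shows "odd_to_the_right C (l, i) \<longleftrightarrow> odd (p i + rightmost p C)"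
proof -
  note c = circleD[OF assms(1)]
  have "Max (snd ` C) \<in> snd ` C" using c by (intro Max_in) auto
  then obtain v where v: "v \<in> C" "snd v = Max (snd ` C)" by auto
  have "{y. snd v < y \<and> (fst v, y) \<in> C} = {}"
  proof -
    have "y \<le> Max (snd ` C)" if "(l, y) \<in> C" for l y using c(3) that by (intro Max_ge) force+
    then show ?thesis using v by force
  qed
  then have v0: "\<not> odd_to_the_right C v" unfolding odd_to_the_right_def by (simp only: card.empty) simp
  have eq: "(odd_right z C x \<longleftrightarrow> colour x) \<longleftrightarrow> (odd_to_the_right C x \<longleftrightarrow> even (p (snd x)))" if "x \<in> C" for x
    using odd_right_iff'[of C x] c that unfolding colour_def by (cases "fst x") auto
  have "(odd_right z C v \<longleftrightarrow> colour v) \<longleftrightarrow> (odd_right z C (l, i) \<longleftrightarrow> colour (l, i))"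
    by (rule circle_invariant[OF assms(1) v(1) assms(2)])
      (use odd_right_flip[of C] colour_flip c in \<open>auto\<close>)
  then have "(odd_to_the_right C v \<longleftrightarrow> even (p (snd v))) \<longleftrightarrow> (odd_to_the_right C (l, i) \<longleftrightarrow> even (p i))"
    using eq[OF v(1)] eq[OF assms(2)] by simp
  then show ?thesis using v0 v unfolding rightmost_def by auto
qed

lemma arc_in_circle:
  assumes "C \<in> circles D" "(l, i, j) \<in> cups_of D C \<union> caps_of D C"
  shows "(l, i) \<in> C" "(l, j) \<in> C" "odd_to_the_right C (l, j) \<longleftrightarrow> \<not> odd_to_the_right C (l, i)" (is ?g3)
proof -
  have a: "(l, i, j) \<in> cups D \<union> caps D" using assms(2) unfolding cups_of_def caps_of_def by auto
  show i: "(l, i) \<in> C" using assms(2) unfolding cups_of_def caps_of_def by auto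
  note ap = arc_partner[OF a] and c = circleD[OF assms(1)]
  show j: "(l, j) \<in> C" using ap(6) c i by metis
  show ?g3
    using parity_rightmost[OF assms(1) i] parity_rightmost[OF assms(1) j] ap(4) by auto
qed

end

section \<open>Sums over the arcs of one circle\<close>

abbreviation row :: "level \<Rightarrow> circle \<Rightarrow> int set" where
  "row l C \<equiv> {i. (l, i) \<in> C}"

definition ends :: "(vertex \<Rightarrow> int) \<Rightarrow> level \<times> arc \<Rightarrow> int" where
  "ends h a = h (fst a, fst (snd a)) + h (fst a, snd (snd a))"

context planar
begin

lemma on_level:
  assumes "C \<in> circles D"
  shows "row l C \<subseteq> S" "finite (row l C)"
    "\<And>i. (Lower, i) \<in> C \<Longrightarrow> (Lower, partner A i) \<in> C"
    "\<And>i. (Upper, i) \<in> C \<Longrightarrow> (Upper, partner B i) \<in> C"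
    "\<And>i. (l, i) \<in> C \<Longrightarrow> i \<notin> V \<Longrightarrow> (l, partner M i) \<in> C \<and> partner M i \<notin> V"
    "\<And>i. (l, i) \<in> C \<Longrightarrow> i \<in> V \<Longrightarrow> (other l, i) \<in> C"
proof -
  note c = circleD[OF assms]
  show s: "row l C \<subseteq> S" using c(1) by auto
  then show "finite (row l C)" using finS finite_subset by blast
  show "(Lower, partner A i) \<in> C" if "(Lower, i) \<in> C" for i using c(4)[OF that] by (simp add: outward.simps)
  show "(Upper, partner B i) \<in> C" if "(Upper, i) \<in> C" for i using c(4)[OF that] by (simp add: outward.simps)
  show "(other l, i) \<in> C" if "(l, i) \<in> C" "i \<in> V" for i using c(5)[OF that(1)] that(2) by (simp add: inward.simps)
  show "(l, partner M i) \<in> C \<and> partner M i \<notin> V" if "(l, i) \<in> C" "i \<notin> V" for i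
  proof -
    have "i \<in> S" using c(1) that by auto
    then show ?thesis using c(5)[OF that(1)] that(2) partner_M[of i] by (simp add: inward.simps)
  qed
qed

lemma sum_cups_of:
  assumes "C \<in> circles D"
  shows "(\<Sum>a\<in>cups_of D C. f a) = (\<Sum>\<gamma>\<in>{\<gamma>\<in>A. fst \<gamma> \<in> row Lower C}. f (Lower, \<gamma>)) +
      (\<Sum>\<gamma>\<in>{\<gamma>\<in>M. fst \<gamma> \<in> row Upper C - V}. f (Upper, \<gamma>))" (is ?g1)
    "(\<Sum>a\<in>caps_of D C. f a) = (\<Sum>\<gamma>\<in>{\<gamma>\<in>M. fst \<gamma> \<in> row Lower C - V}. f (Lower, \<gamma>)) +
      (\<Sum>\<gamma>\<in>{\<gamma>\<in>B. fst \<gamma> \<in> row Upper C}. f (Upper, \<gamma>))" (is ?g2)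
proof -
  have M: "fst \<gamma> \<notin> V" if "\<gamma> \<in> M" for \<gamma> using that matchingD(2)[OF mM, of "fst \<gamma>" "snd \<gamma>"] by simp
  have fin: "finite A" "finite B" "finite M"
    using finite_matching[OF finS mA] finite_matching[OF finS mB] finite_matching[OF _ mM] finS by auto
  have "cups_of D C = Pair Lower ` {\<gamma>\<in>A. fst \<gamma> \<in> row Lower C} \<union> Pair Upper ` {\<gamma>\<in>M. fst \<gamma> \<in> row Upper C - V}"
    using M unfolding cups_of_def mid_diagram_def by auto
  then show ?g1
    using fin by (simp only:) (subst sum.union_disjoint, auto simp: sum.reindex inj_on_def)
  have "caps_of D C = Pair Lower ` {\<gamma>\<in>M. fst \<gamma> \<in> row Lower C - V} \<union> Pair Upper ` {\<gamma>\<in>B. fst \<gamma> \<in> row Upper C}"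
    using M unfolding caps_of_def mid_diagram_def by auto
  then show ?g2
    using fin by (simp only:) (subst sum.union_disjoint, auto simp: sum.reindex inj_on_def)
qed

lemma level_sums:
  fixes h :: "vertex \<Rightarrow> int"
  assumes C: "C \<in> circles D"
  shows "(\<Sum>i\<in>row Lower C. h (Lower, i)) = (\<Sum>\<gamma>\<in>{\<gamma>\<in>A. fst \<gamma> \<in> row Lower C}. ends h (Lower, \<gamma>))" (is ?g1)
    "(\<Sum>i\<in>row Upper C. h (Upper, i)) = (\<Sum>\<gamma>\<in>{\<gamma>\<in>B. fst \<gamma> \<in> row Upper C}. ends h (Upper, \<gamma>))" (is ?g2)
    "(\<Sum>i\<in>row l C - V. h (l, i)) = (\<Sum>\<gamma>\<in>{\<gamma>\<in>M. fst \<gamma> \<in> row l C - V}. ends h (l, \<gamma>))" (is ?g3)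
proof -
  have fSV: "finite (S - V)" using finS by simp
  show ?g1
    using sum_matching[OF finS mA on_level(1)[OF C, of Lower], of "\<lambda>i. h (Lower, i)"] on_level(3)[OF C]
    by (simp add: ends_def case_prod_beta)
  show ?g2
    using sum_matching[OF finS mB on_level(1)[OF C, of Upper], of "\<lambda>i. h (Upper, i)"] on_level(4)[OF C]
    by (simp add: ends_def case_prod_beta)
  have "row l C - V \<subseteq> S - V" using on_level(1)[OF C, of l] by auto
  from sum_matching[OF fSV mM this, of "\<lambda>i. h (l, i)"]
  show ?g3
    using on_level(5)[OF C, of l] by (simp add: ends_def case_prod_beta)
qed

lemma verticals:
  assumes C: "C \<in> circles D"
  shows "row Upper C \<inter> V = row Lower C \<inter> V"
  using on_level(6)[OF C, of Lower] on_level(6)[OF C, of Upper] by auto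

lemma sum_split_V:
  fixes h :: "vertex \<Rightarrow> int"
  assumes C: "C \<in> circles D"
  shows "(\<Sum>i\<in>row l C. h (l, i)) = (\<Sum>i\<in>row l C - V. h (l, i)) + (\<Sum>i\<in>row Lower C \<inter> V. h (l, i))"
proof -
  have "row l C \<inter> V = row Lower C \<inter> V" using verticals[OF C] by (cases l) auto
  moreover have "row l C = (row l C - V) \<union> (row l C \<inter> V)" by blast
  ultimately show ?thesis
    using on_level(2)[OF C, of l] by (metis (no_types, lifting) Diff_Diff_Int finite_Int sum.Int_Diff add.commute)
qed

text \<open>Every vertex has one connection below and one above its line. Summing \<open>h\<close>
  over both lines from below and from above gives the cup and the cap sum, except for the vertical
  lines; these leave upwards from the lower and downwards from the upper level, and cancel if
  \<open>h\<close> agrees at their ends.\<close>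

lemma ends_balance:
  assumes C: "C \<in> circles D" and h: "\<And>v. v \<in> V \<Longrightarrow> (Lower, v) \<in> C \<Longrightarrow> h (Lower, v) = h (Upper, v)"
  shows "(\<Sum>a\<in>cups_of D C. ends h a) = (\<Sum>a\<in>caps_of D C. ends h a)"
proof -
  have "(\<Sum>i\<in>row Lower C \<inter> V. h (Lower, i)) = (\<Sum>i\<in>row Lower C \<inter> V. h (Upper, i))"
    using h by (intro sum.cong) auto
  then show ?thesis
    unfolding sum_cups_of[OF C] level_sums[OF C, symmetric]
    using sum_split_V[OF C, of h Lower] sum_split_V[OF C, of h Upper] by linarith
qed

lemma side_vertical:
  assumes C: "C \<in> circles D" and v: "v \<in> V" "(Lower, v) \<in> C"
  shows "(Upper, v) \<in> C" "odd_to_the_right C (Lower, v) \<longleftrightarrow> odd_to_the_right C (Upper, v)" (is ?g2)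
proof -
  show u: "(Upper, v) \<in> C" using on_level(6)[OF C v(2,1)] by simp
  show ?g2
    using parity_rightmost[OF C v(2)] parity_rightmost[OF C u] by simp
qed

lemma count_balance:
  assumes C: "C \<in> circles D"
  shows "card (cups_of D C) = card (caps_of D C)"
proof -
  have "(\<Sum>a\<in>cups_of D C. ends (\<lambda>_. 1) a) = (\<Sum>a\<in>caps_of D C. ends (\<lambda>_. 1) a)"
    by (rule ends_balance[OF C]) simp
  then show ?thesis by (simp add: ends_def)
qed

lemma displacement_balance:
  assumes C: "C \<in> circles D"
  shows "(\<Sum>a\<in>cups_of D C. left_interior C a * int (arc_dist p (snd a))) =
    (\<Sum>a\<in>caps_of D C. left_interior C a * int (arc_dist p (snd a)))"
proof -
  \<comment> \<open>The two ends of an arc are on opposite sides, so positions signed by the side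
    have \<open>- \<chi> d\<close> as their sum over the ends of an arc.\<close>
  define h where "h = (\<lambda>x. if odd_to_the_right C x then int (p (snd x)) else - int (p (snd x)))"
  have eq: "left_interior C a * int (arc_dist p (snd a)) = - ends h a" if a: "a \<in> cups_of D C \<union> caps_of D C" for a
  proof -
    obtain l i j where aa: "a = (l, i, j)" by (cases a) auto
    have "(l, i, j) \<in> cups D \<union> caps D" using a unfolding aa cups_of_def caps_of_def by auto
    then have "p i < p j" by (rule arc_partner(5))
    then show ?thesis
      using arc_in_circle(3)[OF C, of l i j] a unfolding aa left_interior_def ends_def h_def by (simp add: of_nat_diff)
  qed
  have "(\<Sum>a\<in>cups_of D C. - ends h a) = (\<Sum>a\<in>caps_of D C. - ends h a)"
    unfolding sum_negf by (subst ends_balance[OF C]) (use side_vertical[OF C] in \<open>auto simp: h_def\<close>)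
  then show ?thesis using eq by (simp cong: sum.cong)
qed

lemma turning:
  assumes C: "C \<in> circles D"
  shows "(\<Sum>a\<in>cups_of D C. left_interior C a) + (\<Sum>a\<in>caps_of D C. left_interior C a) = 2"
proof -
  note c = circleD[OF C]
  let ?r = "odd_right z C"
  \<comment> \<open>On the upper level \<open>zigzag\<close> exchanges left and right, and the two
    notions of parity differ as well. The two changes cancel, so an arc on either level contributes
    its sign \<chi> to the turning number.\<close>
  have r: "odd_to_the_right C x \<longleftrightarrow> (?r x \<noteq> (fst x = Upper))" if "x \<in> C" for x
    using odd_right_iff'[OF c(1,4), of x] that c(1) by auto
  define h where "h f = (\<lambda>x. if ?r x then sgn (z (f x) - z x) else 0 :: int)" for f :: "vertex \<Rightarrow> vertex"
  have total: "(\<Sum>x\<in>C. if ?r x then sgn (z (out x) - z x) + sgn (z (inn x) - z x) else 0) = 2"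
  proof (rule turning_number[OF c(3,2)])
    show "inj_on z C" using inj_z c(1) inj_on_subset by blast
    show "noncrossing z C out" "noncrossing z C inn"
      using noncrossing_subset[OF _ c(1)] noncrossing_out noncrossing_inn c by auto
    fix Y assume Y: "Y \<subseteq> C" "Y \<noteq> {}" and cl: "\<And>y. y \<in> Y \<Longrightarrow> out y \<in> Y \<and> inn y \<in> Y"
    obtain y where y: "y \<in> Y" using Y(2) by blast
    have "orb out inn y \<subseteq> Y" by (rule orb_minimal[OF y cl])
    then show "Y = C" using c(6)[of y] y Y(1) by auto
  qed
  have split: "(\<Sum>x\<in>C. if ?r x then sgn (z (out x) - z x) + sgn (z (inn x) - z x) else 0) =
      (\<Sum>x\<in>C. h out x) + (\<Sum>x\<in>C. h inn x)"
    unfolding sum.distrib[symmetric] h_def by (intro sum.cong) auto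
  have lev: "(\<Sum>x\<in>C. g x) = (\<Sum>i\<in>row Lower C. g (Lower, i)) + (\<Sum>i\<in>row Upper C. g (Upper, i))" for g :: "vertex \<Rightarrow> int"
  proof -
    have "C = Pair Lower ` row Lower C \<union> Pair Upper ` row Upper C"
    proof -
      have "x \<in> Pair Lower ` row Lower C \<union> Pair Upper ` row Upper C" if "x \<in> C" for x
        using that by (cases x; cases "fst x") auto
      then show ?thesis by blast
    qed
    then have "(\<Sum>x\<in>C. g x) = (\<Sum>x\<in>Pair Lower ` row Lower C \<union> Pair Upper ` row Upper C. g x)" by simp
    also have "\<dots> = (\<Sum>x\<in>Pair Lower ` row Lower C. g x) + (\<Sum>x\<in>Pair Upper ` row Upper C. g x)"
      using on_level(2)[OF C] by (intro sum.union_disjoint) auto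
    finally show ?thesis by (simp add: sum.reindex inj_on_def)
  qed
  have side: "(l, i) \<in> C" "(l, j) \<in> C" "odd_to_the_right C (l, j) \<longleftrightarrow> \<not> odd_to_the_right C (l, i)" "i < j"
    "i \<in> S" "j \<in> S"
    if "l = Lower \<and> (i, j) \<in> A \<or> l = Upper \<and> (i, j) \<in> B \<or> (i, j) \<in> M" "(l, i) \<in> C" for l i j
  proof -
    have "(l, i, j) \<in> cups_of D C \<union> caps_of D C"
      using that unfolding cups_of_def caps_of_def mid_diagram_def by (cases l) auto
    from arc_in_circle[OF C this]
    show "(l, i) \<in> C" "(l, j) \<in> C" "odd_to_the_right C (l, j) \<longleftrightarrow> \<not> odd_to_the_right C (l, i)" by auto
    show "i < j" "i \<in> S" "j \<in> S" using that(1) matchingD[OF mA] matchingD[OF mB] matchingD[OF mM] by blast+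
  qed
  have hA: "ends (h out) (Lower, \<gamma>) = left_interior C (Lower, \<gamma>)" if m: "\<gamma> \<in> {\<gamma>\<in>A. fst \<gamma> \<in> row Lower C}" for \<gamma>
  proof -
    obtain i j where g: "\<gamma> = (i, j)" "(i, j) \<in> A" "(Lower, i) \<in> C" using m by (cases \<gamma>) auto
    note s = side[of Lower i j] 
    have "partner A i = j" "partner A j = i" using partner_eq[OF mA] g by auto
    then show ?thesis using s g r[of "(Lower, i)"] r[of "(Lower, j)"]
      unfolding ends_def left_interior_def h_def g by (auto simp: outward.simps)
  qed
  have hB: "ends (h out) (Upper, \<gamma>) = left_interior C (Upper, \<gamma>)" if m: "\<gamma> \<in> {\<gamma>\<in>B. fst \<gamma> \<in> row Upper C}" for \<gamma>
  proof -
    obtain i j where g: "\<gamma> = (i, j)" "(i, j) \<in> B" "(Upper, i) \<in> C" using m by (cases \<gamma>) auto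
    note s = side[of Upper i j] 
    have "partner B i = j" "partner B j = i" using partner_eq[OF mB] g by auto
    then show ?thesis using s g r[of "(Upper, i)"] r[of "(Upper, j)"]
      unfolding ends_def left_interior_def h_def g by (auto simp: outward.simps)
  qed
  have hM: "ends (h inn) (l, \<gamma>) = left_interior C (l, \<gamma>)" if m: "\<gamma> \<in> {\<gamma>\<in>M. fst \<gamma> \<in> row l C - V}" for l \<gamma>
  proof -
    obtain i j where g: "\<gamma> = (i, j)" "(i, j) \<in> M" "(l, i) \<in> C" using m by (cases \<gamma>) auto
    note s = side[of l i j] 
    have "partner M i = j" "partner M j = i" "i \<notin> V" "j \<notin> V" using partner_eq[OF mM] g matchingD[OF mM g(2)] by auto
    then show ?thesis using s g r[of "(l, i)"] r[of "(l, j)"]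
      unfolding ends_def left_interior_def h_def g by (cases l) (auto simp: inward.simps)
  qed
  \<comment> \<open>In the zigzag picture vertical lines count as arcs, with sign \<rho>. Their
    total is 0: \<rho> cancels on the ends of each arc, hence over the whole lower row (matched by
    \<open>A\<close>) and over its part outside \<open>V\<close> (matched by \<open>M\<close>), and
    so over the rest.\<close>
  define \<rho> where "\<rho> = (\<lambda>x. if odd_to_the_right C x then 1 else - 1 :: int)"
  have \<rho>0: "ends \<rho> (Lower, \<gamma>) = 0" if "\<gamma> \<in> A \<union> M" "(Lower, fst \<gamma>) \<in> C" for \<gamma>
    using side[of Lower "fst \<gamma>" "snd \<gamma>"] that unfolding ends_def \<rho>_def by auto
  have "(\<Sum>i\<in>row Lower C. \<rho> (Lower, i)) = 0" "(\<Sum>i\<in>row Lower C - V. \<rho> (Lower, i)) = 0"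
    unfolding level_sums[OF C] using \<rho>0 by (auto intro!: sum.neutral)
  then have V0: "(\<Sum>i\<in>row Lower C \<inter> V. \<rho> (Lower, i)) = 0"
    using sum_split_V[OF C, of \<rho> Lower] by simp
  have hV: "h inn (Lower, i) + h inn (Upper, i) = \<rho> (Lower, i)" if "i \<in> row Lower C \<inter> V" for i
  proof -
    have i: "i \<in> V" "(Lower, i) \<in> C" "i \<in> S" using that VS by auto
    have u: "(Upper, i) \<in> C" "?r (Upper, i) \<longleftrightarrow> \<not> ?r (Lower, i)"
      using side_vertical[OF C i(1,2)] r[of "(Lower, i)"] r[of "(Upper, i)"] i by auto
    then show ?thesis using i r[of "(Lower, i)"] z_lower_upper[OF i(3,3)]
      unfolding h_def \<rho>_def by (auto simp: inward.simps)
  qed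
  have "(\<Sum>x\<in>C. h inn x) = (\<Sum>i\<in>row Lower C - V. h inn (Lower, i)) + (\<Sum>i\<in>row Upper C - V. h inn (Upper, i))
      + (\<Sum>i\<in>row Lower C \<inter> V. h inn (Lower, i) + h inn (Upper, i))"
    unfolding lev sum.distrib using sum_split_V[OF C, of "h inn" Lower] sum_split_V[OF C, of "h inn" Upper] by simp
  also have "(\<Sum>i\<in>row Lower C \<inter> V. h inn (Lower, i) + h inn (Upper, i)) = 0"
    unfolding V0[symmetric] by (intro sum.cong refl hV)
  finally have hinn: "(\<Sum>x\<in>C. h inn x) = (\<Sum>i\<in>row Lower C - V. h inn (Lower, i)) + (\<Sum>i\<in>row Upper C - V. h inn (Upper, i))"
    by simp
  have "sum (\<lambda>\<gamma>. ends (h out) (Lower, \<gamma>)) {\<gamma>\<in>A. fst \<gamma> \<in> row Lower C} =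
      sum (\<lambda>\<gamma>. left_interior C (Lower, \<gamma>)) {\<gamma>\<in>A. fst \<gamma> \<in> row Lower C}"
    "sum (\<lambda>\<gamma>. ends (h out) (Upper, \<gamma>)) {\<gamma>\<in>B. fst \<gamma> \<in> row Upper C} =
      sum (\<lambda>\<gamma>. left_interior C (Upper, \<gamma>)) {\<gamma>\<in>B. fst \<gamma> \<in> row Upper C}"
    "sum (\<lambda>\<gamma>. ends (h inn) (l, \<gamma>)) {\<gamma>\<in>M. fst \<gamma> \<in> row l C - V} =
      sum (\<lambda>\<gamma>. left_interior C (l, \<gamma>)) {\<gamma>\<in>M. fst \<gamma> \<in> row l C - V}" for l
    by (intro sum.cong refl hA hB hM; assumption)+
  then have "(\<Sum>a\<in>cups_of D C. left_interior C a) + (\<Sum>a\<in>caps_of D C. left_interior C a) = (\<Sum>x\<in>C. h out x) + (\<Sum>x\<in>C. h inn x)"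
    unfolding hinn lev[of "h out"] level_sums[OF C] sum_cups_of[OF C] by (simp only: ac_simps)
  then show ?thesis using total split by simp
qed

end

section \<open>Exponents of a circle\<close>

text \<open>The set \<open>C\<close> is deliberately arbitrary. Evaluating the sum on a union of
  circles, or on a circle of the cut diagram inside the uncut one, is what allows a comparison
  before and after a surgery.\<close>

definition exterior_sum :: "diagram \<Rightarrow> circle \<Rightarrow> (arc \<Rightarrow> 'b) \<Rightarrow> (arc \<Rightarrow> 'b) \<Rightarrow> 'b::comm_monoid_add" where
  "exterior_sum D C f g = (\<Sum>a\<in>icup D C. f (snd a)) + (\<Sum>a\<in>icap D C. g (snd a))"

text \<open>The contribution of a circle whose interior and exterior have been exchanged by an
  enclosing circle.\<close>

definition interior_sum :: "diagram \<Rightarrow> circle \<Rightarrow> (arc \<Rightarrow> 'b) \<Rightarrow> (arc \<Rightarrow> 'b) \<Rightarrow> 'b::comm_monoid_add" where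
  "interior_sum D C f g = (\<Sum>a\<in>cups_of D C - icup D C. f (snd a)) + (\<Sum>a\<in>caps_of D C - icap D C. g (snd a))"

definition cup_eps :: "(int \<Rightarrow> nat) \<Rightarrow> arc \<Rightarrow> nat" where
  "cup_eps p \<gamma> = (saddle_width p \<gamma> + 1) * p (fst \<gamma>)"

definition cap_eps :: "(int \<Rightarrow> nat) \<Rightarrow> arc \<Rightarrow> nat" where
  "cap_eps p \<gamma> = saddle_width p \<gamma> * (p (fst \<gamma>) + 1)"

definition cup_omega :: "(int \<Rightarrow> nat) \<Rightarrow> arc \<Rightarrow> int" where
  "cup_omega p \<gamma> = - int (saddle_width p \<gamma>)"

definition cap_omega :: "(int \<Rightarrow> nat) \<Rightarrow> arc \<Rightarrow> int" where
  "cap_omega p \<gamma> = int (saddle_width p \<gamma>) - 1"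

abbreviation eps_exp :: "(int \<Rightarrow> nat) \<Rightarrow> diagram \<Rightarrow> circle \<Rightarrow> nat" where
  "eps_exp p D C \<equiv> exterior_sum D C (cup_eps p) (cap_eps p)"

abbreviation omega_exp :: "(int \<Rightarrow> nat) \<Rightarrow> diagram \<Rightarrow> circle \<Rightarrow> int" where
  "omega_exp p D C \<equiv> exterior_sum D C (cup_omega p) (cap_omega p)"

lemma even_sum_cong:
  fixes f g :: "'a \<Rightarrow> int"
  assumes "\<And>a. a \<in> X \<Longrightarrow> even (f a) \<longleftrightarrow> even (g a)"
  shows "even (sum f X) \<longleftrightarrow> even (sum g X)"
  using assms by (induction X rule: infinite_finite_induct) auto

lemma quarter:
  assumes "int d = 4 * x + 2" shows "int ((d - 2) div 4) = x"
  using assms by presburger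

lemma icup_iff: "icup D C = {a \<in> cups_of D C. left_interior C a = - 1}"
  unfolding icup_def cups_of_def left_interior_def by auto

lemma icap_iff: "icap D C = {a \<in> caps_of D C. left_interior C a = - 1}"
  unfolding icap_def caps_of_def left_interior_def by auto

lemma odd_to_the_right_Un:
  assumes "finite C" "finite C'" "C \<inter> C' = {}"
  shows "odd_to_the_right (C \<union> C') v \<longleftrightarrow> (odd_to_the_right C v \<noteq> odd_to_the_right C' v)"
proof -
  have fin: "finite {y. snd v < y \<and> (fst v, y) \<in> X}" if "finite X" for X :: circle
    by (rule finite_subset[of _ "snd ` X"]) (use that in force)+
  have "{y. snd v < y \<and> (fst v, y) \<in> C \<union> C'} = {y. snd v < y \<and> (fst v, y) \<in> C} \<union> {y. snd v < y \<and> (fst v, y) \<in> C'}"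
    by auto
  then have "card {y. snd v < y \<and> (fst v, y) \<in> C \<union> C'} = card {y. snd v < y \<and> (fst v, y) \<in> C} + card {y. snd v < y \<and> (fst v, y) \<in> C'}"
    using fin[OF assms(1)] fin[OF assms(2)] assms(3) by (simp only:) (rule card_Un_disjoint, auto)
  then show ?thesis unfolding odd_to_the_right_def by simp
qed

lemma rightmost_Un:
  assumes "finite C" "finite C'" "C \<noteq> {}" "C' \<noteq> {}" "mono p"
  shows "rightmost p (C \<union> C') = max (rightmost p C) (rightmost p C')"
proof -
  have "Max (snd ` (C \<union> C')) = max (Max (snd ` C)) (Max (snd ` C'))"
    using assms by (simp add: image_Un Max_Un)
  then show ?thesis unfolding rightmost_def by (simp only: max_of_mono[OF assms(5)])
qed

context planar
begin

lemma circles_away: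
  assumes "C \<in> circles D" "C' \<in> circles D"
  shows "circles D - {C, C'} = orb out inn ` (W - (C \<union> C'))"
proof (intro equalityI subsetI)
  fix X assume X: "X \<in> circles D - {C, C'}"
  then obtain v where v: "v \<in> X" using circleD(2)[of X] by blast
  then have "v \<in> W" "X = orb out inn v" using circleD(1,6)[of X] X by auto
  moreover have "v \<notin> C \<union> C'" using v circle_disjoint[of X] assms X by blast
  ultimately show "X \<in> orb out inn ` (W - (C \<union> C'))" by blast
next
  fix X assume "X \<in> orb out inn ` (W - (C \<union> C'))"
  then obtain v where v: "v \<in> W" "v \<notin> C" "v \<notin> C'" "X = orb out inn v" by blast
  then have "X \<in> circles D" "v \<in> X" unfolding circles_eq using orb_refl by auto
  then show "X \<in> circles D - {C, C'}" using v by blast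
qed

lemma saddle:
  assumes "a \<in> cups_of D C \<union> caps_of D C"
  shows "2 * int (saddle_width p (snd a)) = int (arc_dist p (snd a)) + 1"
proof -
  obtain l i j where a: "a = (l, i, j)" by (cases a) auto
  have "(l, i, j) \<in> cups D \<union> caps D" using assms unfolding a cups_of_def caps_of_def by auto
  from arc_partner(4,5)[OF this] have "odd (p j - p i)" by simp
  then show ?thesis unfolding a saddle_width_def by simp presburger
qed

text \<open>Twice the exponent is \<open>- d - 1\<close> for a cup and \<open>d - 1\<close> for a
  cap. The difference of the interior and the exterior sum weights these by \<chi>: the distances
  cancel by \<open>displacement_balance\<close>, and the constants add up to minus the turning sum
  2.\<close>

lemma interior_omega:
  assumes C: "C \<in> circles D"
  shows "interior_sum D C (cup_omega p) (cap_omega p) = omega_exp p D C - 1"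
proof -
  have fin: "finite (cups_of D C)" "finite (caps_of D C)"
    using finite_cups by (auto intro: finite_subset[rotated] simp: cups_of_def caps_of_def)
  have li: "left_interior C a = 1 \<or> left_interior C a = - 1" for a unfolding left_interior_def by auto
  have sd: "(\<Sum>a\<in>X - {a\<in>X. left_interior C a = - 1}. f a) - (\<Sum>a\<in>{a\<in>X. left_interior C a = - 1}. f a) = (\<Sum>a\<in>X. left_interior C a * f a)"
    if "finite X" for X and f :: "level \<times> arc \<Rightarrow> int"
  proof -
    let ?N = "{a\<in>X. left_interior C a = - 1}"
    have "(\<Sum>a\<in>X. left_interior C a * f a) = (\<Sum>a\<in>X - ?N. left_interior C a * f a) + (\<Sum>a\<in>?N. left_interior C a * f a)"
      using that by (subst sum.subset_diff[of "?N"]) auto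
    moreover have "(\<Sum>a\<in>X - ?N. left_interior C a * f a) = (\<Sum>a\<in>X - ?N. f a)"
      using li by (intro sum.cong) auto
    moreover have "(\<Sum>a\<in>?N. left_interior C a * f a) = (\<Sum>a\<in>?N. - f a)"
      by (intro sum.cong) auto
    ultimately show ?thesis by (simp add: sum_negf)
  qed
  have "2 * (interior_sum D C (cup_omega p) (cap_omega p) - omega_exp p D C) =
      (\<Sum>a\<in>cups_of D C. left_interior C a * (2 * cup_omega p (snd a))) + (\<Sum>a\<in>caps_of D C. left_interior C a * (2 * cap_omega p (snd a)))"
    unfolding interior_sum_def exterior_sum_def icup_iff icap_iff
    using sd[OF fin(1), of "\<lambda>a. cup_omega p (snd a)"] sd[OF fin(2), of "\<lambda>a. cap_omega p (snd a)"]
    by (simp add: sum_distrib_left[symmetric] mult.left_commute[of _ 2])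
  also have "(\<Sum>a\<in>cups_of D C. left_interior C a * (2 * cup_omega p (snd a))) =
      - (\<Sum>a\<in>cups_of D C. left_interior C a * int (arc_dist p (snd a))) - (\<Sum>a\<in>cups_of D C. left_interior C a)"
    unfolding sum_negf[symmetric] sum_subtractf[symmetric] cup_omega_def
    using saddle[of _ C] by (intro sum.cong) (auto simp: algebra_simps)
  also have "(\<Sum>a\<in>caps_of D C. left_interior C a * (2 * cap_omega p (snd a))) =
      (\<Sum>a\<in>caps_of D C. left_interior C a * int (arc_dist p (snd a))) - (\<Sum>a\<in>caps_of D C. left_interior C a)"
    unfolding sum_subtractf[symmetric] cap_omega_def
    using saddle[of _ C] by (intro sum.cong) (auto simp: algebra_simps)
  finally have "2 * (interior_sum D C (cup_omega p) (cap_omega p) - omega_exp p D C) =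
      - (sum (left_interior C) (cups_of D C) + sum (left_interior C) (caps_of D C))"
    using displacement_balance[OF C] by simp
  then show ?thesis unfolding turning[OF C] by simp
qed

lemma left_interior_parity:
  assumes C: "C \<in> circles D" and a: "a \<in> cups_of D C \<union> caps_of D C"
  shows "left_interior C a = 1 \<longleftrightarrow> odd (p (fst (snd a)) + rightmost p C)" (is ?g1) "left_interior C a = 1 \<or> left_interior C a = - 1" (is ?g2)
proof -
  obtain l i j where aa: "a = (l, i, j)" by (cases a) auto
  have "(l, i) \<in> C" using arc_in_circle(1)[OF C] a unfolding aa by blast
  from parity_rightmost[OF C this]
  show ?g1 ?g2
    unfolding left_interior_def aa by auto
qed

text \<open>Modulo 2, the left end of an arc of \<open>C\<close> can be replaced by the side of the arc on which the
  interior lies, see \<open>left_interior_parity\<close>; this turns the sum of the quadratic exponents into a linear one.\<close>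

lemma interior_eps:
  assumes C: "C \<in> circles D"
  shows "even (interior_sum D C (cup_eps p) (cap_eps p) + eps_exp p D C) \<longleftrightarrow>
    even ((circle_dist p D C - 2) div 4 + rightmost p C)"
proof -
  have fin: "finite (cups_of D C)" "finite (caps_of D C)"
    using finite_cups by (auto intro: finite_subset[rotated] simp: cups_of_def caps_of_def)
  let ?t = "rightmost p C"
  let ?\<chi> = "left_interior C" and ?d = "\<lambda>a. int (arc_dist p (snd a))" and ?s = "\<lambda>a. int (saddle_width p (snd a))"
  \<comment> \<open>By \<open>left_interior_parity\<close>, \<sigma>\<chi> = 1 iff the left end has
    odd position. So modulo 2 the exponent of a cup is \<open>s + 1\<close> in this case and 0
    otherwise, that of a cap is 0 in this case and \<open>s\<close> otherwise; these are
    \<open>x1\<close> and \<open>x2\<close>.\<close>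
  define \<sigma> :: int where "\<sigma> = (if even ?t then 1 else - 1)"
  define x1 where "x1 = (\<lambda>a. if \<sigma> * ?\<chi> a = 1 then ?s a + 1 else 0)"
  define x2 where "x2 = (\<lambda>a. if \<sigma> * ?\<chi> a = 1 then 0 else ?s a)"
  note lp = left_interior_parity[OF C]
  have s: "\<sigma> = 1 \<or> \<sigma> = - 1" unfolding \<sigma>_def by auto
  have total: "interior_sum D C (cup_eps p) (cap_eps p) + eps_exp p D C =
      (\<Sum>a\<in>cups_of D C. cup_eps p (snd a)) + (\<Sum>a\<in>caps_of D C. cap_eps p (snd a))"
    unfolding interior_sum_def exterior_sum_def
    by (subst (3) sum.subset_diff[of "icup D C"], (use fin in \<open>auto simp: icup_iff\<close>)[2],
        subst (3) sum.subset_diff[of "icap D C"]) (use fin in \<open>auto simp: icap_iff\<close>)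
  have par: "even (int (cup_eps p (snd a))) \<longleftrightarrow> even (x1 a)" "even (int (cap_eps p (snd a))) \<longleftrightarrow> even (x2 a)"
    if "a \<in> cups_of D C \<union> caps_of D C" for a
    using lp[OF that] unfolding cup_eps_def cap_eps_def x1_def x2_def \<sigma>_def by auto
  have x1: "4 * x1 a = (1 + \<sigma> * ?\<chi> a) * (?d a + 3)" and x2: "4 * x2 a = (1 - \<sigma> * ?\<chi> a) * (?d a + 1)"
    if "a \<in> cups_of D C \<union> caps_of D C" for a
    using lp(2)[OF that] s saddle[OF that] unfolding x1_def x2_def by auto
  let ?n = "int (card (cups_of D C))" and ?a1 = "\<Sum>a\<in>cups_of D C. ?\<chi> a" and ?a2 = "\<Sum>a\<in>caps_of D C. ?\<chi> a"
  let ?X = "(\<Sum>a\<in>cups_of D C. x1 a) + (\<Sum>a\<in>caps_of D C. x2 a)"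
  have "4 * (\<Sum>a\<in>cups_of D C. x1 a) = (\<Sum>a\<in>cups_of D C. (1 + \<sigma> * ?\<chi> a) * (?d a + 3))"
    unfolding sum_distrib_left using x1 by (intro sum.cong) auto
  also have "\<dots> = (\<Sum>a\<in>cups_of D C. ?d a + 3 + \<sigma> * (?\<chi> a * ?d a) + 3 * \<sigma> * ?\<chi> a)"
    by (intro sum.cong) (auto simp: algebra_simps)
  also have "\<dots> = (\<Sum>a\<in>cups_of D C. ?d a) + 3 * ?n + \<sigma> * (\<Sum>a\<in>cups_of D C. ?\<chi> a * ?d a) + 3 * \<sigma> * ?a1"
    by (simp add: sum.distrib sum_distrib_left)
  finally have e1: "4 * (\<Sum>a\<in>cups_of D C. x1 a) = \<dots>" .
  have "4 * (\<Sum>a\<in>caps_of D C. x2 a) = (\<Sum>a\<in>caps_of D C. (1 - \<sigma> * ?\<chi> a) * (?d a + 1))"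
    unfolding sum_distrib_left using x2 by (intro sum.cong) auto
  also have "\<dots> = (\<Sum>a\<in>caps_of D C. ?d a + 1 - \<sigma> * (?\<chi> a * ?d a) - \<sigma> * ?\<chi> a)"
    by (intro sum.cong) (auto simp: algebra_simps)
  also have "\<dots> = (\<Sum>a\<in>caps_of D C. ?d a) + ?n - \<sigma> * (\<Sum>a\<in>caps_of D C. ?\<chi> a * ?d a) - \<sigma> * ?a2"
    using count_balance[OF C] by (simp add: sum.distrib sum_subtractf sum_distrib_left)
  finally have e2: "4 * (\<Sum>a\<in>caps_of D C. x2 a) = \<dots>" .
  have dist: "int (circle_dist p D C) = (\<Sum>a\<in>cups_of D C. ?d a) + (\<Sum>a\<in>caps_of D C. ?d a)"
    unfolding circle_dist_def cups_of_def caps_of_def by (simp add: case_prod_beta)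
  \<comment> \<open>The sign sums enter as \<open>3 * ?a1 - ?a2\<close>, which
    \<open>turning\<close> converts to \<open>4 * ?a1 - 2\<close>. In particular the distance of a
    circle is 2 modulo 4, so the division by 4 below is exact.\<close>
  have X: "4 * ?X = int (circle_dist p D C) + 4 * ?n + \<sigma> * (4 * ?a1 - 2)"
    using e1 e2 dist displacement_balance[OF C] turning[OF C] s by auto
  have "even ?a1 \<longleftrightarrow> even (\<Sum>a\<in>cups_of D C. 1 :: int)"
    using lp(2) by (intro even_sum_cong) (metis UnI1 odd_one even_minus)
  then have a1: "even ?a1 \<longleftrightarrow> even ?n" by simp
  define k where "k = (circle_dist p D C - 2) div 4"
  have k: "even ?X \<longleftrightarrow> even (k + ?t)"
  proof (cases "even ?t")
    case True
    then have "int (circle_dist p D C) = 4 * (?X - ?n - ?a1) + 2" using X unfolding \<sigma>_def by simp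
    from quarter[OF this] have "int k = ?X - ?n - ?a1" unfolding k_def .
    then have "even k \<longleftrightarrow> even (?X - ?n - ?a1)" by (metis even_of_nat)
    then show ?thesis using a1 True by simp blast
  next
    case False
    then have "int (circle_dist p D C) = 4 * (?X - ?n + ?a1 - 1) + 2" using X unfolding \<sigma>_def by simp
    from quarter[OF this] have "int k = ?X - ?n + ?a1 - 1" unfolding k_def .
    then have "even k \<longleftrightarrow> even (?X - ?n + ?a1 - 1)" by (metis even_of_nat)
    then show ?thesis using a1 False by simp blast
  qed
  have "even (int (interior_sum D C (cup_eps p) (cap_eps p) + eps_exp p D C)) \<longleftrightarrow> even ?X"
    unfolding total of_nat_add of_nat_sum
    using even_sum_cong[of "cups_of D C" "\<lambda>a. int (cup_eps p (snd a))" x1]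
      even_sum_cong[of "caps_of D C" "\<lambda>a. int (cap_eps p (snd a))" x2] par by simp
  then show ?thesis using k unfolding k_def by simp
qed

text \<open>The ray parity of the union is the sum of both ray parities, and that of the other
  circle is constant along \<open>C\<close>, namely odd iff \<open>C\<close> is nested in it. So
  exactly the arcs of a nested circle change sides.\<close>

lemma exterior_sum_Un:
  assumes C: "C \<in> circles D" "C' \<in> circles D" "C \<noteq> C'"
  shows "exterior_sum D (C \<union> C') f g =
    (if nested_in C C' then interior_sum D C f g else exterior_sum D C f g) +
    (if nested_in C' C then interior_sum D C' f g else exterior_sum D C' f g)"
proof -
  note c = circleD[OF C(1)] and c' = circleD[OF C(2)]
  note dj = circle_disjoint[OF C]
  note od = odd_to_the_right_Un[OF c(3) c'(3) dj]
  have fin: "finite (cups_of D X)" "finite (caps_of D X)" for X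
    using finite_cups by (auto intro: finite_subset[rotated] simp: cups_of_def caps_of_def)
  have n: "odd_to_the_right C' v \<longleftrightarrow> nested_in C C'" if "v \<in> C" for v using nested_iff[OF C that] by simp
  have n': "odd_to_the_right C v \<longleftrightarrow> nested_in C' C" if "v \<in> C'" for v using nested_iff[OF C(2,1) C(3)[symmetric] that] by simp
  have "icup D (C \<union> C') = (if nested_in C C' then cups_of D C - icup D C else icup D C) \<union>
      (if nested_in C' C then cups_of D C' - icup D C' else icup D C')"
    using n n' unfolding icup_def cups_of_def by (auto simp: od split: if_splits)
  moreover have "(if nested_in C C' then cups_of D C - icup D C else icup D C) \<inter>
      (if nested_in C' C then cups_of D C' - icup D C' else icup D C') = {}"
    using dj unfolding icup_iff cups_of_def by auto
  ultimately have 1: "(\<Sum>a\<in>icup D (C \<union> C'). f (snd a)) = (\<Sum>a\<in>(if nested_in C C' then cups_of D C - icup D C else icup D C). f (snd a)) +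
      (\<Sum>a\<in>(if nested_in C' C then cups_of D C' - icup D C' else icup D C'). f (snd a))"
    using fin by (simp only:) (rule sum.union_disjoint, auto simp: icup_iff)
  have "icap D (C \<union> C') = (if nested_in C C' then caps_of D C - icap D C else icap D C) \<union>
      (if nested_in C' C then caps_of D C' - icap D C' else icap D C')"
    using n n' unfolding icap_def caps_of_def by (auto simp: od split: if_splits)
  moreover have "(if nested_in C C' then caps_of D C - icap D C else icap D C) \<inter>
      (if nested_in C' C then caps_of D C' - icap D C' else icap D C') = {}"
    using dj unfolding icap_iff caps_of_def by auto
  ultimately have 2: "(\<Sum>a\<in>icap D (C \<union> C'). g (snd a)) = (\<Sum>a\<in>(if nested_in C C' then caps_of D C - icap D C else icap D C). g (snd a)) +
      (\<Sum>a\<in>(if nested_in C' C then caps_of D C' - icap D C' else icap D C'). g (snd a))"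
    using fin by (simp only:) (rule sum.union_disjoint, auto simp: icap_iff)
  show ?thesis unfolding exterior_sum_def[of D "C \<union> C'"] 1 2
    by (simp add: exterior_sum_def interior_sum_def ac_simps)
qed

end

section \<open>The effect of a surgery on the exponents\<close>

text \<open>\<open>outer\<close> says that no remaining pair encloses \<gamma>, so that the cap and
  the cup can be connected without crossing other arcs.\<close>

locale surgered = planar +
  fixes i j :: int
  assumes ij: "(i, j) \<in> M" and outer: "\<And>k l. (k, l) \<in> M \<Longrightarrow> \<not> (k < i \<and> i < l)"
begin

lemma M_unique:
  assumes "(k, l) \<in> M" "k = i \<or> k = j \<or> l = i \<or> l = j" shows "(k, l) = (i, j)"
proof -
  have "partner M k = l" "partner M l = k" "partner M i = j" "partner M j = i"
    using ij assms(1) by (simp_all add: partner_eq[OF mM])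
  then have "k = i \<Longrightarrow> l = j" "k = j \<Longrightarrow> l = i" "l = i \<Longrightarrow> k = j" "l = j \<Longrightarrow> k = i"
    by metis+
  then show ?thesis using assms(2) matchingD(1)[OF mM ij] matchingD(1)[OF mM assms(1)] by (metis order_less_asym)
qed

lemma ij_in: "i < j" "i \<in> S" "j \<in> S" "i \<notin> V" "j \<notin> V"
  using matchingD[OF mM ij] by auto

lemma planar_cut: "planar A (M - {(i, j)}) B (V \<union> {i, j}) S p"
proof unfold_locales
  show "matching (S - (V \<union> {i, j})) (M - {(i, j)})"
    unfolding matching_def
  proof (intro conjI)
    have "k < l \<and> k \<in> S - (V \<union> {i, j}) \<and> l \<in> S - (V \<union> {i, j})" if "(k, l) \<in> M - {(i, j)}" for k l
    proof -
      have kl: "(k, l) \<in> M" "(k, l) \<noteq> (i, j)" using that by auto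
      then have "\<not> (k = i \<or> k = j \<or> l = i \<or> l = j)" using M_unique[OF kl(1)] by blast
      then show ?thesis using matchingD[OF mM kl(1)] by blast
    qed
    then show "\<forall>(k, l)\<in>M - {(i, j)}. k < l \<and> k \<in> S - (V \<union> {i, j}) \<and> l \<in> S - (V \<union> {i, j})" by blast
    show "\<forall>v\<in>S - (V \<union> {i, j}). \<exists>!w. (v, w) \<in> M - {(i, j)} \<or> (w, v) \<in> M - {(i, j)}"
    proof
      fix v assume v: "v \<in> S - (V \<union> {i, j})"
      then have "((v, w) \<in> M - {(i, j)} \<or> (w, v) \<in> M - {(i, j)}) \<longleftrightarrow> ((v, w) \<in> M \<or> (w, v) \<in> M)" for w by auto
      moreover have "\<exists>!w. (v, w) \<in> M \<or> (w, v) \<in> M" using mM v unfolding matching_def by blast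
      ultimately show "\<exists>!w. (v, w) \<in> M - {(i, j)} \<or> (w, v) \<in> M - {(i, j)}" by simp
    qed
    show "\<forall>k l m n. (k, l) \<in> M - {(i, j)} \<longrightarrow> (m, n) \<in> M - {(i, j)} \<longrightarrow> k < m \<longrightarrow> m < l \<longrightarrow> n < l"
      using matching_nested[OF mM] by blast
  qed
  show "\<not> (k < v \<and> v < l)" if kl: "(k, l) \<in> M - {(i, j)}" and v: "v \<in> V \<union> {i, j}" for k l v
  proof
    assume kvl: "k < v \<and> v < l"
    consider "v \<in> V" | "v = i" | "v = j" using v by blast
    then show False
    proof cases
      case 1 then show False using MV[of k l v] kl kvl by auto
    next
      case 2 then show False using outer[of k l] kl kvl by auto
    next
      case 3
      have "k \<noteq> i" using M_unique[of k l] kl by blast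
      then consider "k < i" | "i < k" by linarith
      then show False
      proof cases
        case 1 then show False using outer[of k l] kl kvl 3 ij_in(1) by auto
      next
        case 2 then show False using matching_nested[OF mM ij _ 2] kl kvl 3 by force
      qed
    qed
  qed
qed (use finS mA mB VS ij_in p_mono p_odd in auto)

sublocale cut: planar A "M - {(i, j)}" B "V \<union> {i, j}" S p
  by (rule planar_cut)

abbreviation "D' \<equiv> mid_diagram A (M - {(i, j)}) B (V \<union> {i, j})"
abbreviation "inn' \<equiv> inward (M - {(i, j)}) (V \<union> {i, j})"

lemma cut_eq: "cut D (i, j) = D'"
  unfolding cut_def mid_diagram_def by auto

lemma partners: "partner M i = j" "partner M j = i"
  using partner_eq[OF mM] ij by auto

lemma sw: "switching W out inn inn' (Lower, i) (Lower, j) (Upper, i) (Upper, j) colour"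
proof
  show "inn x = inn' x" if x: "x \<in> W - {(Lower, i), (Lower, j), (Upper, i), (Upper, j)}" for x
  proof -
    obtain l k where k: "x = (l, k)" "k \<in> S" "k \<noteq> i" "k \<noteq> j" using x by (cases x; cases "fst x") auto
    show ?thesis
    proof (cases "k \<in> V")
      case False
      then have "k \<in> S - (V \<union> {i, j})" using k by auto
      from partner_arc[OF cut.mM this] have "partner (M - {(i, j)}) k = partner M k"
        by (intro partner_eq[OF mM, symmetric]) blast
      then show ?thesis using False k by (simp add: inward.simps)
    qed (use k in \<open>simp add: inward.simps\<close>)
  qed
qed (use finW invs cut.invs ij_in colour_flip cut.colour_flip partners in \<open>simp_all add: inward.simps\<close>)

abbreviation "C1 \<equiv> circle_of D (Lower, i)"
abbreviation "C2 \<equiv> circle_of D (Upper, i)"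
abbreviation "Ci \<equiv> circle_of D' (Lower, i)"
abbreviation "Cj \<equiv> circle_of D' (Lower, j)"

lemma in_W: "(l, i) \<in> W" "(l, j) \<in> W"
  using ij_in by auto

lemma circle_orbs: "C1 = orb out inn (Lower, i)" "C2 = orb out inn (Upper, i)"
  "Ci = orb out inn' (Lower, i)" "Cj = orb out inn' (Lower, j)"
  using circle_of_eq cut.circle_of_eq in_W by auto

lemma are_circles: "C1 \<in> circles D" "C2 \<in> circles D" "Ci \<in> circles D'" "Cj \<in> circles D'"
  using circle_of_in cut.circle_of_in in_W by auto

lemma members: "(Lower, i) \<in> C1" "(Lower, j) \<in> C1" "(Upper, i) \<in> C2" "(Upper, j) \<in> C2"
  "(Lower, i) \<in> Ci" "(Upper, i) \<in> Ci" "(Lower, j) \<in> Cj" "(Upper, j) \<in> Cj"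
proof -
  show m: "(Lower, i) \<in> C1" "(Upper, i) \<in> C2" "(Lower, i) \<in> Ci" "(Lower, j) \<in> Cj"
    using circle_of_in(2) cut.circle_of_in(2) in_W by auto
  show "(Lower, j) \<in> C1" "(Upper, j) \<in> C2" "(Upper, i) \<in> Ci" "(Upper, j) \<in> Cj"
    using circleD(5)[OF are_circles(1) m(1)] circleD(5)[OF are_circles(2) m(2)]
      cut.circleD(5)[OF are_circles(3) m(3)] cut.circleD(5)[OF are_circles(4) m(4)] partners ij_in
    by (simp_all add: inward.simps)
qed

lemma union_circles: "Ci \<union> Cj = C1 \<union> C2"
  unfolding circle_orbs by (rule switching.union_eq[OF sw])

text \<open>This justifies that \<open>surgery\<close> decides by \<open>C1 \<noteq> C2\<close>
  alone: then \<open>Ci\<close> is the one new circle, and otherwise \<open>Ci\<close> and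
  \<open>Cj\<close> are two different ones.\<close>

lemma merge_or_split: "C1 \<noteq> C2 \<longleftrightarrow> Ci = Cj"
  unfolding circle_orbs using switching.not_both_distinct[OF sw] switching.not_both_equal[OF sw] by blast

lemma rest_circles: "circles D - {C1, C2} = circles D' - {Ci, Cj}"
proof -
  have away: "orb out inn' v = orb out inn v" if "v \<in> W" "v \<notin> C1 \<union> C2" for v
    using switching.orb_away[OF sw] that unfolding circle_orbs by blast
  show ?thesis
    unfolding circles_away[OF are_circles(1,2)] cut.circles_away[OF are_circles(3,4)] union_circles
    using away by (intro image_cong) auto
qed

text \<open>Closure under \<open>inn\<close> away from the four ends is common to the circles before
  and after the cut. In zigzag order the ends are \<open>(Lower, i)\<close>,
  \<open>(Lower, j)\<close>, \<open>(Upper, j)\<close>, \<open>(Upper, i)\<close>, and neighbours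
  are joined by the cap, the new vertical line at \<open>j\<close> and the cup.\<close>

lemma sides:
  assumes X: "X \<subseteq> W" "\<And>x. x \<in> X \<Longrightarrow> out x \<in> X"
    "\<And>x. x \<in> X \<Longrightarrow> x \<notin> {(Lower, i), (Lower, j), (Upper, i), (Upper, j)} \<Longrightarrow> inn x \<in> X"
  shows "odd_to_the_right X (Lower, j) \<longleftrightarrow> odd_to_the_right X (Upper, j)" (is ?g1)
    "odd_to_the_right X (Lower, i) \<longleftrightarrow> (odd_to_the_right X (Lower, j) \<noteq> ((Lower, j) \<in> X))" (is ?g2)
    "odd_to_the_right X (Upper, i) \<longleftrightarrow> (odd_to_the_right X (Upper, j) \<noteq> ((Upper, j) \<in> X))" (is ?g3)
proof -
  have fX: "finite X" using X(1) finW finite_subset by blast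
  have zz: "z (Lower, i) < z (Lower, j)" "z (Lower, j) < z (Upper, j)" "z (Upper, j) < z (Upper, i)"
    using ij_in z_lower_upper by auto
  have i1: "inn (Lower, i) = (Lower, j)" "inn' (Lower, j) = (Upper, j)" "inn (Upper, j) = (Upper, i)"
    using ij_in partners by (auto simp: inward.simps)
  have "odd_right z X (Lower, i) \<longleftrightarrow> (odd_right z X (Lower, j) \<noteq> ((Lower, j) \<in> X))"
  proof -
    have "inn x \<in> X" if x: "x \<in> X" "z (Lower, i) < z x" "z x < z (Lower, j)" for x
      by (rule X(3)[OF x(1)]) (use x zz in auto)
    then show ?thesis
      using odd_right_between[OF fX inj_z X(1) noncrossing_inn in_W(1)[of Lower]] zz unfolding i1 by blast
  qed
  moreover have "odd_right z X (Lower, j) \<longleftrightarrow> (odd_right z X (Upper, j) \<noteq> ((Upper, j) \<in> X))"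
  proof -
    have "inn' x \<in> X" if x: "x \<in> X" "z (Lower, j) < z x" "z x < z (Upper, j)" for x
    proof -
      have "x \<notin> {(Lower, i), (Lower, j), (Upper, i), (Upper, j)}" using x zz by auto
      moreover from this have "inn x = inn' x" using switching.gh[OF sw, of x] x(1) X(1) by blast
      ultimately show ?thesis using X(3)[OF x(1)] by simp
    qed
    then show ?thesis
      using odd_right_between[OF fX inj_z X(1) cut.noncrossing_inn in_W(2)[of Lower]] zz unfolding i1 by blast
  qed
  moreover have "odd_right z X (Upper, j) \<longleftrightarrow> (odd_right z X (Upper, i) \<noteq> ((Upper, i) \<in> X))"
  proof -
    have "inn x \<in> X" if x: "x \<in> X" "z (Upper, j) < z x" "z x < z (Upper, i)" for x
      by (rule X(3)[OF x(1)]) (use x zz in auto)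
    then show ?thesis
      using odd_right_between[OF fX inj_z X(1) noncrossing_inn in_W(2)[of Upper]] zz unfolding i1 by blast
  qed
  moreover note odd_right_iff[OF X(1,2) ij_in(2)] odd_right_iff[OF X(1,2) ij_in(3)]
  ultimately show ?g1 ?g2 ?g3
    by auto
qed

text \<open>Ray parities depend on the vertex set alone, so the two diagrams differ only by the
  copies of \<gamma>: the cup on the upper and the cap on the lower level.\<close>

lemma exterior_sum_cut:
  "exterior_sum D C f g = exterior_sum D' C f g +
     ((if (Upper, i) \<in> C \<and> \<not> odd_to_the_right C (Upper, i) then f (i, j) else 0) +
      (if (Lower, i) \<in> C \<and> \<not> odd_to_the_right C (Lower, i) then g (i, j) else 0))"
proof -
  have fin: "finite (icup D' C)" "finite (icap D' C)"
    using cut.finite_cups by (auto intro: finite_subset[rotated] simp: icup_def icap_def)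
  have "icup D C = (if (Upper, i) \<in> C \<and> \<not> odd_to_the_right C (Upper, i) then {(Upper, (i, j))} else {}) \<union> icup D' C"
    "(Upper, (i, j)) \<notin> icup D' C"
    using ij unfolding icup_def mid_diagram_def by auto
  then have "(\<Sum>a\<in>icup D C. f (snd a)) = (if (Upper, i) \<in> C \<and> \<not> odd_to_the_right C (Upper, i) then f (i, j) else 0) + (\<Sum>a\<in>icup D' C. f (snd a))"
    using fin by auto
  moreover have "icap D C = (if (Lower, i) \<in> C \<and> \<not> odd_to_the_right C (Lower, i) then {(Lower, (i, j))} else {}) \<union> icap D' C"
    "(Lower, (i, j)) \<notin> icap D' C"
    using ij unfolding icap_def mid_diagram_def by auto
  then have "(\<Sum>a\<in>icap D C. g (snd a)) = (if (Lower, i) \<in> C \<and> \<not> odd_to_the_right C (Lower, i) then g (i, j) else 0) + (\<Sum>a\<in>icap D' C. g (snd a))"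
    using fin by auto
  ultimately show ?thesis unfolding exterior_sum_def by (simp add: ac_simps)
qed

lemma exterior_sum_rest:
  assumes "C \<in> circles D - {C1, C2}"
  shows "exterior_sum D C f g = exterior_sum D' C f g"
proof -
  have "C \<inter> C1 = {}" "C \<inter> C2 = {}" using circle_disjoint assms are_circles by auto
  then have "(Lower, i) \<notin> C" "(Upper, i) \<notin> C" using members by auto
  then show ?thesis unfolding exterior_sum_cut[of C] by simp
qed

abbreviation "s \<equiv> saddle_width p (i, j)"

text \<open>The asymmetry between cups and caps in the coefficients has this effect:
  \<open>(s + 1) p + s (p + 1)\<close> is \<open>p + s\<close> up to an even number, and
  \<open>- s + (s - 1)\<close> no longer depends on \<gamma>.\<close>

lemma gamma_exponents:
  "even (cup_eps p (i, j) + cap_eps p (i, j)) \<longleftrightarrow> even (p i + s)"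
  "cup_omega p (i, j) + cap_omega p (i, j) = - 1"
  by (auto simp: cup_eps_def cap_eps_def cup_omega_def cap_omega_def)

section \<open>Merging two circles\<close>

context
  assumes merge: "C1 \<noteq> C2"
begin

lemma merge_union: "Ci = C1 \<union> C2"
  using merge_or_split merge union_circles by auto

text \<open>In a non-nested merge the interiors lie between the line and the copies of \<gamma>, so
  that these contribute nothing. In a nested merge both copies are exterior arcs of the union, and
  the cut removes them.\<close>

lemma merge_exterior_sum:
  "exterior_sum D' Ci f g + (if nested_in C1 C2 \<or> nested_in C2 C1 then f (i, j) + g (i, j) else 0) =
    (if nested_in C1 C2 then interior_sum D C1 f g else exterior_sum D C1 f g) +
    (if nested_in C2 C1 then interior_sum D C2 f g else exterior_sum D C2 f g)"
proof -
  note c1 = circleD[OF are_circles(1)] and c2 = circleD[OF are_circles(2)]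
  have nm: "(Lower, i) \<notin> C2" "(Lower, j) \<notin> C2" "(Upper, i) \<notin> C1" "(Upper, j) \<notin> C1"
    using circle_disjoint[OF are_circles(1,2) merge] members by auto
  note s1 = sides[OF c1(1,4,5)] and s2 = sides[OF c2(1,4,5)]
  have n: "nested_in C1 C2 \<longleftrightarrow> odd_to_the_right C2 (Lower, i)" "nested_in C2 C1 \<longleftrightarrow> odd_to_the_right C1 (Upper, i)"
    using nested_iff are_circles merge members by auto
  have nb: "\<not> (nested_in C1 C2 \<and> nested_in C2 C1)" using not_nested_both are_circles by auto
  note od = odd_to_the_right_Un[OF c1(3) c2(3) circle_disjoint[OF are_circles(1,2) merge]]
  have o: "odd_to_the_right Ci (Upper, i) \<longleftrightarrow> \<not> (nested_in C1 C2 \<or> nested_in C2 C1)"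
    "odd_to_the_right Ci (Lower, i) \<longleftrightarrow> \<not> (nested_in C1 C2 \<or> nested_in C2 C1)"
    using n s1 s2 nm members nb unfolding merge_union od by auto
  have "exterior_sum D Ci f g = (if nested_in C1 C2 then interior_sum D C1 f g else exterior_sum D C1 f g) +
    (if nested_in C2 C1 then interior_sum D C2 f g else exterior_sum D C2 f g)"
    unfolding merge_union by (rule exterior_sum_Un[OF are_circles(1,2) merge])
  then show ?thesis unfolding exterior_sum_cut[of Ci] using o members by auto
qed

lemma merge_omega: "omega_exp p D' Ci = omega_exp p D C1 + omega_exp p D C2"
  using merge_exterior_sum[of "cup_omega p" "cap_omega p"] gamma_exponents(2)
    interior_omega[OF are_circles(1)] interior_omega[OF are_circles(2)] not_nested_both[OF are_circles(1,2)]
  by (auto split: if_splits)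

lemma merge_eps:
  "\<not> nested_in C1 C2 \<Longrightarrow> \<not> nested_in C2 C1 \<Longrightarrow> eps_exp p D' Ci = eps_exp p D C1 + eps_exp p D C2"
  "nested_in C1 C2 \<Longrightarrow> even (eps_exp p D' Ci + eps_exp p D C1 + eps_exp p D C2) \<longleftrightarrow>
     even (1 + (circle_dist p D C1 - 2) div 4 + s)"
  "nested_in C2 C1 \<Longrightarrow> even (eps_exp p D' Ci + eps_exp p D C1 + eps_exp p D C2) \<longleftrightarrow>
     even (1 + (circle_dist p D C2 - 2) div 4 + s)"
proof -
  note m = merge_exterior_sum[of "cup_eps p" "cap_eps p"]
  note nb = not_nested_both[OF are_circles(1,2)]
  note c1 = circleD[OF are_circles(1)] and c2 = circleD[OF are_circles(2)]
  note s1 = sides[OF c1(1,4,5)] and s2 = sides[OF c2(1,4,5)]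
  have n: "nested_in C1 C2 \<longleftrightarrow> odd_to_the_right C2 (Lower, i)" "nested_in C2 C1 \<longleftrightarrow> odd_to_the_right C1 (Upper, i)"
    using nested_iff are_circles merge members by auto
  have nm: "(Lower, i) \<notin> C2" "(Lower, j) \<notin> C2" "(Upper, i) \<notin> C1" "(Upper, j) \<notin> C1"
    using circle_disjoint[OF are_circles(1,2) merge] members by auto
  show "\<not> nested_in C1 C2 \<Longrightarrow> \<not> nested_in C2 C1 \<Longrightarrow> eps_exp p D' Ci = eps_exp p D C1 + eps_exp p D C2"
    using m by simp
  have gen: "even (eps_exp p D' Ci + eps_exp p D X + eps_exp p D Y) \<longleftrightarrow> even (1 + (circle_dist p D X - 2) div 4 + s)"
    if X: "X \<in> circles D" "(l, i) \<in> X" "odd_to_the_right X (l, i)"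
      and sum: "eps_exp p D' Ci + (cup_eps p (i, j) + cap_eps p (i, j)) = interior_sum D X (cup_eps p) (cap_eps p) + eps_exp p D Y" for X Y l
  proof -
    \<comment> \<open>\<gamma> is an arc of the inner circle with the interior between it and the
      line, so its left end and the rightmost position differ in parity. This is the origin of the
      isolated \<epsilon> in the nested merge.\<close>
    have t: "odd (p i + rightmost p X)" using parity_rightmost[OF X(1,2)] X(3) by simp
    have "even (eps_exp p D' Ci + (cup_eps p (i, j) + cap_eps p (i, j))) \<longleftrightarrow> even (interior_sum D X (cup_eps p) (cap_eps p) + eps_exp p D Y)"
      using sum by simp
    then show ?thesis using interior_eps[OF X(1)] gamma_exponents(1) t unfolding even_add by simp blast
  qed
  show "even (eps_exp p D' Ci + eps_exp p D C1 + eps_exp p D C2) \<longleftrightarrow>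
     even (1 + (circle_dist p D C1 - 2) div 4 + s)" if a: "nested_in C1 C2"
    by (rule gen[OF are_circles(1) members(1)]) (use m nb a n s1 members nm in auto)
  show "even (eps_exp p D' Ci + eps_exp p D C1 + eps_exp p D C2) \<longleftrightarrow>
     even (1 + (circle_dist p D C2 - 2) div 4 + s)" if a: "nested_in C2 C1"
  proof -
    have "even (eps_exp p D' Ci + eps_exp p D C2 + eps_exp p D C1) \<longleftrightarrow> even (1 + (circle_dist p D C2 - 2) div 4 + s)"
      by (rule gen[OF are_circles(2) members(3)]) (use m nb a n s2 members nm in auto)
    then show ?thesis by (simp only: ac_simps)
  qed
qed

lemma merge_rightmost: "rightmost p Ci = max (rightmost p C1) (rightmost p C2)"
  unfolding merge_union using circleD[OF are_circles(1)] circleD[OF are_circles(2)] p_mono by (intro rightmost_Un) auto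

lemma merge_circles: "circles D' = insert Ci (circles D - {C1, C2})" (is ?g1) "Ci \<notin> circles D"
proof -
  show ?g1
    using rest_circles merge_or_split merge are_circles by auto
  show "Ci \<notin> circles D"
  proof
    assume "Ci \<in> circles D"
    then have "Ci = C1" "Ci = C2" using circle_disjoint[of Ci] are_circles members merge_union by blast+
    then show False using merge by simp
  qed
qed

end

section \<open>Splitting a circle\<close>

context
  assumes split: "C1 = C2"
begin

lemma split_union: "C1 = Ci \<union> Cj" and split_distinct: "Ci \<noteq> Cj"
  using merge_or_split split union_circles by auto

lemma split_sides:
  "odd_to_the_right Ci (Lower, i) \<longleftrightarrow> nested_in Cj Ci" (is ?g1) "odd_to_the_right Ci (Upper, i) \<longleftrightarrow> nested_in Cj Ci" (is ?g2)
  "odd_to_the_right Cj (Lower, i) \<longleftrightarrow> nested_in Ci Cj" (is ?g3) "odd_to_the_right Cj (Upper, i) \<longleftrightarrow> nested_in Ci Cj" (is ?g4)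
  "odd_to_the_right Cj (Lower, j) \<longleftrightarrow> \<not> nested_in Ci Cj" (is ?g5)
proof -
  note ci = cut.circleD[OF are_circles(3)] and cj = cut.circleD[OF are_circles(4)]
  have nm: "(Lower, i) \<notin> Cj" "(Lower, j) \<notin> Ci" "(Upper, i) \<notin> Cj" "(Upper, j) \<notin> Ci"
    using cut.circle_disjoint[OF are_circles(3,4) split_distinct] members by auto
  have inn: "inn x \<in> X" if "X \<in> circles D'" "x \<in> X" "x \<notin> {(Lower, i), (Lower, j), (Upper, i), (Upper, j)}" for X x
  proof -
    have "x \<in> W" using cut.circleD(1)[OF that(1)] that(2) by blast
    then have "inn x = inn' x" using switching.gh[OF sw, of x] that(3) by blast
    then show ?thesis using cut.circleD(5)[OF that(1,2)] by simp
  qed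
  note s1 = sides[OF ci(1,4) inn[OF are_circles(3)]] and s2 = sides[OF cj(1,4) inn[OF are_circles(4)]]
  have n: "nested_in Ci Cj \<longleftrightarrow> odd_to_the_right Cj (Lower, i)" "nested_in Cj Ci \<longleftrightarrow> odd_to_the_right Ci (Lower, j)"
    using cut.nested_iff are_circles split_distinct members by auto
  show ?g1 ?g2 ?g3 ?g4 ?g5
    using n s1 s2 nm members by auto
qed

text \<open>The union of the two new circles is \<open>C1\<close>. In contrast to a merge, the
  copies of \<gamma> are exterior arcs of it exactly when the new circles are not nested.\<close>

lemma split_exterior_sum:
  "exterior_sum D C1 f g =
    (if nested_in Ci Cj then interior_sum D' Ci f g else exterior_sum D' Ci f g) +
    (if nested_in Cj Ci then interior_sum D' Cj f g else exterior_sum D' Cj f g) +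
    (if nested_in Ci Cj \<or> nested_in Cj Ci then 0 else f (i, j) + g (i, j))"
proof -
  note ci = cut.circleD[OF are_circles(3)] and cj = cut.circleD[OF are_circles(4)]
  note od = odd_to_the_right_Un[OF ci(3) cj(3) cut.circle_disjoint[OF are_circles(3,4) split_distinct]]
  have nb: "\<not> (nested_in Ci Cj \<and> nested_in Cj Ci)" using cut.not_nested_both are_circles by auto
  have "odd_to_the_right C1 (Upper, i) \<longleftrightarrow> nested_in Ci Cj \<or> nested_in Cj Ci"
    "odd_to_the_right C1 (Lower, i) \<longleftrightarrow> nested_in Ci Cj \<or> nested_in Cj Ci"
    using split_sides nb unfolding split_union od by auto
  moreover have "exterior_sum D' C1 f g = (if nested_in Ci Cj then interior_sum D' Ci f g else exterior_sum D' Ci f g) +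
    (if nested_in Cj Ci then interior_sum D' Cj f g else exterior_sum D' Cj f g)"
    unfolding split_union by (rule cut.exterior_sum_Un[OF are_circles(3,4) split_distinct])
  moreover have "(Lower, i) \<in> C1" "(Upper, i) \<in> C1" using members split by auto
  ultimately show ?thesis unfolding exterior_sum_cut[of C1] by auto
qed

text \<open>Removing the copies of \<gamma> and reversing an inner circle both change the exponent
  by one, and exactly one of them occurs. Hence every split needs the same factor \<omega>.\<close>

lemma split_omega: "omega_exp p D' Ci + omega_exp p D' Cj = omega_exp p D C1 + 1"
  using split_exterior_sum[of "cup_omega p" "cap_omega p"] gamma_exponents(2)
    cut.interior_omega[OF are_circles(3)] cut.interior_omega[OF are_circles(4)] cut.not_nested_both[OF are_circles(3,4)]
  by (auto split: if_splits)

lemma split_eps: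
  "\<not> nested_in Ci Cj \<Longrightarrow> \<not> nested_in Cj Ci \<Longrightarrow>
    even (eps_exp p D' Ci + eps_exp p D' Cj + eps_exp p D C1) \<longleftrightarrow> even (p i + s)"
  "nested_in Ci Cj \<Longrightarrow> even (eps_exp p D' Ci + eps_exp p D' Cj + eps_exp p D C1) \<longleftrightarrow>
    even ((circle_dist p D' Ci - 2) div 4 + rightmost p Ci)"
  "nested_in Cj Ci \<Longrightarrow> even (eps_exp p D' Ci + eps_exp p D' Cj + eps_exp p D C1) \<longleftrightarrow>
    even ((circle_dist p D' Cj - 2) div 4 + rightmost p Cj)"
proof -
  note m = split_exterior_sum[of "cup_eps p" "cap_eps p"]
  note nb = cut.not_nested_both[OF are_circles(3,4)]
  show "even (eps_exp p D' Ci + eps_exp p D' Cj + eps_exp p D C1) \<longleftrightarrow> even (p i + s)"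
    if "\<not> nested_in Ci Cj" "\<not> nested_in Cj Ci"
    using m that gamma_exponents(1) by simp blast
  show "even (eps_exp p D' Ci + eps_exp p D' Cj + eps_exp p D C1) \<longleftrightarrow>
    even ((circle_dist p D' Ci - 2) div 4 + rightmost p Ci)" if "nested_in Ci Cj"
    using m that nb cut.interior_eps[OF are_circles(3)] by simp blast
  show "even (eps_exp p D' Ci + eps_exp p D' Cj + eps_exp p D C1) \<longleftrightarrow>
    even ((circle_dist p D' Cj - 2) div 4 + rightmost p Cj)" if "nested_in Cj Ci"
    using m that nb cut.interior_eps[OF are_circles(4)] by simp blast
qed

lemma split_rightmost:
  "rightmost p C1 = max (rightmost p Ci) (rightmost p Cj)" (is ?g1)
  "nested_in Ci Cj \<Longrightarrow> rightmost p C1 = rightmost p Cj"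
  "nested_in Cj Ci \<Longrightarrow> rightmost p C1 = rightmost p Ci"
  "nested_in Ci Cj \<or> nested_in Cj Ci \<Longrightarrow> odd (rightmost p Ci + rightmost p Cj)"
  "p i \<le> rightmost p Ci" "p j \<le> rightmost p Cj" "odd (p i + p j)"
proof -
  note ci = cut.circleD[OF are_circles(3)] and cj = cut.circleD[OF are_circles(4)]
  show m: ?g1
    unfolding split_union using ci cj p_mono by (intro rightmost_Un) auto
  have r: "rightmost p C \<le> rightmost p C'" if "C \<in> circles D'" "C' \<in> circles D'" "nested_in C C'" for C C'
    using cut.nested_Max[OF that] monoD[OF p_mono] unfolding rightmost_def by simp
  show "nested_in Ci Cj \<Longrightarrow> rightmost p C1 = rightmost p Cj" using r[OF are_circles(3,4)] m by simp
  show "nested_in Cj Ci \<Longrightarrow> rightmost p C1 = rightmost p Ci" using r[OF are_circles(4,3)] m by simp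
  show o: "odd (p i + p j)" using p_odd ij by auto
  \<comment> \<open>For nested circles the ray parity of \<open>Ci\<close> at \<open>i\<close>
    equals that of \<open>Cj\<close> at \<open>j\<close>, whereas \<open>p i\<close> and
    \<open>p j\<close> differ in parity; hence so do the rightmost positions. This yields the
    \<epsilon> in the second summand of a nested split.\<close>
  show "odd (rightmost p Ci + rightmost p Cj)" if "nested_in Ci Cj \<or> nested_in Cj Ci"
    using that split_sides cut.parity_rightmost[OF are_circles(3) members(5)]
      cut.parity_rightmost[OF are_circles(4) members(7)] o cut.not_nested_both[OF are_circles(3,4)] by auto
  have "p k \<le> rightmost p C" if "finite C" "(l, k) \<in> C" for l k C
    unfolding rightmost_def using that by (intro monoD[OF p_mono] Max_ge) force+
  then show "p i \<le> rightmost p Ci" "p j \<le> rightmost p Cj" using ci(3) cj(3) members by blast+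
qed

lemma split_circles: "circles D' = insert Ci (insert Cj (circles D - {C1}))" (is ?g1) "Ci \<notin> circles D" "Cj \<notin> circles D"
proof -
  show ?g1
    using rest_circles split are_circles by auto
  have "C = C1" if "C \<in> circles D" "C \<subseteq> C1" for C
    using circle_disjoint[OF that(1) are_circles(1)] circleD(2)[OF that(1)] that(2) by blast
  then show "Ci \<notin> circles D" "Cj \<notin> circles D"
    using split_union members cut.circle_disjoint[OF are_circles(3,4) split_distinct] by blast+
qed

end

end

section \<open>Surgeries intertwine the coefficients\<close>

abbreviation "keys \<equiv> Poly_Mapping.keys"
abbreviation "lookup \<equiv> Poly_Mapping.lookup"
abbreviation "single \<equiv> Poly_Mapping.single"

section \<open>Linear extension of maps between free modules\<close>

lemma lookup_smult: "lookup (smult q x) k = q * lookup x k"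
  unfolding smult_def by (simp add: Poly_Mapping.map.rep_eq when_def)

lemma smult_single: "smult q (single k r) = single k (q * r)"
  by (rule poly_mapping_eqI) (simp add: lookup_smult lookup_single when_def)

lemma smult_simps:
  "smult q (x + y) = smult q x + smult q y" "smult (q + r) x = smult q x + smult r x"
  "smult q (smult r x) = smult (q * r) x" "smult 1 x = x" "smult 0 x = 0" "smult q 0 = 0"
  by (rule poly_mapping_eqI; simp add: lookup_smult lookup_add algebra_simps)+

lemma smult_sum: "smult q (sum f A) = (\<Sum>a\<in>A. smult q (f a))"
  by (induction A rule: infinite_finite_induct) (auto simp: smult_simps)

lemma lookup_sum: "lookup (sum f A) k = (\<Sum>a\<in>A. lookup (f a) k)"
  by (induction A rule: infinite_finite_induct) (auto simp: lookup_add)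

lemma keys_smult: "keys (smult q x) \<subseteq> keys x"
  by (auto simp: in_keys_iff lookup_smult)

lemma lin_ext_superset:
  assumes "finite A" "keys x \<subseteq> A"
  shows "lin_ext f x = (\<Sum>b\<in>A. smult (lookup x b) (f b))"
  unfolding lin_ext_def
  by (rule sum.mono_neutral_left) (use assms in \<open>auto simp: in_keys_iff smult_simps\<close>)

lemma lin_ext_add: "lin_ext f (x + y) = lin_ext f x + lin_ext f y"
proof -
  let ?A = "keys x \<union> keys y"
  have "finite ?A" "keys (x + y) \<subseteq> ?A" using Poly_Mapping.keys_add[of x y] by auto
  then show ?thesis
    by (simp add: lin_ext_superset[of ?A] lookup_add smult_simps sum.distrib)
qed

lemma lin_ext_zero: "lin_ext f 0 = 0" by (simp add: lin_ext_def)

lemma lin_ext_smult: "lin_ext f (smult q x) = smult q (lin_ext f x)"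
  by (simp add: lin_ext_superset[OF _ keys_smult] lin_ext_def[of f x] lookup_smult smult_simps smult_sum)

lemma lin_ext_single: "lin_ext f (single k q) = smult q (f k)"
  by (simp add: lin_ext_superset[of "{k}"] smult_simps)

lemma lin_ext_sum: "lin_ext f (sum g A) = (\<Sum>a\<in>A. lin_ext f (g a))"
  by (induction A rule: infinite_finite_induct) (auto simp: lin_ext_zero lin_ext_add)

lemma lin_ext_cong:
  assumes "\<And>b. b \<in> keys x \<Longrightarrow> f b = g b"
  shows "lin_ext f x = lin_ext g x"
  unfolding lin_ext_def by (intro sum.cong) (use assms in auto)

lemma keys_lin_ext:
  assumes "\<And>b. b \<in> keys x \<Longrightarrow> keys (f b) \<subseteq> A"
  shows "keys (lin_ext f x) \<subseteq> A"
proof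
  fix k assume "k \<in> keys (lin_ext f x)"
  then have "(\<Sum>b\<in>keys x. lookup x b * lookup (f b) k) \<noteq> 0"
    by (simp add: in_keys_iff lin_ext_def lookup_sum lookup_smult)
  then obtain b where "b \<in> keys x" "lookup (f b) k \<noteq> 0"
    by (metis (no_types, lifting) mult_zero_right sum.neutral)
  then show "k \<in> A" using assms[of b] by (meson in_keys_iff subsetD)
qed

lemma lookup_diag: "lookup (lin_ext (\<lambda>k. single k (c k)) x) k = lookup x k * c k"
  by (simp add: lin_ext_def lookup_sum lookup_smult lookup_single when_def sum.delta in_keys_iff
      if_distrib[of "\<lambda>y. _ * y"] cong: if_cong)

section \<open>Monomials in \<epsilon> and \<omega> as units of the ground ring\<close>

lemma Q_eps_power_cong:
  assumes "even m \<longleftrightarrow> even n"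
  shows "Q_eps ^ m = Q_eps ^ n"
proof -
  have "Q_eps ^ k = (if even k then 1 else Q_eps)" for k
    by (induction k) (auto simp: Q_eps_squared)
  then show ?thesis using assms by simp
qed

text \<open>All coefficients have this form, so by \<open>Q_unit_cong\<close> an identity between
  them becomes a parity condition and an equation of integers.\<close>

definition Q_unit :: "nat \<Rightarrow> int \<Rightarrow> Q" where
  "Q_unit e k = Q_eps ^ e * Q_omega_pow k"

lemma Q_unit_mult: "Q_unit e k * Q_unit f l = Q_unit (e + f) (k + l)"
  unfolding Q_unit_def power_add Q_omega_pow_add by (simp only: ac_simps)

lemma Q_unit_cong: "even e \<longleftrightarrow> even f \<Longrightarrow> k = l \<Longrightarrow> Q_unit e k = Q_unit f l"
  unfolding Q_unit_def using Q_eps_power_cong[of e f] by simp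

lemma Q_unit_eps: "Q_eps ^ e = Q_unit e 0" "Q_eps = Q_unit 1 0" "Q_omega = Q_unit 0 1"
  by (simp_all add: Q_unit_def Q_omega_pow_0 Q_omega_def)

lemma prod_Q_unit: "(\<Prod>a\<in>A. Q_unit (f a) (g a)) = Q_unit (sum f A) (sum g A)"
  by (induction A rule: infinite_finite_induct) (auto simp: Q_unit_mult, auto simp: Q_unit_def Q_omega_pow_0)

lemma circle_coeff_eq:
  "circle_coeff p D K C = Q_unit (eps_exp p D C + (if C \<in> K then rightmost p C else 0)) (omega_exp p D C)"
proof -
  have "circle_coeff p D K C = (\<Prod>a\<in>icup D C. Q_unit (cup_eps p (snd a)) (cup_omega p (snd a))) *
      (\<Prod>a\<in>icap D C. Q_unit (cap_eps p (snd a)) (cap_omega p (snd a))) * Q_unit (if C \<in> K then rightmost p C else 0) 0"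
    unfolding circle_coeff_def cup_eps_def cup_omega_def cap_eps_def cap_omega_def Q_unit_def
    by (simp add: case_prod_beta Q_omega_pow_0)
  then show ?thesis by (simp add: prod_Q_unit Q_unit_mult exterior_sum_def add.assoc)
qed

definition diagram_coeff :: "(int \<Rightarrow> nat) \<Rightarrow> diagram \<Rightarrow> circle set \<Rightarrow> Q" where
  "diagram_coeff p D K = (\<Prod>C\<in>circles D. circle_coeff p D K C)"

abbreviation rescale :: "(int \<Rightarrow> nat) \<Rightarrow> diagram \<Rightarrow> (circle set \<Rightarrow>\<^sub>0 Q) \<Rightarrow> (circle set \<Rightarrow>\<^sub>0 Q)" where
  "rescale p D \<equiv> lin_ext (\<lambda>K. single K (diagram_coeff p D K))"

lemma rescale_single: "rescale p D (single K q) = single K (q * diagram_coeff p D K)"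
  by (simp add: lin_ext_single smult_single)

lemma keys_single_subset: "keys (single k q) \<subseteq> {k}"
  by auto

lemma keys_two_singles:
  "keys (single k q + single l r) \<subseteq> {k, l}"
  using Poly_Mapping.keys_add[of "single k q" "single l r"]
    keys_single_subset[of k q] keys_single_subset[of l r] by blast

text \<open>The coefficient identities hold only if the clockwise circles are circles of the current
  diagram, so that no new circle is marked beforehand. The bounds on the supports preserve this from
  one surgery to the next.\<close>

lemma keys_merge:
  "keys (merge \<alpha> \<epsilon> p D \<gamma> C1 C2 C K) \<subseteq> {K - {C1, C2}, insert C (K - {C1, C2})}"
  unfolding merge_def Let_def by (simp only: split: if_split) (simp add: subset_insertI2)

lemma keys_split:
  "keys (nonnested_split \<alpha> \<epsilon> \<omega> p \<gamma> C Ci Cj K) \<subseteq>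
    {K - {C}, insert Ci (K - {C}), insert Cj (K - {C}), insert Ci (insert Cj (K - {C}))}"
  "keys (nested_split \<alpha> \<epsilon> \<omega> p D C Ci Cj K) \<subseteq>
    {K - {C}, insert Ci (K - {C}), insert Cj (K - {C}), insert Ci (insert Cj (K - {C}))}"
  unfolding nonnested_split_def nested_split_def Let_def
  by (simp only: split: if_split, intro conjI impI; rule order_trans[OF keys_two_singles], simp)+

context surgered
begin

definition rest_coeff :: "circle set \<Rightarrow> Q" where
  "rest_coeff K = (\<Prod>C\<in>circles D - {C1, C2}. circle_coeff p D K C)"

lemma rest_coeff':
  assumes "\<And>C. C \<in> circles D - {C1, C2} \<Longrightarrow> C \<in> K' \<longleftrightarrow> C \<in> K"
  shows "(\<Prod>C\<in>circles D - {C1, C2}. circle_coeff p D' K' C) = rest_coeff K"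
  unfolding rest_coeff_def circle_coeff_eq
proof (rule prod.cong[OF refl])
  fix C assume C: "C \<in> circles D - {C1, C2}"
  show "Q_unit (eps_exp p D' C + (if C \<in> K' then rightmost p C else 0)) (omega_exp p D' C) =
      Q_unit (eps_exp p D C + (if C \<in> K then rightmost p C else 0)) (omega_exp p D C)"
    by (simp only: exterior_sum_rest[OF C] assms[OF C])
qed

text \<open>The factor \<epsilon>^t(C) of clockwise circles turns into the differences t(C) - t(C_k)
  of the merge rule. What remains is \<epsilon>^n, where \<open>n\<close> is the exponent of the
  nested factor by \<open>merge_eps\<close>.\<close>

lemma merge_coeff:
  assumes K: "K \<subseteq> circles D" and m: "C1 \<noteq> C2"
  shows "rescale p D' (merge \<alpha> 1 p D (i, j) C1 C2 Ci K) =
    smult (diagram_coeff p D K) (merge \<alpha> Q_eps p D (i, j) C1 C2 Ci K)"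
proof -
  define n where "n = (if nested_in C1 C2 then 1 + (circle_dist p D C1 - 2) div 4 + s
    else if nested_in C2 C1 then 1 + (circle_dist p D C2 - 2) div 4 + s else 0)"
  define \<kappa> where "\<kappa> = (if nested_in C1 C2 then Q_eps * Q_eps ^ ((circle_dist p D C1 - 2) div 4) * Q_eps ^ s
    else if nested_in C2 C1 then Q_eps * Q_eps ^ ((circle_dist p D C2 - 2) div 4) * Q_eps ^ s else 1)"
  have \<kappa>: "\<kappa> = Q_unit n 0"
    unfolding \<kappa>_def n_def Q_unit_def by (simp add: Q_omega_pow_0 power_add)
  have one: "(if nested_in C1 C2 then 1 * 1 ^ ((circle_dist p D C1 - 2) div 4) * 1 ^ s
    else if nested_in C2 C1 then 1 * 1 ^ ((circle_dist p D C2 - 2) div 4) * 1 ^ s else (1 :: Q)) = 1" by simp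
  have e: "even (eps_exp p D' Ci + eps_exp p D C1 + eps_exp p D C2) \<longleftrightarrow> even n"
    using merge_eps[OF m] unfolding n_def by (simp split: if_splits) blast
  have DK: "diagram_coeff p D K = circle_coeff p D K C1 * circle_coeff p D K C2 * rest_coeff K"
  proof -
    have "circles D = insert C1 (insert C2 (circles D - {C1, C2}))" using are_circles by auto
    then have "diagram_coeff p D K = (\<Prod>C\<in>insert C1 (insert C2 (circles D - {C1, C2})). circle_coeff p D K C)"
      unfolding diagram_coeff_def by simp
    then show ?thesis using finite_circles m by (simp add: rest_coeff_def mult.assoc)
  qed
  have DK': "diagram_coeff p D' K' = circle_coeff p D' K' Ci * rest_coeff K"
    if "\<And>C. C \<in> circles D - {C1, C2} \<Longrightarrow> C \<in> K' \<longleftrightarrow> C \<in> K" for K'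
    unfolding diagram_coeff_def merge_circles(1)[OF m]
    using finite_circles merge_circles(2)[OF m] rest_coeff'[OF that] by simp
  have nK: "Ci \<notin> K" using K merge_circles(2)[OF m] by blast
  have t: "rightmost p C1 \<le> rightmost p Ci" "rightmost p C2 \<le> rightmost p Ci"
    using merge_rightmost[OF m] by auto
  let ?e = "\<lambda>D C. eps_exp p D C" and ?t = "rightmost p"
  have D0: "diagram_coeff p D' (K - {C1, C2}) = Q_unit (?e D' Ci) (omega_exp p D' Ci) * rest_coeff K"
    using nK by (subst DK') (auto simp: circle_coeff_eq)
  have D1: "diagram_coeff p D' (insert Ci (K - {C1, C2})) = Q_unit (?e D' Ci + ?t Ci) (omega_exp p D' Ci) * rest_coeff K"
    using merge_circles(2)[OF m] by (subst DK') (auto simp: circle_coeff_eq)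
  note w = merge_omega[OF m]
  consider "C1 \<notin> K" "C2 \<notin> K" | "C1 \<in> K" "C2 \<notin> K" | "C1 \<notin> K" "C2 \<in> K" | "C1 \<in> K" "C2 \<in> K" by blast
  then show ?thesis
  proof cases
    case 1
    have "Q_unit (?e D' Ci) (omega_exp p D' Ci) = Q_unit (?e D C1) (omega_exp p D C1) * Q_unit (?e D C2) (omega_exp p D C2) * \<kappa>"
      unfolding \<kappa> Q_unit_mult by (rule Q_unit_cong) (use e w in auto)
    then show ?thesis
      unfolding merge_def Let_def one \<kappa>_def[symmetric]
      using 1 D0 by (simp add: rescale_single smult_single DK circle_coeff_eq ac_simps)
  next
    case 2
    have "Q_unit (?e D' Ci + ?t Ci) (omega_exp p D' Ci) =
        Q_unit (?e D C1 + ?t C1) (omega_exp p D C1) * Q_unit (?e D C2) (omega_exp p D C2) * (\<kappa> * Q_eps ^ (?t Ci - ?t C1))"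
      unfolding \<kappa> Q_unit_eps(1) Q_unit_mult by (rule Q_unit_cong) (use e w t in auto)
    then show ?thesis
      unfolding merge_def Let_def one \<kappa>_def[symmetric]
      using 2 D1 by (simp add: rescale_single smult_single DK circle_coeff_eq ac_simps)
  next
    case 3
    have "Q_unit (?e D' Ci + ?t Ci) (omega_exp p D' Ci) =
        Q_unit (?e D C1) (omega_exp p D C1) * Q_unit (?e D C2 + ?t C2) (omega_exp p D C2) * (\<kappa> * Q_eps ^ (?t Ci - ?t C2))"
      unfolding \<kappa> Q_unit_eps(1) Q_unit_mult by (rule Q_unit_cong) (use e w t in auto)
    then show ?thesis
      unfolding merge_def Let_def one \<kappa>_def[symmetric]
      using 3 D1 by (simp add: rescale_single smult_single DK circle_coeff_eq ac_simps)
  next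
    case 4
    have "Q_unit (?e D' Ci) (omega_exp p D' Ci) =
        Q_unit (?e D C1 + ?t C1) (omega_exp p D C1) * Q_unit (?e D C2 + ?t C2) (omega_exp p D C2) *
          (\<kappa> * Q_eps ^ (?t Ci - ?t C1) * Q_eps ^ (?t Ci - ?t C2))"
      unfolding \<kappa> Q_unit_eps(1) Q_unit_mult by (rule Q_unit_cong) (use e w t in auto)
    then have "\<alpha> * Q_unit (?e D' Ci) (omega_exp p D' Ci) * rest_coeff K =
        \<alpha> * (Q_unit (?e D C1 + ?t C1) (omega_exp p D C1) * Q_unit (?e D C2 + ?t C2) (omega_exp p D C2) *
          (\<kappa> * Q_eps ^ (?t Ci - ?t C1) * Q_eps ^ (?t Ci - ?t C2))) * rest_coeff K"
      by simp
    then show ?thesis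
      unfolding merge_def Let_def one \<kappa>_def[symmetric]
      using 4 D0 by (simp add: rescale_single smult_single DK circle_coeff_eq ac_simps)
  qed
qed

lemma split_coeffs:
  assumes K: "K \<subseteq> circles D" and m: "C1 = C2"
  shows "diagram_coeff p D K = circle_coeff p D K C1 * rest_coeff K" (is ?g1)
    "diagram_coeff p D' (K - {C1}) = Q_unit (eps_exp p D' Ci + eps_exp p D' Cj) (omega_exp p D C1 + 1) * rest_coeff K" (is ?g2)
    "diagram_coeff p D' (insert Ci (K - {C1})) =
      Q_unit (eps_exp p D' Ci + eps_exp p D' Cj + rightmost p Ci) (omega_exp p D C1 + 1) * rest_coeff K" (is ?g3)
    "diagram_coeff p D' (insert Cj (K - {C1})) =
      Q_unit (eps_exp p D' Ci + eps_exp p D' Cj + rightmost p Cj) (omega_exp p D C1 + 1) * rest_coeff K" (is ?g4)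
    "diagram_coeff p D' (insert Ci (insert Cj (K - {C1}))) =
      Q_unit (eps_exp p D' Ci + eps_exp p D' Cj + rightmost p Ci + rightmost p Cj) (omega_exp p D C1 + 1) * rest_coeff K" (is ?g5)
proof -
  show ?g1
    unfolding diagram_coeff_def rest_coeff_def
    by (subst prod.remove[OF finite_circles are_circles(1)]) (simp add: m)
  have DK': "diagram_coeff p D' K' = circle_coeff p D' K' Ci * circle_coeff p D' K' Cj * rest_coeff K"
    if "\<And>C. C \<in> circles D - {C1, C2} \<Longrightarrow> C \<in> K' \<longleftrightarrow> C \<in> K" for K'
    unfolding diagram_coeff_def split_circles(1)[OF m]
    using finite_circles split_circles(2,3)[OF m] split_distinct[OF m] rest_coeff'[OF that] m by (simp add: mult.assoc)
  have nK: "Ci \<notin> K" "Cj \<notin> K" using K split_circles(2,3)[OF m] by auto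
  have gen: "diagram_coeff p D' K' = Q_unit (eps_exp p D' Ci + eps_exp p D' Cj + (if Ci \<in> K' then rightmost p Ci else 0) +
      (if Cj \<in> K' then rightmost p Cj else 0)) (omega_exp p D C1 + 1) * rest_coeff K"
    if "\<And>C. C \<in> circles D - {C1, C2} \<Longrightarrow> C \<in> K' \<longleftrightarrow> C \<in> K" for K'
  proof -
    have "diagram_coeff p D' K' = circle_coeff p D' K' Ci * circle_coeff p D' K' Cj * rest_coeff K"
      by (rule DK') (rule that)
    then show ?thesis
      unfolding circle_coeff_eq Q_unit_mult split_omega[OF m, symmetric] by (simp only: ac_simps)
  qed
  have ne: "Cj \<noteq> Ci" "Ci \<noteq> Cj" using split_distinct[OF m] by auto
  have r: "C \<in> K - {C1} \<longleftrightarrow> C \<in> K" "C \<in> insert Ci (K - {C1}) \<longleftrightarrow> C \<in> K" "C \<in> insert Cj (K - {C1}) \<longleftrightarrow> C \<in> K"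
    "C \<in> insert Ci (insert Cj (K - {C1})) \<longleftrightarrow> C \<in> K" if "C \<in> circles D - {C1, C2}" for C
    using that split_circles(2,3)[OF m] by blast+
  have i: "Ci \<notin> K - {C1}" "Cj \<notin> K - {C1}" using nK by auto
  show ?g2
    by (subst gen, erule r(1), simp only: i if_False add_0_right)
  show ?g3
    by (subst gen, erule r(2), simp only: insert_iff i ne simp_thms if_False if_True add_0_right)
  show ?g4
    by (subst gen, erule r(3), simp only: insert_iff i ne simp_thms if_False if_True add_0_right)
  show ?g5
    by (subst gen, erule r(4), simp only: insert_iff i ne simp_thms if_False if_True add_0_right)
qed

text \<open>The correction \<open>p i + s\<close> of \<open>split_eps\<close> combines with
  \<epsilon>^t(Ci) to the first coefficient of the rule. The second one refers to \<open>j\<close>,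
  and \<epsilon> compensates for the different parity of \<open>p j\<close>.\<close>

lemma nonnested_split_coeff:
  assumes K: "K \<subseteq> circles D" and m: "C1 = C2" and n: "\<not> nested_in Ci Cj" "\<not> nested_in Cj Ci"
  shows "rescale p D' (nonnested_split \<alpha> 1 1 p (i, j) C1 Ci Cj K) =
    smult (diagram_coeff p D K) (nonnested_split \<alpha> Q_eps Q_omega p (i, j) C1 Ci Cj K)"
proof -
  note cs = split_coeffs[OF K m] and e = split_eps(1)[OF m n] and r = split_rightmost[OF m]
  let ?e = "\<lambda>D C. eps_exp p D C" and ?t = "rightmost p"
  have t: "?t Ci \<le> ?t C1" "?t Cj \<le> ?t C1" using r(1) by auto
  show ?thesis
  proof (cases "C1 \<in> K")
    case False
    then have K0: "K - {C1} = K" by blast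
    have 1: "Q_unit (?e D' Ci + ?e D' Cj + ?t Ci) (omega_exp p D C1 + 1) =
        Q_unit (?e D C1) (omega_exp p D C1) * (Q_omega * Q_eps ^ (?t Ci - p i) * Q_eps ^ s)"
      unfolding Q_unit_eps(1,3) Q_unit_mult by (rule Q_unit_cong) (use e r in auto)
    have 2: "Q_unit (?e D' Ci + ?e D' Cj + ?t Cj) (omega_exp p D C1 + 1) =
        Q_unit (?e D C1) (omega_exp p D C1) * (Q_unit 1 0 * Q_omega * Q_eps ^ (?t Cj - p j) * Q_eps ^ s)"
      unfolding Q_unit_eps(1,3) Q_unit_mult by (rule Q_unit_cong) (use e r in auto)
    show ?thesis
      unfolding nonnested_split_def Let_def
      using False 1 2[folded Q_unit_eps(2)] cs by (simp add: lin_ext_add rescale_single smult_single smult_simps circle_coeff_eq K0 ac_simps)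
  next
    case True
    have 1: "Q_unit (?e D' Ci + ?e D' Cj + ?t Ci + ?t Cj) (omega_exp p D C1 + 1) =
        Q_unit (?e D C1 + ?t C1) (omega_exp p D C1) * (Q_omega * Q_eps ^ (?t C1 - ?t Cj) * Q_eps ^ (?t Ci - p i) * Q_eps ^ s)"
      unfolding Q_unit_eps(1,3) Q_unit_mult by (rule Q_unit_cong) (use e r t in auto)
    have "Q_unit (?e D' Ci + ?e D' Cj) (omega_exp p D C1 + 1) =
        Q_unit (?e D C1 + ?t C1) (omega_exp p D C1) * (Q_unit 1 0 * Q_omega * Q_eps ^ (?t C1 - ?t Cj) * Q_eps ^ (?t Cj - p j) * Q_eps ^ s)"
      unfolding Q_unit_eps(1,3) Q_unit_mult by (rule Q_unit_cong) (use e r t in auto)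
    then have 2: "\<alpha> * Q_unit (?e D' Ci + ?e D' Cj) (omega_exp p D C1 + 1) * rest_coeff K =
        \<alpha> * (Q_unit (?e D C1 + ?t C1) (omega_exp p D C1) * (Q_eps * Q_omega * Q_eps ^ (?t C1 - ?t Cj) * Q_eps ^ (?t Cj - p j) * Q_eps ^ s)) * rest_coeff K"
      unfolding Q_unit_eps(2)[symmetric] by simp
    show ?thesis
      unfolding nonnested_split_def Let_def
      using True 1 2 cs by (simp add: lin_ext_add rescale_single smult_single smult_simps circle_coeff_eq ac_simps)
  qed
qed

text \<open>The correction is \<open>k + t\<close> with \<open>t\<close> taken from the inner
  circle. It absorbs \<epsilon>^t(Cin) where that circle becomes clockwise; where only the outer one
  does, two rightmost positions of different parity leave \<epsilon>. The assumption
  \<open>inout\<close> covers both choices of the inner circle at once.\<close>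

lemma nested_split_coeff:
  assumes K: "K \<subseteq> circles D" and m: "C1 = C2" and n: "nested_in Cin Cout"
    and inout: "Cin = Ci \<and> Cout = Cj \<or> Cin = Cj \<and> Cout = Ci"
  shows "rescale p D' (nested_split \<alpha> 1 1 p D' C1 Cin Cout K) =
    smult (diagram_coeff p D K) (nested_split \<alpha> Q_eps Q_omega p D' C1 Cin Cout K)"
proof -
  note cs = split_coeffs[OF K m] and r = split_rightmost[OF m]
  let ?e = "\<lambda>D C. eps_exp p D C" and ?t = "rightmost p" and ?k = "(circle_dist p D' Cin - 2) div 4"
  have e: "even (?e D' Cin + ?e D' Cout + ?e D C1) \<longleftrightarrow> even (?k + ?t Cin)"
    using inout split_eps(2,3)[OF m] n by (auto simp: add.commute)
  have t: "?t C1 = ?t Cout" "odd (?t Cin + ?t Cout)"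
    using inout n r(2-4) by (auto simp: add.commute)
  have c: "diagram_coeff p D K = circle_coeff p D K C1 * rest_coeff K"
    "diagram_coeff p D' (K - {C1}) = Q_unit (?e D' Cin + ?e D' Cout) (omega_exp p D C1 + 1) * rest_coeff K"
    "diagram_coeff p D' (insert Cin (K - {C1})) =
      Q_unit (?e D' Cin + ?e D' Cout + ?t Cin) (omega_exp p D C1 + 1) * rest_coeff K"
    "diagram_coeff p D' (insert Cout (K - {C1})) =
      Q_unit (?e D' Cin + ?e D' Cout + ?t Cout) (omega_exp p D C1 + 1) * rest_coeff K"
    "diagram_coeff p D' (insert Cin (insert Cout (K - {C1}))) =
      Q_unit (?e D' Cin + ?e D' Cout + ?t Cin + ?t Cout) (omega_exp p D C1 + 1) * rest_coeff K"
    using inout cs by (auto simp: ac_simps insert_commute)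
  show ?thesis
  proof (cases "C1 \<in> K")
    case False
    then have K0: "K - {C1} = K" by blast
    have 1: "Q_unit (?e D' Cin + ?e D' Cout + ?t Cin) (omega_exp p D C1 + 1) =
        Q_unit (?e D C1) (omega_exp p D C1) * (Q_omega * Q_eps ^ ?k)"
      unfolding Q_unit_eps(1,3) Q_unit_mult by (rule Q_unit_cong) (use e t in auto)
    have 2: "Q_unit (?e D' Cin + ?e D' Cout + ?t Cout) (omega_exp p D C1 + 1) =
        Q_unit (?e D C1) (omega_exp p D C1) * (Q_unit 1 0 * Q_omega * Q_eps ^ ?k)"
      unfolding Q_unit_eps(1,3) Q_unit_mult by (rule Q_unit_cong) (use e t in auto)
    show ?thesis
      unfolding nested_split_def Let_def
      using False 1 2[folded Q_unit_eps(2)] c by (simp add: lin_ext_add rescale_single smult_single smult_simps circle_coeff_eq K0 ac_simps)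
  next
    case True
    have 1: "Q_unit (?e D' Cin + ?e D' Cout + ?t Cin + ?t Cout) (omega_exp p D C1 + 1) =
        Q_unit (?e D C1 + ?t C1) (omega_exp p D C1) * (Q_omega * Q_eps ^ ?k)"
      unfolding Q_unit_eps(1,3) Q_unit_mult by (rule Q_unit_cong) (use e t in auto)
    have "Q_unit (?e D' Cin + ?e D' Cout) (omega_exp p D C1 + 1) =
        Q_unit (?e D C1 + ?t C1) (omega_exp p D C1) * (Q_unit 1 0 * Q_omega * Q_eps ^ ?k)"
      unfolding Q_unit_eps(1,3) Q_unit_mult by (rule Q_unit_cong) (use e t in auto)
    then have 2: "\<alpha> * Q_unit (?e D' Cin + ?e D' Cout) (omega_exp p D C1 + 1) * rest_coeff K =
        \<alpha> * (Q_unit (?e D C1 + ?t C1) (omega_exp p D C1) * (Q_eps * Q_omega * Q_eps ^ ?k)) * rest_coeff K"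
      unfolding Q_unit_eps(2)[symmetric] by simp
    show ?thesis
      unfolding nested_split_def Let_def
      using True 1 2 c by (simp add: lin_ext_add rescale_single smult_single smult_simps circle_coeff_eq ac_simps)
  qed
qed

lemma surgery_coeff:
  assumes K: "K \<subseteq> circles D"
  shows "rescale p D' (surgery \<alpha> 1 1 p D (i, j) K) = smult (diagram_coeff p D K) (surgery \<alpha> Q_eps Q_omega p D (i, j) K)"
  unfolding surgery_def Let_def cut_eq fst_conv snd_conv
  using merge_coeff[OF K] nonnested_split_coeff[OF K] nested_split_coeff[OF K] by auto

lemma keys_surgery:
  assumes K: "K \<subseteq> circles D"
  shows "keys (surgery \<alpha> \<epsilon> \<omega> p D (i, j) K) \<subseteq> Pow (circles D')"
proof (cases "C1 = C2")
  case False
  then have "{K - {C1, C2}, insert Ci (K - {C1, C2})} \<subseteq> Pow (circles D')"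
    unfolding merge_circles(1)[OF False] using K by blast
  then show ?thesis
    using keys_merge[of \<alpha> \<epsilon> p D "(i, j)" C1 C2 Ci K] False
    unfolding surgery_def Let_def cut_eq fst_conv snd_conv by (simp only: if_True simp_thms)
next
  case True
  have sub: "{K - {C1}, insert Ci (K - {C1}), insert Cj (K - {C1}), insert Ci (insert Cj (K - {C1}))} \<subseteq> Pow (circles D')"
    "{K - {C1}, insert Cj (K - {C1}), insert Ci (K - {C1}), insert Cj (insert Ci (K - {C1}))} \<subseteq> Pow (circles D')"
    unfolding split_circles(1)[OF True] using K by blast+
  have "keys (surgery \<alpha> \<epsilon> \<omega> p D (i, j) K) = keys
      (if nested_in Ci Cj then nested_split \<alpha> \<epsilon> \<omega> p D' C1 Ci Cj K
       else if nested_in Cj Ci then nested_split \<alpha> \<epsilon> \<omega> p D' C1 Cj Ci K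
       else nonnested_split \<alpha> \<epsilon> \<omega> p (i, j) C1 Ci Cj K)"
    unfolding surgery_def Let_def cut_eq fst_conv snd_conv using True by (simp only: if_False simp_thms)
  then show ?thesis
    by (simp only: split: if_split)
      (intro conjI impI; (rule order_trans[OF keys_split(1) sub(1)] | rule order_trans[OF keys_split(2) sub(1)]
        | rule order_trans[OF keys_split(2) sub(2)]))
qed

end

lemma mid_cut:
  assumes "(i, j) \<in> M"
  shows "cut (mid_diagram A M B V) (i, j) = mid_diagram A (M - {(i, j)}) B (V \<union> {i, j})"
  unfolding cut_def mid_diagram_def by auto

lemma surgeries_coeff:
  assumes "planar A M B V S p" "set \<gamma>s = M" "sorted_wrt (\<lambda>\<gamma> \<delta>. fst \<gamma> < fst \<delta>) \<gamma>s"
    and "keys x \<subseteq> Pow (circles (mid_diagram A M B V))"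
  shows "rescale p (foldl cut (mid_diagram A M B V) \<gamma>s) (surgeries \<alpha> 1 1 p (mid_diagram A M B V) \<gamma>s x) =
    surgeries \<alpha> Q_eps Q_omega p (mid_diagram A M B V) \<gamma>s (rescale p (mid_diagram A M B V) x)"
  using assms
proof (induction \<gamma>s arbitrary: M V x)
  case (Cons \<gamma> \<gamma>s)
  obtain i j where g: "\<gamma> = (i, j)" by (cases \<gamma>)
  let ?D = "mid_diagram A M B V" and ?D' = "mid_diagram A (M - {(i, j)}) B (V \<union> {i, j})"
  have ij: "(i, j) \<in> M" using Cons.prems(2) g by auto
  \<comment> \<open>The order from left to right makes \<gamma> the remaining pair with the smallest
    left end, so no remaining pair encloses it.\<close>
  have least: "i < k" if "(k, l) \<in> set \<gamma>s" for k l using Cons.prems(3) that g by auto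
  interpret planar A M B V S p by (rule Cons.prems(1))
  interpret surgered A M B V S p i j
  proof
    fix k l assume "(k, l) \<in> M"
    then have "i \<le> k" using least[of k l] Cons.prems(2) g by auto
    then show "\<not> (k < i \<and> i < l)" by simp
  qed (rule ij)
  have set: "set \<gamma>s = M - {(i, j)}" using least[of i j] Cons.prems(2) g by auto
  let ?y = "lin_ext (surgery \<alpha> 1 1 p ?D (i, j)) x"
  have keys: "K \<subseteq> circles ?D" if "K \<in> keys x" for K using Cons.prems(4) that by auto
  have "keys ?y \<subseteq> Pow (circles ?D')"
    by (rule keys_lin_ext) (rule keys_surgery, rule keys)
  then have IH: "rescale p (foldl cut ?D' \<gamma>s) (surgeries \<alpha> 1 1 p ?D' \<gamma>s ?y) =
      surgeries \<alpha> Q_eps Q_omega p ?D' \<gamma>s (rescale p ?D' ?y)"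
    using Cons.prems(3) by (intro Cons.IH planar_cut set) auto
  have "rescale p ?D' ?y = (\<Sum>K\<in>keys x. smult (lookup x K) (rescale p ?D' (surgery \<alpha> 1 1 p ?D (i, j) K)))"
    by (simp only: lin_ext_def[of "surgery \<alpha> 1 1 p ?D (i, j)"] lin_ext_sum lin_ext_smult)
  also have "\<dots> = (\<Sum>K\<in>keys x. smult (lookup x K) (smult (diagram_coeff p ?D K) (surgery \<alpha> Q_eps Q_omega p ?D (i, j) K)))"
    by (intro sum.cong refl) (simp only: surgery_coeff[OF keys])
  also have "\<dots> = lin_ext (surgery \<alpha> Q_eps Q_omega p ?D (i, j)) (rescale p ?D x)"
    by (simp only: lin_ext_def[of _ x] lin_ext_sum lin_ext_smult lin_ext_single)
  finally show ?case using IH by (simp only: g surgeries.simps foldl.simps cut_eq)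
qed simp

lemma foldl_cut:
  assumes "set \<gamma>s = M" "sorted_wrt (\<lambda>\<gamma> \<delta>. fst \<gamma> < fst \<delta>) \<gamma>s"
  shows "foldl cut (mid_diagram A M B V) \<gamma>s = mid_diagram A {} B (V \<union> fst ` M \<union> snd ` M)"
  using assms
proof (induction \<gamma>s arbitrary: M V)
  case (Cons \<gamma> \<gamma>s)
  obtain i j where g: "\<gamma> = (i, j)" by (cases \<gamma>)
  have ij: "(i, j) \<in> M" using Cons.prems(1) g by auto
  have set: "set \<gamma>s = M - {(i, j)}" using Cons.prems g by auto
  have "V \<union> {i, j} \<union> fst ` (M - {(i, j)}) \<union> snd ` (M - {(i, j)}) = V \<union> fst ` M \<union> snd ` M"
    using ij by force
  then show ?case using Cons.IH[OF set, of "V \<union> {i, j}"] Cons.prems(2) by (simp add: g mid_cut[OF ij])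
qed simp

lemma surgeries_smult:
  "surgeries \<alpha> \<epsilon> \<omega> p D \<gamma>s (smult c x) = smult c (surgeries \<alpha> \<epsilon> \<omega> p D \<gamma>s x)"
  by (induction \<gamma>s arbitrary: D x) (auto simp: lin_ext_smult)

section \<open>Coefficients of stacked and collapsed diagrams\<close>

definition line_rel :: "arc set \<Rightarrow> arc set \<Rightarrow> (int \<times> int) set" where
  "line_rel X Y = (X \<union> Y) \<union> (X \<union> Y)\<inverse>"

text \<open>The common ground for comparing basic, stacked and collapsed diagrams, whose circles use
  different levels.\<close>

definition line_circles :: "arc set \<Rightarrow> arc set \<Rightarrow> int set set" where
  "line_circles X Y = (\<lambda>i. (line_rel X Y)\<^sup>* `` {i}) ` Domain (line_rel X Y)"

definition exterior_arcs :: "arc set \<Rightarrow> int set \<Rightarrow> arc set" where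
  "exterior_arcs X c = {(i, j) \<in> X. i \<in> c \<and> even (card {y. i < y \<and> y \<in> c})}"

definition line_coeff :: "(int \<Rightarrow> nat) \<Rightarrow> arc set \<Rightarrow> arc set \<Rightarrow> weight \<Rightarrow> int set \<Rightarrow> Q" where
  "line_coeff p X Y \<nu> c =
     Q_unit ((\<Sum>\<gamma>\<in>exterior_arcs X c. cup_eps p \<gamma>) + (\<Sum>\<gamma>\<in>exterior_arcs Y c. cap_eps p \<gamma>) +
         (if \<forall>v\<in>c. v = Max c \<longrightarrow> \<nu> v = Up then 0 else p (Max c)))
       ((\<Sum>\<gamma>\<in>exterior_arcs X c. cup_omega p \<gamma>) + (\<Sum>\<gamma>\<in>exterior_arcs Y c. cap_omega p \<gamma>))"

text \<open>A circle of a diagram that is described by its projection \<open>c\<close> to the integers; it uses one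
  level, or both levels if all arcs between them have been removed.\<close>

lemma circle_coeff_line:
  assumes "cups D \<inter> {(l, i, j). (l, i) \<in> L \<times> c} = {k} \<times> {(i, j) \<in> X. i \<in> c}"
    and "caps D \<inter> {(l, i, j). (l, i) \<in> L \<times> c} = {k'} \<times> {(i, j) \<in> Y. i \<in> c}"
    and "L \<noteq> {}" "\<And>l v. l \<in> L \<Longrightarrow> lab (l, v) = \<nu> v" "L \<times> c \<in> circles D"
  shows "circle_coeff p D (clockwise_circles D lab) (L \<times> c) = line_coeff p X Y \<nu> c"
proof -
  have ot: "odd_to_the_right (L \<times> c) (l, i) \<longleftrightarrow> odd (card {y. i < y \<and> y \<in> c})" if "l \<in> L" for l i
    using that unfolding odd_to_the_right_def by simp
  have *: "{(l, i, j) \<in> Z. (l, i) \<in> L \<times> c \<and> \<not> odd_to_the_right (L \<times> c) (l, i)} = Pair m ` exterior_arcs T c"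
    if Z: "Z \<inter> {(l, i, j). (l, i) \<in> L \<times> c} = {m} \<times> {(i, j) \<in> T. i \<in> c}" for Z m T
  proof -
    have iff: "(l, i, j) \<in> Z \<and> l \<in> L \<and> i \<in> c \<longleftrightarrow> l = m \<and> (i, j) \<in> T \<and> i \<in> c" for l i j
      using Z[THEN eqset_imp_iff, of "(l, i, j)"] by simp
    have "(l, i, j) \<in> Z \<and> (l, i) \<in> L \<times> c \<and> \<not> odd_to_the_right (L \<times> c) (l, i) \<longleftrightarrow>
        l = m \<and> (i, j) \<in> exterior_arcs T c" for l i j
    proof -
      have "(l, i, j) \<in> Z \<and> (l, i) \<in> L \<times> c \<and> \<not> odd_to_the_right (L \<times> c) (l, i) \<longleftrightarrow>
          ((l, i, j) \<in> Z \<and> l \<in> L \<and> i \<in> c) \<and> even (card {y. i < y \<and> y \<in> c})"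
        using ot[of l i] by auto
      then show ?thesis unfolding iff exterior_arcs_def by simp
    qed
    then show ?thesis by auto
  qed
  note cu = *[OF assms(1), folded icup_def] and ca = *[OF assms(2), folded icap_def]
  have sn: "snd ` (L \<times> c) = c" using assms(3) by force
  have "anticlockwise lab (L \<times> c) \<longleftrightarrow> (\<forall>v\<in>c. v = Max c \<longrightarrow> \<nu> v = Up)"
    unfolding anticlockwise_def sn using assms(3,4) by auto
  then have cl: "L \<times> c \<in> clockwise_circles D lab \<longleftrightarrow> \<not> (\<forall>v\<in>c. v = Max c \<longrightarrow> \<nu> v = Up)"
    unfolding clockwise_circles_def using assms(5) by simp
  show ?thesis
    unfolding circle_coeff_eq line_coeff_def exterior_sum_def cu ca cl rightmost_def sn
    by (simp add: sum.reindex inj_on_def)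
qed

lemma rtrancl_levels:
  assumes "R = {((l, i), (l, j)) | l i j. (i, j) \<in> G l}"
  shows "R\<^sup>* `` {(l, i)} = {l} \<times> (G l)\<^sup>* `` {i}"
proof -
  have "fst x = l \<and> (i, snd x) \<in> (G l)\<^sup>*" if "((l, i), x) \<in> R\<^sup>*" for x
    using that by induction (auto simp: assms intro: rtrancl_into_rtrancl)
  moreover have "((l, i), (l, j)) \<in> R\<^sup>*" if "(i, j) \<in> (G l)\<^sup>*" for j
    using that
  proof induction
    case (step j k)
    then have "((l, j), (l, k)) \<in> R" using assms by auto
    then show ?case using step(3) by (rule rtrancl_into_rtrancl[rotated])
  qed simp
  ultimately show ?thesis by auto
qed

definition level_up :: "(level \<Rightarrow> arc set) \<Rightarrow> (level \<times> arc) set" where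
  "level_up X = {(l, \<gamma>). \<gamma> \<in> X l}"

lemma circles_levels:
  assumes "cups D = level_up X" "caps D = level_up Y" "vlines D = {}"
  shows "circles D = (\<Union>l. (\<lambda>c. {l} \<times> c) ` line_circles (X l) (Y l))"
proof -
  have R: "adjacency D = {((l, i), (l, j)) | l i j. (i, j) \<in> line_rel (X l) (Y l)}"
    unfolding adjacency_def Let_def assms line_rel_def level_up_def by auto
  have "Domain (adjacency D) = {(l, i). i \<in> Domain (line_rel (X l) (Y l))}"
    unfolding R by auto
  then show ?thesis
    unfolding circles_def circle_of_def line_circles_def
    by (auto simp: rtrancl_levels[OF R] image_iff) blast+
qed

lemma level_coeff:
  assumes "cups D = level_up X" "caps D = level_up Y" "vlines D = {}" "c \<in> line_circles (X l) (Y l)"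
  shows "circle_coeff p D (clockwise_circles D lab) ({l} \<times> c) = line_coeff p (X l) (Y l) (\<lambda>i. lab (l, i)) c"
proof (rule circle_coeff_line)
  show "{l} \<times> c \<in> circles D" unfolding circles_levels[OF assms(1-3)] using assms(4) by blast
qed (use assms in \<open>auto simp: level_up_def\<close>)

lemma UN_level: "(\<Union>l. F l) = F Lower \<union> F Upper"
proof -
  have UNIV: "(UNIV :: level set) = {Lower, Upper}" using level.exhaust by auto
  show ?thesis unfolding UNIV by simp
qed

lemma basic_coeff:
  "diagram_coeff p (basic_diagram \<xi> \<mu>) (clockwise_circles (basic_diagram \<xi> \<mu>) (\<lambda>(l, i). \<nu> i)) =
    (\<Prod>c\<in>line_circles (arcs \<xi>) (arcs \<mu>). line_coeff p (arcs \<xi>) (arcs \<mu>) \<nu> c)"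
proof -
  \<comment> \<open>A basic diagram is treated as a two-level one whose upper line carries no
    arcs.\<close>
  let ?X = "\<lambda>l. case l of Lower \<Rightarrow> arcs \<xi> | Upper \<Rightarrow> {}" and ?Y = "\<lambda>l. case l of Lower \<Rightarrow> arcs \<mu> | Upper \<Rightarrow> {}"
  have D: "cups (basic_diagram \<xi> \<mu>) = level_up ?X" "caps (basic_diagram \<xi> \<mu>) = level_up ?Y" "vlines (basic_diagram \<xi> \<mu>) = {}"
    unfolding basic_diagram_def level_up_def by (auto split: level.splits)
  have "line_circles {} {} = {}" unfolding line_circles_def line_rel_def by simp
  moreover have "(\<Union>l. (\<lambda>c. {l} \<times> c) ` line_circles (?X l) (?Y l)) =
      (\<lambda>c. {Lower} \<times> c) ` line_circles (?X Lower) (?Y Lower) \<union> (\<lambda>c. {Upper} \<times> c) ` line_circles (?X Upper) (?Y Upper)"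
    by (rule UN_level)
  ultimately have "circles (basic_diagram \<xi> \<mu>) = (\<lambda>c. {Lower} \<times> c) ` line_circles (arcs \<xi>) (arcs \<mu>)"
    unfolding circles_levels[OF D] by simp
  moreover have "inj_on (\<lambda>c. {Lower} \<times> c) (line_circles (arcs \<xi>) (arcs \<mu>))" by (auto intro!: inj_onI)
  ultimately show ?thesis
    unfolding diagram_coeff_def using level_coeff[OF D, of _ Lower] by (simp add: prod.reindex)
qed

text \<open>Without vertical lines no circle changes its level, so the product over all circles
  factors into those of the two multiplied diagrams.\<close>

lemma stacked_coeff:
  assumes "finite (line_circles A M)" "finite (line_circles M B)"
  shows "diagram_coeff p (mid_diagram A M B {}) (clockwise_circles (mid_diagram A M B {}) (\<lambda>(l, i). case l of Lower \<Rightarrow> \<nu> i | Upper \<Rightarrow> \<nu>' i)) =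
    (\<Prod>c\<in>line_circles A M. line_coeff p A M \<nu> c) * (\<Prod>c\<in>line_circles M B. line_coeff p M B \<nu>' c)"
proof -
  let ?X = "\<lambda>l. case l of Lower \<Rightarrow> A | Upper \<Rightarrow> M" and ?Y = "\<lambda>l. case l of Lower \<Rightarrow> M | Upper \<Rightarrow> B"
  let ?D = "mid_diagram A M B {}"
  have D: "cups ?D = level_up ?X" "caps ?D = level_up ?Y" "vlines ?D = {}"
    unfolding mid_diagram_def level_up_def by (auto split: level.splits)
  have ne: "c \<noteq> {}" if "c \<in> line_circles A M" for c using that unfolding line_circles_def by auto
  have "(\<Union>l. (\<lambda>c. {l} \<times> c) ` line_circles (?X l) (?Y l)) =
      (\<lambda>c. {Lower} \<times> c) ` line_circles (?X Lower) (?Y Lower) \<union> (\<lambda>c. {Upper} \<times> c) ` line_circles (?X Upper) (?Y Upper)"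
    by (rule UN_level)
  then have c: "circles ?D = (\<lambda>c. {Lower} \<times> c) ` line_circles A M \<union> (\<lambda>c. {Upper} \<times> c) ` line_circles M B"
    unfolding circles_levels[OF D] by simp
  have dj: "(\<lambda>c. {Lower} \<times> c) ` line_circles A M \<inter> (\<lambda>c. {Upper} \<times> c) ` line_circles M B = {}"
    using ne by (fastforce simp: times_eq_iff)
  have inj: "inj_on (\<lambda>c. {l} \<times> c) Z" for l :: level and Z :: "int set set" by (auto intro!: inj_onI)
  show ?thesis
    unfolding diagram_coeff_def c
    using level_coeff[OF D, of _ Lower] level_coeff[OF D, of _ Upper] assms
    by (subst prod.union_disjoint[OF _ _ dj]) (simp_all add: prod.reindex[OF inj])
qed

text \<open>With vertical lines everywhere, a circle meets both levels in the same set
  \<open>c\<close>. Its cups are on the lower and its caps on the upper level, and a ray on either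
  level counts points of \<open>c\<close>; so collapsing preserves sides and rightmost
  positions.\<close>

lemma collapsed_coeff:
  assumes A: "matching S A" and B: "matching S B"
  shows "diagram_coeff p (mid_diagram A {} B S) (clockwise_circles (mid_diagram A {} B S) (\<lambda>(l, i). \<nu> i)) =
    (\<Prod>c\<in>line_circles A B. line_coeff p A B \<nu> c)"
proof -
  let ?D = "mid_diagram A {} B S"
  have fieldA: "i \<in> S \<and> j \<in> S" if "(i, j) \<in> line_rel A B" for i j
    using that matchingD[OF A] matchingD[OF B] unfolding line_rel_def by auto
  have dom: "Domain (line_rel A B) = S"
    using partner_arc[OF A] fieldA unfolding line_rel_def by blast
  have adj: "((l, i), (k, j)) \<in> adjacency ?D \<longleftrightarrow>
      l = k \<and> (l = Lower \<and> ((i, j) \<in> A \<or> (j, i) \<in> A) \<or> l = Upper \<and> ((i, j) \<in> B \<or> (j, i) \<in> B)) \<or> l \<noteq> k \<and> i = j \<and> i \<in> S" for l i k j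
    unfolding adjacency_def mid_diagram_def Let_def by (cases l; cases k) auto
  have "Domain (adjacency ?D) = UNIV \<times> S"
  proof -
    have "((l, i), (other l, i)) \<in> adjacency ?D" if "i \<in> S" for l i using that adj by (cases l) auto
    moreover have "i \<in> S" if "((l, i), (k, j)) \<in> adjacency ?D" for l i k j
      using that matchingD[OF A] matchingD[OF B] unfolding adj by blast
    ultimately show ?thesis by (auto simp: Domain_unfold)
  qed
  moreover have "circle_of ?D (l, i) = UNIV \<times> (line_rel A B)\<^sup>* `` {i}" if i: "i \<in> S" for l i
  proof -
    have "(i, snd x) \<in> (line_rel A B)\<^sup>*" if "((l, i), x) \<in> (adjacency ?D)\<^sup>*" for x
      using that
    proof induction
      case (step x y)
      obtain k m k' m' where xy: "x = (k, m)" "y = (k', m')" by (cases x, cases y)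
      have "m = m' \<or> (m, m') \<in> line_rel A B" using step(2) unfolding xy adj line_rel_def by blast
      then show ?case using step(3) unfolding xy by (auto intro: rtrancl_into_rtrancl)
    qed simp
    moreover have "j \<in> S \<and> (\<forall>k. ((l, i), (k, j)) \<in> (adjacency ?D)\<^sup>*)" if "(i, j) \<in> (line_rel A B)\<^sup>*" for j
      using that
    proof induction
      case base
      have "((l, i), (other l, i)) \<in> adjacency ?D" using i adj by (cases l) auto
      then have "((l, i), (k, i)) \<in> (adjacency ?D)\<^sup>*" for k by (cases "k = l"; cases k; cases l) auto
      then show ?case using i by blast
    next
      case (step j m)
      have m: "m \<in> S" using fieldA step(2) by blast
      have "\<exists>k. ((k, j), (k, m)) \<in> adjacency ?D" using step(2) unfolding line_rel_def adj by blast
      then obtain k where "((k, j), (k, m)) \<in> adjacency ?D" by blast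
      then have 1: "((l, i), (k, m)) \<in> (adjacency ?D)\<^sup>*" using step(3) by (meson rtrancl_into_rtrancl)
      moreover have "((k, m), (other k, m)) \<in> adjacency ?D" using m adj by (cases k) auto
      ultimately have 2: "((l, i), (other k, m)) \<in> (adjacency ?D)\<^sup>*" by (rule rtrancl_into_rtrancl)
      have "((l, i), (k', m)) \<in> (adjacency ?D)\<^sup>*" for k' using 1 2 by (cases k; cases k') auto
      then show ?case using m by blast
    qed
    ultimately show ?thesis unfolding circle_of_def by auto
  qed
  ultimately have c: "circles ?D = (\<lambda>c. UNIV \<times> c) ` line_circles A B"
    unfolding circles_def line_circles_def dom by (auto simp: image_iff)
  have "circle_coeff p ?D (clockwise_circles ?D (\<lambda>(l, i). \<nu> i)) (UNIV \<times> c) = line_coeff p A B \<nu> c"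
    if "c \<in> line_circles A B" for c
  proof (rule circle_coeff_line)
    show "UNIV \<times> c \<in> circles ?D" unfolding c using that by blast
  qed (auto simp: mid_diagram_def)
  moreover have "inj_on (\<lambda>c. (UNIV :: level set) \<times> c) (line_circles A B)" by (auto intro!: inj_onI)
  ultimately show ?thesis unfolding diagram_coeff_def c by (simp add: prod.reindex)
qed

section \<open>Weights and positions\<close>

text \<open>If two arcs share an end, the other end of the shorter one lies strictly beneath the
  longer one, so it was connected by an arc beneath; its label tells which end of that arc it is. By
  induction this arc is the shorter one itself, but the shared end does not lie strictly beneath the
  longer arc.\<close>

lemma arcs_unique:
  assumes "(i, j) \<in> arcs \<xi>" "(i', j') \<in> arcs \<xi>" "i = i' \<or> j = j'"
  shows "(i, j) = (i', j')"
  using assms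
proof (induction "nat (max (j - i) (j' - i'))" arbitrary: i j i' j' rule: less_induct)
  case less
  have gen: False if a: "(i, j) \<in> arcs \<xi>" "(i', j') \<in> arcs \<xi>" and sh: "i = i' \<and> j < j' \<or> j = j' \<and> i' < i"
    and IH: "\<And>k l k' l'. nat (max (l - k) (l' - k')) < nat (j' - i') \<Longrightarrow> (k, l) \<in> arcs \<xi> \<Longrightarrow> (k', l') \<in> arcs \<xi> \<Longrightarrow>
      k = k' \<or> l = l' \<Longrightarrow> (k, l) = (k', l')" for i j i' j'
  proof -
    have ij: "\<xi> i = Down" "\<xi> j = Up" "i < j" using a(1) by (auto elim: arcs.cases)
    have mid: "\<And>k. i' < k \<Longrightarrow> k < j' \<Longrightarrow> \<xi> k = Circ \<or> \<xi> k = Cross \<or> (\<exists>a b. (a, b) \<in> arcs \<xi> \<and> i' < a \<and> b < j' \<and> (k = a \<or> k = b))"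
      using a(2) by (auto elim: arcs.cases)
    have ends: "\<xi> k = Down" "\<xi> l = Up" "k < l" if "(k, l) \<in> arcs \<xi>" for k l
      using that by (auto elim: arcs.cases)
    from sh show False
    proof
      assume s: "i = i' \<and> j < j'"
      then obtain k l where kl: "(k, l) \<in> arcs \<xi>" "i' < k" "l < j'" "j = k \<or> j = l" using mid[of j] ij by auto
      then have "j = l" using ends[OF kl(1)] ij by auto
      then have "(k, l) = (i, j)" using kl s ends[OF kl(1)] a(1) ij by (intro IH) auto
      then show False using kl s by simp
    next
      assume s: "j = j' \<and> i' < i"
      then obtain k l where kl: "(k, l) \<in> arcs \<xi>" "i' < k" "l < j'" "i = k \<or> i = l" using mid[of i] ij by auto
      then have "i = k" using ends[OF kl(1)] ij by auto
      then have "(k, l) = (i, j)" using kl s ends[OF kl(1)] a(1) ij by (intro IH) auto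
      then show False using kl s by simp
    qed
  qed
  show ?case
  proof (rule ccontr)
    assume "(i, j) \<noteq> (i', j')"
    then consider "i = i' \<and> j < j' \<or> j = j' \<and> i' < i" | "i' = i \<and> j' < j \<or> j' = j \<and> i < i'"
      using less.prems(3) by (metis linorder_neqE_linordered_idom)
    then show False
    proof cases
      case 1
      then have "max (j - i) (j' - i') = j' - i'" by auto
      with 1 show False using gen[OF less.prems(1,2)] less.hyps by metis
    next
      case 2
      then have "max (j - i) (j' - i') = j - i" by auto
      with 2 show False using gen[OF less.prems(2,1)] less.hyps by metis
    qed
  qed
qed

lemma arcs_matching:
  assumes "balanced_weight \<xi>"
  shows "matching {i. \<xi> i = Down \<or> \<xi> i = Up} (arcs \<xi>)"
proof -
  have e: "\<xi> i = Down" "\<xi> j = Up" "i < j" if "(i, j) \<in> arcs \<xi>" for i j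
    using that by (auto elim: arcs.cases)
  have "\<exists>!w. (v, w) \<in> arcs \<xi> \<or> (w, v) \<in> arcs \<xi>" if v: "\<xi> v = Down \<or> \<xi> v = Up" for v
  proof -
    obtain a b where ab: "(a, b) \<in> arcs \<xi>" "v = a \<or> v = b" using assms v unfolding balanced_weight_def by blast
    show ?thesis
    proof (rule ex_ex1I)
      show "\<exists>w. (v, w) \<in> arcs \<xi> \<or> (w, v) \<in> arcs \<xi>" using ab by blast
      fix w w' assume "(v, w) \<in> arcs \<xi> \<or> (w, v) \<in> arcs \<xi>" "(v, w') \<in> arcs \<xi> \<or> (w', v) \<in> arcs \<xi>"
      then consider "(v, w) \<in> arcs \<xi>" "(v, w') \<in> arcs \<xi>" | "(w, v) \<in> arcs \<xi>" "(w', v) \<in> arcs \<xi>"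
        using e(1)[of v] e(2)[of _ v] by (metis wsymbol.distinct(11))
      then show "w = w'" using arcs_unique by cases (blast dest: prod.inject[THEN iffD1])+
    qed
  qed
  moreover have "l < j" if ij: "(i, j) \<in> arcs \<xi>" and kl: "(k, l) \<in> arcs \<xi>" and k: "i < k" "k < j" for i j k l
  proof -
    have "\<xi> k = Circ \<or> \<xi> k = Cross \<or> (\<exists>a b. (a, b) \<in> arcs \<xi> \<and> i < a \<and> b < j \<and> (k = a \<or> k = b))"
      using ij k by (cases rule: arcs.cases) blast
    then obtain a b where ab: "(a, b) \<in> arcs \<xi>" "b < j" "k = a \<or> k = b"
      using e(1)[OF kl] by auto
    then have "k = a" using e(1)[OF kl] e(2)[OF ab(1)] by auto
    then show ?thesis using arcs_unique[OF kl ab(1)] ab(2) by simp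
  qed
  ultimately show ?thesis using e unfolding matching_def by fast
qed

lemma forget_star: "forget s = BStar \<longleftrightarrow> s = Down \<or> s = Up"
  by (cases s) simp_all

section \<open>Blocks and their position functions\<close>

lemma same_block_sym:
  assumes "same_block \<xi> \<mu>" shows "same_block \<mu> \<xi>"
proof -
  obtain \<pi> where p: "\<pi> permutes {i. \<xi> i = Down \<or> \<xi> i = Up}" "\<mu> = \<xi> \<circ> \<pi>" using assms unfolding same_block_def by blast
  have "{i. \<mu> i = Down \<or> \<mu> i = Up} = {i. \<xi> i = Down \<or> \<xi> i = Up}"
    unfolding forget_star[symmetric] forget_same_block[OF assms] ..
  moreover have "\<xi> = \<mu> \<circ> inv \<pi>" unfolding p(2) comp_assoc permutes_inv_o[OF p(1)] by simp
  ultimately show ?thesis using permutes_inv[OF p(1)] unfolding same_block_def by auto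
qed

lemma same_block_trans:
  assumes "same_block \<xi> \<mu>" "same_block \<mu> \<eta>" shows "same_block \<xi> \<eta>"
proof -
  obtain \<pi> where p: "\<pi> permutes {i. \<xi> i = Down \<or> \<xi> i = Up}" "\<mu> = \<xi> \<circ> \<pi>" using assms unfolding same_block_def by blast
  obtain \<rho> where r: "\<rho> permutes {i. \<mu> i = Down \<or> \<mu> i = Up}" "\<eta> = \<mu> \<circ> \<rho>" using assms unfolding same_block_def by blast
  have "{i. \<mu> i = Down \<or> \<mu> i = Up} = {i. \<xi> i = Down \<or> \<xi> i = Up}"
    unfolding forget_star[symmetric] forget_same_block[OF assms(1)] ..
  then have "(\<pi> \<circ> \<rho>) permutes {i. \<xi> i = Down \<or> \<xi> i = Up}" using permutes_compose[OF _ p(1)] r(1) by simp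
  then show ?thesis unfolding same_block_def r(2) p(2) comp_assoc by blast
qed

lemma block_of_eq:
  assumes "is_block \<Lambda>" "\<mu> \<in> \<Lambda>"
  shows "block_of \<mu> = \<Lambda>" "is_weight \<mu>"
proof -
  obtain \<xi> where x: "is_weight \<xi>" "\<Lambda> = block_of \<xi>" using assms(1) unfolding is_block_def by blast
  have s: "same_block \<xi> \<mu>" using assms(2) x(2) by (simp add: block_of_def)
  show "block_of \<mu> = \<Lambda>"
    unfolding x(2) block_of_def using same_block_trans same_block_sym s by blast
  have "forget s = BCirc \<longleftrightarrow> s = Circ" for s by (cases s) auto
  then show "is_weight \<mu>" using x(1) forget_same_block[OF s] unfolding is_weight_def by metis
qed

definition stars :: "weight set \<Rightarrow> int set" where
  "stars \<Lambda> = {i. block_seq \<Lambda> i = BStar}"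

lemma stars_eq:
  assumes "is_block \<Lambda>" "\<mu> \<in> \<Lambda>"
  shows "stars \<Lambda> = {i. \<mu> i = Down \<or> \<mu> i = Up}"
  unfolding stars_def block_of_eq(1)[OF assms, symmetric] block_seq_block_of forget_star ..

lemma finite_symbols:
  assumes "is_block \<Lambda>"
  shows "finite {i. block_seq \<Lambda> i \<noteq> BCirc}"
proof -
  obtain \<xi> where x: "is_weight \<xi>" "\<Lambda> = block_of \<xi>" using assms unfolding is_block_def by blast
  obtain N where N: "\<And>i. \<bar>i\<bar> > N \<Longrightarrow> \<xi> i = Circ" using x(1) unfolding is_weight_def by blast
  have "{i. block_seq \<Lambda> i \<noteq> BCirc} \<subseteq> {- N..N}"
    unfolding x(2) block_seq_block_of using N by (auto intro: ccontr simp: not_le abs_less_iff) (metis abs_le_D1 abs_le_D2 forget.simps(1) linorder_not_le minus_le_iff)+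
  then show ?thesis using finite_subset by blast
qed

lemma pos_mono:
  assumes "is_block \<Lambda>"
  shows "mono (pos \<Lambda>)"
proof (rule monoI)
  fix i j :: int assume "i \<le> j"
  then show "pos \<Lambda> i \<le> pos \<Lambda> j"
    unfolding pos_def
    by (intro add_mono mult_left_mono card_mono) (auto intro: finite_subset[OF _ finite_symbols[OF assms]])
qed

text \<open>The stars strictly beneath an arc are paired off, the right end adds one, and crosses
  count twice.\<close>

lemma pos_odd:
  assumes b: "is_block \<Lambda>" and m: "matching (stars \<Lambda>) X" and ij: "(i, j) \<in> X"
  shows "odd (pos \<Lambda> i + pos \<Lambda> j)"
proof -
  have fin: "finite {k. k \<le> l \<and> block_seq \<Lambda> k = BStar}" "finite {k\<in>stars \<Lambda>. i < k \<and> k < j}" for l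
    unfolding stars_def by (auto intro: finite_subset[OF _ finite_symbols[OF b]])
  have pj: "partner X i = j" using partner_eq[OF m] ij by blast
  note i = matchingD[OF m ij]
  have "involution_on {k\<in>stars \<Lambda>. i < k \<and> k < j} (partner X)"
    unfolding involution_on_def
    using noncrossing_between[OF noncrossing_partner[OF m] i(2)] noncrossingD[OF noncrossing_partner[OF m]] pj by auto
  then have ev: "even (card {k\<in>stars \<Lambda>. i < k \<and> k < j})" using even_card_involution fin(2) by blast
  have "{k. k \<le> j \<and> block_seq \<Lambda> k = BStar} = {k. k \<le> i \<and> block_seq \<Lambda> k = BStar} \<union> insert j {k\<in>stars \<Lambda>. i < k \<and> k < j}"
    using i unfolding stars_def by auto
  moreover have "card ({k. k \<le> i \<and> block_seq \<Lambda> k = BStar} \<union> insert j {k\<in>stars \<Lambda>. i < k \<and> k < j}) =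
      card {k. k \<le> i \<and> block_seq \<Lambda> k = BStar} + card (insert j {k\<in>stars \<Lambda>. i < k \<and> k < j})"
    using fin i(1) by (intro card_Un_disjoint) auto
  ultimately have "card {k. k \<le> j \<and> block_seq \<Lambda> k = BStar} =
      card {k. k \<le> i \<and> block_seq \<Lambda> k = BStar} + Suc (card {k\<in>stars \<Lambda>. i < k \<and> k < j})"
    using fin(2) by simp
  then show ?thesis unfolding pos_def using ev by simp
qed

section \<open>The isomorphism\<close>

text \<open>Reading the block off from the cup weight gives a single map for all blocks, the
  candidate for the isomorphism of the direct sums.\<close>

definition total_coeff :: "basis \<Rightarrow> Q" where
  "total_coeff b = basis_coeff (block_of (fst b)) b"

lemma total_coeff_eq:
  assumes "is_block \<Lambda>" "\<xi> \<in> \<Lambda>"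
  shows "total_coeff (\<xi>, \<nu>, \<mu>) = basis_coeff \<Lambda> (\<xi>, \<nu>, \<mu>)" (is ?g1)
    "total_coeff (\<xi>, \<nu>, \<mu>) = (\<Prod>c\<in>line_circles (arcs \<xi>) (arcs \<mu>). line_coeff (pos \<Lambda>) (arcs \<xi>) (arcs \<mu>) \<nu> c)" (is ?g2)
proof -
  show ?g1
    unfolding total_coeff_def by (simp add: block_of_eq[OF assms])
  then show ?g2
    by (simp only: basis_coeff.simps Let_def basic_coeff[symmetric] diagram_coeff_def)
qed

abbreviation coeff_total :: "(basis \<Rightarrow>\<^sub>0 Q) \<Rightarrow> (basis \<Rightarrow>\<^sub>0 Q)" where
  "coeff_total \<equiv> lin_ext (\<lambda>b. single b (total_coeff b))"

lemma left_to_right_matching: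
  assumes "finite S" "matching S X"
  shows "set (left_to_right X) = X" "sorted_wrt (\<lambda>\<gamma> \<delta>. fst \<gamma> < fst \<delta>) (left_to_right X)" (is ?g2)
proof -
  let ?l = "map (\<lambda>i. (i, partner X i)) (sorted_list_of_set (fst ` X))"
  have fin: "finite (fst ` X)" using finite_matching[OF assms] by simp
  have "set ?l = X"
  proof -
    have "(i, partner X i) = (i, j)" if "(i, j) \<in> X" for i j using partner_eq[OF assms(2)] that by auto
    then show ?thesis using fin by (force simp: image_iff)
  qed
  moreover have "sorted_wrt (\<lambda>\<gamma> \<delta>. fst \<gamma> < fst \<delta>) ?l"
    by (simp add: sorted_wrt_map)
  ultimately have "left_to_right X = ?l" by (rule left_to_right_eqI)
  then show "set (left_to_right X) = X" ?g2
    using \<open>set ?l = X\<close> \<open>sorted_wrt (\<lambda>\<gamma> \<delta>. fst \<gamma> < fst \<delta>) ?l\<close> by simp_all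
qed

lemma finite_line_circles: "finite X \<Longrightarrow> finite Y \<Longrightarrow> finite (line_circles X Y)"
  unfolding line_circles_def line_rel_def by (intro finite_imageI finite_Domain) simp

lemma basis_mult_coeff:
  assumes b: "is_block \<Lambda>" "is_block \<Lambda>'" and x: "x \<in> arc_basis \<Lambda>" and y: "y \<in> arc_basis \<Lambda>'"
  shows "coeff_total (basis_mult \<alpha> 1 1 x y) = smult (total_coeff x * total_coeff y) (basis_mult \<alpha> Q_eps Q_omega x y)"
proof -
  obtain \<xi> \<nu> \<mu> where xx: "x = (\<xi>, \<nu>, \<mu>)" by (metis surj_pair)
  obtain \<mu>' \<nu>' \<eta> where yy: "y = (\<mu>', \<nu>', \<eta>)" by (metis surj_pair)
  show ?thesis
  proof (cases "\<mu> = \<mu>'")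
    case False
    then show ?thesis unfolding xx yy by (simp add: lin_ext_zero smult_simps)
  next
    case True
    have mem: "\<xi> \<in> \<Lambda>" "\<mu> \<in> \<Lambda>" "\<mu> \<in> \<Lambda>'" "\<eta> \<in> \<Lambda>'" and bal: "balanced_weight \<xi>" "balanced_weight \<mu>" "balanced_weight \<eta>"
      using x y True unfolding xx yy arc_basis_def by auto
    have L: "block_of \<mu> = \<Lambda>" "\<Lambda>' = \<Lambda>" using block_of_eq(1)[OF b(1) mem(2)] block_of_eq(1)[OF b(2) mem(3)] by auto
    let ?S = "stars \<Lambda>" and ?p = "pos \<Lambda>" and ?\<gamma>s = "left_to_right (arcs \<mu>)"
    let ?D = "mid_diagram (arcs \<xi>) (arcs \<mu>) (arcs \<eta>) {}" and ?E = "mid_diagram (arcs \<xi>) {} (arcs \<eta>) ?S"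
    have mt: "matching ?S (arcs \<xi>)" "matching ?S (arcs \<mu>)" "matching ?S (arcs \<eta>)"
      using arcs_matching[OF bal(1)] arcs_matching[OF bal(2)] arcs_matching[OF bal(3)]
        stars_eq[OF b(1) mem(1)] stars_eq[OF b(1) mem(2)] stars_eq[OF b(1)] mem(4) L(2) by simp_all
    have finS: "finite ?S" unfolding stars_def using finite_symbols[OF b(1)] by (rule finite_subset[rotated]) auto
    have fin: "finite (arcs \<xi>)" "finite (arcs \<mu>)" "finite (arcs \<eta>)" using finite_matching[OF finS] mt by auto
    have pl: "planar (arcs \<xi>) (arcs \<mu>) (arcs \<eta>) {} ?S ?p"
      by unfold_locales (use finS mt pos_mono[OF b(1)] pos_odd[OF b(1)] in auto)
    note ltr = left_to_right_matching[OF finS mt(2)]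
    have S: "{} \<union> fst ` arcs \<mu> \<union> snd ` arcs \<mu> = ?S"
    proof -
      have "v \<in> fst ` arcs \<mu> \<union> snd ` arcs \<mu>" if "v \<in> ?S" for v
        using partner_arc[OF mt(2) that] by force
      then show ?thesis using matchingD(2,3)[OF mt(2)] by auto
    qed
    have E: "foldl cut ?D ?\<gamma>s = ?E" unfolding foldl_cut[OF ltr] S ..
    define K where "K = clockwise_circles ?D (\<lambda>(l, i). case l of Lower \<Rightarrow> \<nu> i | Upper \<Rightarrow> \<nu>' i)"
    have D: "stacked_diagram \<xi> \<mu> \<eta> = ?D" unfolding stacked_diagram_def mid_diagram_def ..
    define u where "u = surgeries \<alpha> 1 1 ?p ?D ?\<gamma>s (single K 1)"
    define w where "w = surgeries \<alpha> Q_eps Q_omega ?p ?D ?\<gamma>s (single K 1)"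
    have "rescale ?p ?E u = surgeries \<alpha> Q_eps Q_omega ?p ?D ?\<gamma>s (rescale ?p ?D (single K 1))"
      unfolding u_def E[symmetric] by (rule surgeries_coeff[OF pl ltr]) (auto simp: K_def clockwise_circles_def)
    also have "rescale ?p ?D (single K 1) = smult (diagram_coeff ?p ?D K) (single K 1)"
      by (simp add: rescale_single smult_single)
    also have "surgeries \<alpha> Q_eps Q_omega ?p ?D ?\<gamma>s \<dots> = smult (diagram_coeff ?p ?D K) w"
      unfolding w_def by (rule surgeries_smult)
    finally have uw: "rescale ?p ?E u = smult (diagram_coeff ?p ?D K) w" .
    have DK: "diagram_coeff ?p ?D K = total_coeff x * total_coeff y"
      unfolding K_def xx yy True[symmetric] total_coeff_eq(2)[OF b(1) mem(1)] total_coeff_eq(2)[OF b(1) mem(2)]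
      by (rule stacked_coeff) (use fin in \<open>auto intro: finite_line_circles\<close>)
    have EK: "diagram_coeff ?p ?E (clockwise_circles ?E (\<lambda>(l, i). \<nu>'' i)) = total_coeff (\<xi>, \<nu>'', \<eta>)" for \<nu>''
      unfolding total_coeff_eq(2)[OF b(1) mem(1)] by (rule collapsed_coeff[OF mt(1,3)])
    \<comment> \<open>\<open>basis_mult\<close> evaluates the result of the surgeries at the
      orientations coming from weights, so the intertwining relation is read off at exactly
      these.\<close>
    have lk: "lookup u (clockwise_circles ?E (\<lambda>(l, i). \<nu>'' i)) * total_coeff (\<xi>, \<nu>'', \<eta>) =
        total_coeff x * total_coeff y * lookup w (clockwise_circles ?E (\<lambda>(l, i). \<nu>'' i))" for \<nu>''
      using arg_cong[OF uw, of "\<lambda>f. lookup f (clockwise_circles ?E (\<lambda>(l, i). \<nu>'' i))"]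
      by (simp only: lookup_diag lookup_smult EK DK)
    have bm: "basis_mult \<alpha> \<epsilon> \<omega> x y = (\<Sum>\<nu>''\<in>{\<nu>''. (\<xi>, \<nu>'', \<eta>) \<in> arc_basis \<Lambda>}.
        single (\<xi>, \<nu>'', \<eta>) (lookup (surgeries \<alpha> \<epsilon> \<omega> ?p ?D ?\<gamma>s (single K 1))
          (clockwise_circles ?E (\<lambda>(l, i). \<nu>'' i))))" for \<epsilon> \<omega> :: Q
      unfolding xx yy True[symmetric] by (simp add: Let_def L D E K_def)
    show ?thesis
      unfolding bm lin_ext_sum lin_ext_single smult_single smult_sum u_def[symmetric] w_def[symmetric] lk ..
  qed
qed

lemma keys_basis_mult:
  assumes "is_block \<Lambda>" "x \<in> arc_basis \<Lambda>"
  shows "keys (basis_mult \<alpha> \<epsilon> \<omega> x y) \<subseteq> arc_basis \<Lambda>"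
proof -
  obtain \<xi> \<nu> \<mu> where xx: "x = (\<xi>, \<nu>, \<mu>)" by (metis surj_pair)
  obtain \<mu>' \<nu>' \<eta> where yy: "y = (\<mu>', \<nu>', \<eta>)" by (metis surj_pair)
  have "\<mu> \<in> \<Lambda>" using assms(2) unfolding xx arc_basis_def by auto
  then have L: "block_of \<mu> = \<Lambda>" using block_of_eq(1)[OF assms(1)] by simp
  have s: "keys (sum f A) \<subseteq> B" if "\<And>a. a \<in> A \<Longrightarrow> keys (f a) \<subseteq> B"
    for f :: "weight \<Rightarrow> basis \<Rightarrow>\<^sub>0 'a" and A B
    using that
  proof (induction A rule: infinite_finite_induct)
    case (insert a A)
    then have "keys (f a + sum f A) \<subseteq> B"
      using Poly_Mapping.keys_add[of "f a" "sum f A"] by blast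
    then show ?case using insert by simp
  qed auto
  show ?thesis
  proof (cases "\<mu> = \<mu>'")
    case False
    then show ?thesis unfolding xx yy by simp
  next
    case True
    have "keys (\<Sum>\<nu>''\<in>{\<nu>''. (\<xi>, \<nu>'', \<eta>) \<in> arc_basis \<Lambda>}. single (\<xi>, \<nu>'', \<eta>) (h \<nu>'')) \<subseteq> arc_basis \<Lambda>"
      for h :: "weight \<Rightarrow> 'a"
      by (rule s) (rule order_trans[OF keys_single_subset], simp)
    moreover have "block_of \<mu>' = \<Lambda>" using L True by simp
    ultimately show ?thesis unfolding xx yy True basis_mult.simps Let_def by simp
  qed
qed

lemma coeff_total_mult:
  assumes "keys x \<subseteq> (\<Union>\<Lambda>\<in>{\<Lambda>. is_block \<Lambda>}. arc_basis \<Lambda>)" "keys y \<subseteq> (\<Union>\<Lambda>\<in>{\<Lambda>. is_block \<Lambda>}. arc_basis \<Lambda>)"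
  shows "coeff_total (arc_mult \<alpha> 1 1 x y) = arc_mult \<alpha> Q_eps Q_omega (coeff_total x) (coeff_total y)"
proof -
  let ?X = "keys x" and ?Y = "keys y"
  have "coeff_total (arc_mult \<alpha> 1 1 x y) = (\<Sum>a\<in>?X. smult (lookup x a)
      (\<Sum>b\<in>?Y. smult (lookup y b) (coeff_total (basis_mult \<alpha> 1 1 a b))))"
    unfolding arc_mult_def lin_ext_def[of _ x] lin_ext_def[of _ y] lin_ext_sum lin_ext_smult ..
  also have "\<dots> = (\<Sum>a\<in>?X. smult (lookup x a)
      (\<Sum>b\<in>?Y. smult (lookup y b) (smult (total_coeff a * total_coeff b) (basis_mult \<alpha> Q_eps Q_omega a b))))"
  proof (intro sum.cong refl arg_cong[where f = "smult _"])
    fix a b assume "a \<in> ?X" "b \<in> ?Y"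
    then obtain \<Lambda> \<Lambda>' where "is_block \<Lambda>" "is_block \<Lambda>'" "a \<in> arc_basis \<Lambda>" "b \<in> arc_basis \<Lambda>'"
      using assms by blast
    then show "coeff_total (basis_mult \<alpha> 1 1 a b) = smult (total_coeff a * total_coeff b) (basis_mult \<alpha> Q_eps Q_omega a b)"
      by (rule basis_mult_coeff)
  qed
  also have "\<dots> = arc_mult \<alpha> Q_eps Q_omega (coeff_total x) (coeff_total y)"
    unfolding arc_mult_def lin_ext_def[of "\<lambda>b. single b (total_coeff b)" x]
      lin_ext_def[of "\<lambda>b. single b (total_coeff b)" y] lin_ext_sum lin_ext_smult lin_ext_single smult_sum smult_simps(3)
    by (intro sum.cong refl arg_cong2[where f = smult]) (simp add: ac_simps)
  finally show ?thesis .
qed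

lemma Q_unit_single: "Q_unit e k = single (0, of_nat e, k) 1"
proof -
  have "Q_eps ^ e = single (0, of_nat e, 0) 1"
    by (induction e) (simp_all add: Q_eps_def mult_single flip: zero_prod_def)
  then show ?thesis unfolding Q_unit_def Q_omega_pow_def by (simp add: mult_single)
qed

lemma total_coeff_unit: "\<exists>e k. total_coeff b = Q_unit e k"
proof -
  obtain \<xi> \<nu> \<mu> where "b = (\<xi>, \<nu>, \<mu>)" by (metis surj_pair)
  then show ?thesis
    unfolding total_coeff_def by (simp add: Let_def circle_coeff_eq prod_Q_unit) blast
qed

text \<open>\<epsilon> and \<omega> have degree 0: multiplying by a monomial in them moves keys but
  keeps the power of \<alpha>.\<close>

lemma lookup_times_unit_degree:
  assumes "(a, e, w) \<in> keys (q * Q_unit n k)"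
  shows "\<exists>e' w'. (a, e', w') \<in> keys q"
proof -
  have "keys (q * Q_unit n k) \<subseteq> {x + y | x y. x \<in> keys q \<and> y \<in> keys (Q_unit n k)}"
    by (rule keys_mult)
  then show ?thesis using assms unfolding Q_unit_single by fastforce
qed

text \<open>The inverse is diagonal too, with the inverse monomials as entries. Both maps preserve
  degrees, which gives equality of the homogeneous parts and not just an inclusion.\<close>

lemma unit_iso:
  assumes c: "\<And>b. b \<in> U \<Longrightarrow> \<exists>e k. c b = Q_unit e k" and n: "\<And>x. keys x \<subseteq> U \<Longrightarrow> F x = lin_ext (\<lambda>b. single b (c b)) x"
  shows "bij_betw F {x. keys x \<subseteq> U} {x. keys x \<subseteq> U}" (is ?g1)
    "F ` {x \<in> {x. keys x \<subseteq> U}. homogeneous m x} = {x \<in> {x. keys x \<subseteq> U}. homogeneous m x}" (is ?g2)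
proof -
  let ?f = "\<lambda>c. lin_ext (\<lambda>b. single b (c b)) :: (basis \<Rightarrow>\<^sub>0 Q) \<Rightarrow> (basis \<Rightarrow>\<^sub>0 Q)"
  define c' where "c' b = (SOME d. c b * d = 1 \<and> (\<exists>e k. d = Q_unit e k))" for b
  have c': "c b * c' b = 1 \<and> (\<exists>e k. c' b = Q_unit e k)" if b: "b \<in> U" for b
  proof -
    obtain e k where e: "c b = Q_unit e k" using c[OF b] by blast
    have "Q_unit e k * Q_unit e (- k) = Q_unit 0 0" unfolding Q_unit_mult by (rule Q_unit_cong) auto
    then have "c b * Q_unit e (- k) = 1" unfolding e by (simp add: Q_unit_def Q_omega_pow_0)
    then have "\<exists>d. c b * d = 1 \<and> (\<exists>e k. d = Q_unit e k)" by blast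
    then show ?thesis unfolding c'_def by (rule someI_ex)
  qed
  have keys: "keys (?f d x) \<subseteq> keys x" for d x
    by (auto simp: in_keys_iff lookup_diag)
  have inv: "?f c' (?f c x) = x" "?f c (?f c' x) = x" if "keys x \<subseteq> U" for x
  proof -
    have "lookup x b * (c b * c' b) = lookup x b" for b
    proof (cases "b \<in> keys x")
      case True
      then show ?thesis using c'[of b] that by auto
    qed (simp add: in_keys_iff)
    then show "?f c' (?f c x) = x" "?f c (?f c' x) = x"
      by (auto intro!: poly_mapping_eqI simp: lookup_diag ac_simps)
  qed
  have hom: "homogeneous m (?f d x)" if d: "\<And>b. b \<in> U \<Longrightarrow> \<exists>e k. d b = Q_unit e k" and x: "homogeneous m x" "keys x \<subseteq> U" for d x
    unfolding homogeneous_def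
  proof (intro ballI, clarify)
    fix b a e w assume b: "b \<in> keys (?f d x)" and k: "(a, e, w) \<in> keys (lookup (?f d x) b)"
    have bx: "b \<in> keys x" using keys b by blast
    obtain e' k' where "d b = Q_unit e' k'" using d bx x(2) by blast
    then obtain e'' w'' where "(a, e'', w'') \<in> keys (lookup x b)"
      using lookup_times_unit_degree k unfolding lookup_diag by metis
    then show "4 * a + basis_degree b = m" using x(1) bx unfolding homogeneous_def by fastforce
  qed
  show ?g1
    by (rule bij_betw_byWitness[where f' = "?f c'"])
      (use n inv keys in \<open>auto simp: subset_iff\<close>)
  show ?g2
  proof (intro equalityI subsetI)
    fix y assume "y \<in> F ` {x \<in> {x. keys x \<subseteq> U}. homogeneous m x}"
    then obtain x where "keys x \<subseteq> U" "homogeneous m x" "y = ?f c x" using n by auto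
    then show "y \<in> {x \<in> {x. keys x \<subseteq> U}. homogeneous m x}"
      using hom[of c x] c keys[of c x] by auto
  next
    fix y assume "y \<in> {x \<in> {x. keys x \<subseteq> U}. homogeneous m x}"
    then have y: "keys y \<subseteq> U" "homogeneous m y" by auto
    have k: "keys (?f c' y) \<subseteq> U" using keys[of c' y] y by auto
    have "homogeneous m (?f c' y)" using hom[of c' y] c' y by blast
    moreover have "F (?f c' y) = y" using n[OF k] inv(2)[OF y(1)] by simp
    ultimately show "y \<in> F ` {x \<in> {x. keys x \<subseteq> U}. homogeneous m x}"
      using k by (intro image_eqI[of _ F "?f c' y"]) auto
  qed
qed

text \<open>Serves the single blocks and the direct sum alike. As \<open>coeff_map \<Lambda>\<close>
  is only known to agree with \<open>coeff_total\<close> on elements supported in the block,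
  \<open>cl\<close> asks for agreement on products as well.\<close>

lemma iso_from_total:
  assumes U: "U \<subseteq> (\<Union>\<Lambda>\<in>{\<Lambda>. is_block \<Lambda>}. arc_basis \<Lambda>)"
    and F: "\<And>x. keys x \<subseteq> U \<Longrightarrow> F x = coeff_total x"
    and cl: "\<And>x y. keys x \<subseteq> U \<Longrightarrow> keys y \<subseteq> U \<Longrightarrow>
      F (arc_mult Q_alpha 1 1 x y) = coeff_total (arc_mult Q_alpha 1 1 x y)"
  shows "graded_algebra_iso ({x. keys x \<subseteq> U}, arc_mult Q_alpha 1 1)
    ({x. keys x \<subseteq> U}, arc_mult Q_alpha Q_eps Q_omega) F"
proof -
  note u = unit_iso[of U total_coeff F, OF total_coeff_unit F]
  have add: "F (x + y) = F x + F y" if "keys x \<subseteq> U" "keys y \<subseteq> U" for x y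
  proof -
    have "keys (x + y) \<subseteq> U" using that Poly_Mapping.keys_add[of x y] by blast
    then show ?thesis using that by (simp add: F lin_ext_add)
  qed
  have sm: "F (smult q x) = smult q (F x)" if "keys x \<subseteq> U" for q x
    using that order_trans[OF keys_smult that] by (simp add: F lin_ext_smult)
  have mult: "F (arc_mult Q_alpha 1 1 x y) = arc_mult Q_alpha Q_eps Q_omega (F x) (F y)"
    if "keys x \<subseteq> U" "keys y \<subseteq> U" for x y
    unfolding cl[OF that] F[OF that(1)] F[OF that(2)]
    by (rule coeff_total_mult) (use that U in blast)+
  show ?thesis
    unfolding graded_algebra_iso.simps using u add sm mult by simp
qed

lemma coeff_map_total:
  assumes "is_block \<Lambda>" "keys x \<subseteq> arc_basis \<Lambda>"
  shows "coeff_map \<Lambda> x = coeff_total x"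
  unfolding coeff_map_def
proof (rule lin_ext_cong)
  fix b assume "b \<in> keys x"
  then obtain \<xi> \<nu> \<mu> where b: "b = (\<xi>, \<nu>, \<mu>)" "\<xi> \<in> \<Lambda>" using assms(2) unfolding arc_basis_def by blast
  show "single b (basis_coeff \<Lambda> b) = single b (total_coeff b)"
    unfolding b(1) total_coeff_eq(1)[OF assms(1) b(2)] ..
qed

theorem proposition3p15:
  shows "(\<forall>\<Lambda>. balanced_block \<Lambda> \<longrightarrow>
            graded_algebra_iso (AKBN_block \<Lambda>) (AQ_block \<Lambda>) (coeff_map \<Lambda>)) \<and>
         (\<exists>coeff. (\<forall>\<Lambda>. balanced_block \<Lambda> \<longrightarrow> (\<forall>x\<in>arc_module \<Lambda>. coeff x = coeff_map \<Lambda> x)) \<and>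
            graded_algebra_iso AKBN AQ coeff)"
proof (intro conjI allI impI exI[of _ coeff_total] ballI)
  fix \<Lambda> assume "balanced_block \<Lambda>"
  then have b: "is_block \<Lambda>" unfolding balanced_block_def by blast
  show "graded_algebra_iso (AKBN_block \<Lambda>) (AQ_block \<Lambda>) (coeff_map \<Lambda>)"
    unfolding AKBN_block_def AQ_block_def arc_module_def
  proof (rule iso_from_total)
    fix x y :: "basis \<Rightarrow>\<^sub>0 Q" assume x: "keys x \<subseteq> arc_basis \<Lambda>"
    \<comment> \<open>A product stays in the block of its left factor, where both maps
      agree.\<close>
    have "keys (arc_mult Q_alpha 1 1 x y) \<subseteq> arc_basis \<Lambda>"
      unfolding arc_mult_def using x keys_basis_mult[OF b] by (intro keys_lin_ext) blast
    then show "coeff_map \<Lambda> (arc_mult Q_alpha 1 1 x y) = coeff_total (arc_mult Q_alpha 1 1 x y)"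
      by (rule coeff_map_total[OF b])
  qed (use b coeff_map_total[OF b] in auto)
  show "coeff_total x = coeff_map \<Lambda> x" if "x \<in> arc_module \<Lambda>" for x
    using coeff_map_total[OF b, of x] that unfolding arc_module_def by simp
next
  show "graded_algebra_iso AKBN AQ coeff_total"
    unfolding AKBN_def AQ_def total_module_def
    by (rule iso_from_total) (auto simp: balanced_block_def)
qed

end
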